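(* There exist only a finite number of minimal Fano polygons, up to the action of $GL_2(\mathbb{Z})$, with bounded maximal local index $m_{\mathcal{B}}$ of the cones in the residual baskets $\mathcal{B}$. That is, for every positive integer $K$ there are, up to the action of $GL_2(\mathbb{Z})$, only finitely many minimal Fano polygons $P$ whose residual basket $\mathcal{B}$ satisfies $m_{\mathcal{B}}\leq K$.
   Context: Let $N\cong\mathbb{Z}^2$, $N_{\mathbb{Q}}=N\otimes_{\mathbb{Z}}\mathbb{Q}$, $M=\operatorname{Hom}(N,\mathbb{Z})$. A Fano polygon is a convex polygon $P\subset N_{\mathbb{Q}}$ whose vertices are primitive lattice points of $N$ and which contains the origin in its strict interior; polygons are considered up to $GL_2(\mathbb{Z})$-equivalence. Residual basket. For an edge $E$ of $P$ with primitive inner normal $w_E\in M$, the height (local index) is $r_E=-w_E(E)>0$ and the width is $k_E=|E\cap N|-1$. Write $k_E=n_Er_E+k_0$ with $0\leq k_0<r_E$. The edge can be subdivided into $n_E$ lattice segments of width $r_E$ and, if $k_0\neq 0$, one lattice segment of width $k_0$; the cyclic quotient singularity $\sigma$ of the cone over this last segment is the residue of $E$, independent of the subdivision, and its Gorenstein index is $r_\sigma=r_E$. The residual basket $\mathcal{B}$ of $P$ is the cyclically ordered list of residues over all edges with $k_0\neq 0$. Set $m_{\mathcal{B}}=\max\{r_\sigma:\sigma\in\mathcal{B}\}$ if $\mathcal{B}\neq\varnothing$ and $m_{\mathcal{B}}=1$ if $\mathcal{B}=\varnothing$. Mutation. Let $w\in M$ be the primitive inner normal vector of an edge $E$ of $P$,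 let $h_{\min}=\min_{v\in P}w(v)=-r_E<0$ and $h_{\max}=\max_{v\in P}w(v)>0$. For $h\in\mathbb{Z}$ let $w_h(P)$ be the (possibly empty) convex hull of $\{v\in P\cap N: w(v)=h\}$. Let $v_E\in N$ be primitive with $w(v_E)=0$ (unique up to sign) and $F=\operatorname{conv}\{0,v_E\}$. Suppose that for every integer $h$ with $h_{\min}\leq h<0$ there is a (possibly empty) lattice polytope $G_h\subset N_{\mathbb{Q}}$ with $\{v \text{ a vertex of } P: w(v)=h\}\subseteq G_h+|h|F\subseteq w_h(P)$ (Minkowski sum, with $\varnothing+Q=\varnothing$). Then the mutation of $P$ is $\operatorname{mut}_w(P,F)=\operatorname{conv}\big(\bigcup_{h=h_{\min}}^{-1}G_h\cup\bigcup_{h=0}^{h_{\max}}(w_h(P)+hF)\big)$. It is again a Fano polygon, is independent of the choice of $\{G_h\}$, and up to $GL_2(\mathbb{Z})$ is independent of the sign of $v_E$. A Fano polygon $P$ is minimal if $|\partial P\cap N|\leq|\partial Q\cap N|$ for every mutation $Q=\operatorname{mut}_w(P,F)$ of $P$, where $\partial$ denotes the boundary. *)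

theory Defs
  imports "HOL-Analysis.Analysis"
begin

text \<open>
  The lattice \<open>N\<close> is the set of integral points of \<open>real^2\<close>. The vector space \<open>N \<otimes> \<rat>\<close> is replaced
  by \<open>N \<otimes> \<real> = real^2\<close>, so that the library's polytopes can be used: every polytope that occurs
  has lattice vertices, hence is determined by its rational points. The dual lattice
  \<open>M = Hom(N, \<int>)\<close> is identified with the integral points of \<open>real^2\<close> via the inner product,
  that is, \<open>w(v) = w \<bullet> v\<close>.
\<close>

definition lattice :: "(real^2) set" where
  "lattice = {v. \<forall>i. v $ i \<in> \<int>}"

definition primitive :: "real^2 \<Rightarrow> bool" where
  "primitive v \<longleftrightarrow> v \<in> lattice \<and>
     (\<forall>u\<in>lattice. \<forall>k::int. v = of_int k *\<^sub>R u \<longrightarrow> \<bar>k\<bar> = 1)"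

definition lattice_polytope :: "(real^2) set \<Rightarrow> bool" where
  "lattice_polytope G \<longleftrightarrow> (\<exists>V. finite V \<and> V \<subseteq> lattice \<and> G = convex hull V)"

definition GL2Z :: "(real^2^2) set" where
  "GL2Z = {A. (\<forall>i j. A $ i $ j \<in> \<int>) \<and> \<bar>det A\<bar> = 1}"

definition gl2z_rel :: "((real^2) set \<times> (real^2) set) set" where
  "gl2z_rel = {(X, Y). \<exists>A\<in>GL2Z. Y = (\<lambda>v. A *v v) ` X}"

definition fano_polygon :: "(real^2) set \<Rightarrow> bool" where
  "fano_polygon P \<longleftrightarrow> polytope P \<and> (\<forall>v. v extreme_point_of P \<longrightarrow> primitive v) \<and> 0 \<in> interior P"

definition inner_normal :: "(real^2) set \<Rightarrow> (real^2) set \<Rightarrow> real^2" where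
  "inner_normal P E = (THE w. primitive w \<and> E = {v\<in>P. \<forall>u\<in>P. w \<bullet> v \<le> w \<bullet> u})"

text \<open>The height (local index) \<open>r\<^sub>E = - w\<^sub>E(E)\<close> and the width \<open>k\<^sub>E\<close> of an edge.\<close>

definition local_index :: "(real^2) set \<Rightarrow> (real^2) set \<Rightarrow> nat" where
  "local_index P E = (THE r. \<forall>v\<in>E. inner_normal P E \<bullet> v = - real r)"

definition width :: "(real^2) set \<Rightarrow> nat" where
  "width E = card (E \<inter> lattice) - 1"

text \<open>
  \<open>S\<close> is the segment of width \<open>k\<^sub>0\<close> in some subdivision of \<open>E\<close> into \<open>n\<^sub>E\<close> segments of width \<open>r\<close>
  and one of width \<open>k\<^sub>0\<close>; \<open>i\<close> is the number of segments of width \<open>r\<close> between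
  the endpoint \<open>a\<close> of \<open>E\<close> and \<open>S\<close>. The intended \<open>E\<close> is an edge of a Fano polygon, so \<open>a\<close> is a
  lattice point.
\<close>

definition residual_segment :: "nat \<Rightarrow> (real^2) set \<Rightarrow> (real^2) set \<Rightarrow> bool" where
  "residual_segment r E S \<longleftrightarrow>
     (\<exists>a d i. primitive d \<and> E = closed_segment a (a + real (width E) *\<^sub>R d) \<and>
        i \<le> width E div r \<and>
        S = closed_segment (a + real (i * r) *\<^sub>R d) (a + real (i * r + width E mod r) *\<^sub>R d))"

text \<open>
  A cyclic quotient singularity is represented by the \<open>GL\<^sub>2(\<int>)\<close>-orbit of its cone. All
  segments \<open>S\<close> contributing to \<open>residue P E\<close> give the same orbit, so the set below is a single orbit.
\<close>

type_synonym singularity = "(real^2) set set"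

definition residue :: "(real^2) set \<Rightarrow> (real^2) set \<Rightarrow> singularity" where
  "residue P E = gl2z_rel `` {conic hull S | S. residual_segment (local_index P E) E S}"

definition ray_generators :: "(real^2) set \<Rightarrow> (real^2) set" where
  "ray_generators C = {u. primitive u \<and> (conic hull {u}) face_of C}"

text \<open>The least positive multiple of the canonical divisor of the toric surface of \<open>C\<close> that is Cartier.\<close>

definition cone_gorenstein_index :: "(real^2) set \<Rightarrow> nat" where
  "cone_gorenstein_index C =
     (LEAST r. 0 < r \<and> (\<exists>w\<in>lattice. \<forall>u\<in>ray_generators C. w \<bullet> u = real r))"

definition gorenstein_index :: "singularity \<Rightarrow> nat" where
  "gorenstein_index \<sigma> = the_elem (cone_gorenstein_index ` \<sigma>)"

text \<open>
  The edges in anticlockwise order, listed by the angle in \<open>[0, 2\<pi>)\<close> of their inner normals (distinct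
  edges have distinct angles). The choice of the first edge is immaterial: the residual basket is a
  cyclically ordered list, represented here by one of its linearizations.
\<close>

definition edges :: "(real^2) set \<Rightarrow> (real^2) set list" where
  "edges P = sorted_key_list_of_set
     (\<lambda>E. Arg2pi (Complex (inner_normal P E $ 1) (inner_normal P E $ 2))) {E. E edge_of P}"

definition residual_basket :: "(real^2) set \<Rightarrow> singularity list" where
  "residual_basket P =
     map (residue P) (filter (\<lambda>E. width E mod local_index P E \<noteq> 0) (edges P))"

definition max_local_index :: "singularity list \<Rightarrow> nat" where
  "max_local_index B = (if B = [] then 1 else Max (gorenstein_index ` set B))"

text \<open>\<open>slice P w h\<close> is \<open>w\<^sub>h(P)\<close>.\<close>

definition slice :: "(real^2) set \<Rightarrow> real^2 \<Rightarrow> int \<Rightarrow> (real^2) set" where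
  "slice P w h = convex hull {v \<in> P \<inter> lattice. w \<bullet> v = of_int h}"

definition h_min :: "(real^2) set \<Rightarrow> real^2 \<Rightarrow> real" where
  "h_min P w = (INF v\<in>P. w \<bullet> v)"

definition h_max :: "(real^2) set \<Rightarrow> real^2 \<Rightarrow> real" where
  "h_max P w = (SUP v\<in>P. w \<bullet> v)"

definition minkowski_sum :: "(real^2) set \<Rightarrow> (real^2) set \<Rightarrow> (real^2) set" where
  "minkowski_sum X Y = {x + y | x y. x \<in> X \<and> y \<in> Y}"

definition dilate :: "int \<Rightarrow> (real^2) set \<Rightarrow> (real^2) set" where
  "dilate h F = (\<lambda>v. of_int h *\<^sub>R v) ` F"

text \<open>
  \<open>Q\<close> is a mutation of \<open>P\<close>. As it depends on the sign of \<open>v\<^sub>E\<close>, and a priori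
  on the choice of the \<open>G\<^sub>h\<close>, this is a relation; both signs are allowed.
\<close>

definition is_mutation :: "(real^2) set \<Rightarrow> (real^2) set \<Rightarrow> bool" where
  "is_mutation P Q \<longleftrightarrow>
     (\<exists>E w v F G. E edge_of P \<and> w = inner_normal P E \<and>
        primitive v \<and> w \<bullet> v = 0 \<and> F = convex hull {0, v} \<and>
        (\<forall>h::int. h_min P w \<le> of_int h \<and> h < 0 \<longrightarrow>
           lattice_polytope (G h) \<and>
           {u. u extreme_point_of P \<and> w \<bullet> u = of_int h} \<subseteq> minkowski_sum (G h) (dilate \<bar>h\<bar> F) \<and>
           minkowski_sum (G h) (dilate \<bar>h\<bar> F) \<subseteq> slice P w h) \<and>
        Q = convex hull
          ((\<Union>h\<in>{h::int. h_min P w \<le> of_int h \<and> h < 0}. G h) \<union>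
           (\<Union>h\<in>{h::int. 0 \<le> h \<and> of_int h \<le> h_max P w}.
              minkowski_sum (slice P w h) (dilate h F))))"

definition minimal_fano_polygon :: "(real^2) set \<Rightarrow> bool" where
  "minimal_fano_polygon P \<longleftrightarrow> fano_polygon P \<and>
     (\<forall>Q. is_mutation P Q \<longrightarrow> card (frontier P \<inter> lattice) \<le> card (frontier Q \<inter> lattice))"

end

theory Submission
  imports Defs
begin

text \<open>
  Call an edge of height \<open>h\<close> \<^emph>\<open>high\<close> if \<open>h\<close> exceeds the bound \<open>K\<close> on the local indices of the residues.
  A high edge has no residue, since a residue has Gorenstein index \<open>h\<close>; so its width is a positive
  multiple of \<open>h\<close> (\<open>high_edge_width_dvd\<close>), and it can be mutated. In suitable coordinates the mutation
  leaves the left boundary of the polygon fixed and shears the right boundary. This raises the number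
  of boundary lattice points by at most \<open>M - h\<close>, where \<open>M\<close> is the extent of the polygon on the side
  opposite to the edge. A minimal polygon therefore extends at least as far opposite to a high edge
  as the edge is high (\<open>minimal_fano_polygon_long_edge\<close>).

  These two facts bound all heights by \<open>6 * max K 3\<close> (\<open>minimal_edge_height_bound\<close>). Suppose that the
  maximal height \<open>m\<close> is larger, and put an edge of this height at the bottom, with a point of it
  vertically below the origin. Since no edge is higher, the polygon stays in the vertical strip above the bottom
  edge. If the width of this edge is \<open>n * m\<close> with \<open>n \<ge> 2\<close>, a shear gives a second strip, and the points
  at height at least \<open>m\<close>, which exist by minimality, leave only a triangle. If \<open>n = 1\<close>, the strip has
  width \<open>m\<close>, while every high edge is at least as wide as it is high; this leaves room for few edges,
  and the upper ones have slope at most 3. All configurations are excluded by a handful of facts: two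
  edges cannot together be wider than the strip, minimality applies to high vertical edges, an
  integer greater than 2 cannot divide twice a number to which it is coprime, and low edges are low
  compared with \<open>m\<close>.

  If all heights are at most \<open>H\<close>, then there are only finitely many polygons up to \<open>GL\<^sub>2(\<int>)\<close>
  (\<open>bounded_height_normal_form\<close>). By the theorem of Caratheodory, some vertex \<open>v\<close> has \<open>- v / 2\<close> in the
  polygon. Normals are bounded along \<open>v\<close> because of these two points, and after a shear also across,
  because there are vertices on both sides of the line spanned by \<open>v\<close>. So the polygon is cut out by
  half planes from a finite list.
\<close>

section \<open>Lattice vectors and unimodular coordinates\<close>

lemma inner2: "(v::real^2) \<bullet> w = v$1*w$1 + v$2*w$2"
  by (simp add: inner_vec_def sum_2)

lemma eq2: "(v::real^2) = w \<longleftrightarrow> v$1 = w$1 \<and> v$2 = w$2"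
  by (simp add: vec_eq_iff forall_2)

lemma lattice2: "v \<in> lattice \<longleftrightarrow> v$1 \<in> \<int> \<and> v$2 \<in> \<int>"
  by (simp add: lattice_def forall_2)

lemma lattice_add [intro]: "u \<in> lattice \<Longrightarrow> v \<in> lattice \<Longrightarrow> u + v \<in> lattice"
  and lattice_diff [intro]: "u \<in> lattice \<Longrightarrow> v \<in> lattice \<Longrightarrow> u - v \<in> lattice"
  and lattice_minus [intro]: "u \<in> lattice \<Longrightarrow> - u \<in> lattice"
  and lattice_scaleR [intro]: "c \<in> \<int> \<Longrightarrow> u \<in> lattice \<Longrightarrow> c *\<^sub>R u \<in> lattice"
  by (auto simp: lattice2)

lemma lattice_inner: "u \<in> lattice \<Longrightarrow> v \<in> lattice \<Longrightarrow> u \<bullet> v \<in> \<int>"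
  by (simp add: lattice2 inner2)

lemma primitiveE:
  assumes "primitive v"
  obtains i j :: int where "coprime i j" "v$1 = of_int i" "v$2 = of_int j"
proof -
  from assms have "v \<in> lattice" by (simp add: primitive_def)
  then obtain i j :: int where ij: "v$1 = of_int i" "v$2 = of_int j"
    by (auto simp: lattice2 elim!: Ints_cases)
  define u :: "real^2" where "u = vector [of_int (i div gcd i j), of_int (j div gcd i j)]"
  have "u \<in> lattice" by (simp add: lattice2 u_def)
  moreover have "v = of_int (gcd i j) *\<^sub>R u"
    by (simp add: eq2 u_def ij flip: of_int_mult)
  ultimately have "\<bar>gcd i j\<bar> = 1" using assms unfolding primitive_def by blast
  then have "coprime i j" by (simp add: coprime_iff_gcd_eq_1)
  with ij that show thesis by blast
qed

lemma primitiveI: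
  assumes "coprime i j" "v$1 = of_int i" "v$2 = of_int j"
  shows "primitive v"
  unfolding primitive_def
proof (intro conjI ballI allI impI)
  show "v \<in> lattice" using assms by (simp add: lattice2)
  fix u :: "real^2" and k :: int
  assume u: "u \<in> lattice" "v = of_int k *\<^sub>R u"
  then obtain i' j' :: int where ij: "u$1 = of_int i'" "u$2 = of_int j'"
    by (auto simp: lattice2 elim!: Ints_cases)
  have "real_of_int i = of_int (k * i')" "real_of_int j = of_int (k * j')"
    using assms u ij by (simp_all add: eq2)
  then have "i = k * i'" "j = k * j'" by linarith+
  then have "is_unit k" using assms(1) by (meson coprime_common_divisor dvd_triv_left)
  then show "\<bar>k\<bar> = 1" by simp
qed

lemma primitive_in_lattice: "primitive v \<Longrightarrow> v \<in> lattice"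
  by (simp add: primitive_def)

lemma primitive_nonzero: "primitive v \<Longrightarrow> v \<noteq> 0"
  by (metis coprime_0_left_iff of_int_eq_0_iff primitiveE zero_index zdvd1_eq abs_zero zero_neq_one)

lemma primitive_uminus: "primitive v \<Longrightarrow> primitive (- v)"
  by (elim primitiveE, rule primitiveI[of "-_" "-_"]) auto

lemma primitive_dual:
  assumes "primitive v" obtains z where "z \<in> lattice" "v \<bullet> z = 1"
proof -
  obtain i j where ij: "coprime i j" "v$1 = of_int i" "v$2 = of_int j" using assms by (rule primitiveE)
  obtain a b where "a * i + b * j = 1" using ij(1) by (metis coprime_iff_gcd_eq_1 bezout_int)
  then have "real_of_int a * of_int i + of_int b * of_int j = 1"
    by (metis of_int_1 of_int_add of_int_mult)
  then show thesis using ij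
    by (intro that[of "vector [of_int a, of_int b]"]) (auto simp: lattice2 inner2 mult.commute)
qed

lemma primitive_scaleR_lattice:
  assumes "primitive v" "c *\<^sub>R v \<in> lattice" shows "c \<in> \<int>"
proof -
  obtain z where "z \<in> lattice" "v \<bullet> z = 1" using assms(1) by (rule primitive_dual)
  then show ?thesis using lattice_inner[OF assms(2)] by force
qed

lemma primitive_parallel:
  assumes "primitive v" "primitive w" "w = c *\<^sub>R v"
  shows "w = v \<or> w = - v"
proof -
  have "c \<in> \<int>" using assms primitive_scaleR_lattice primitive_in_lattice by metis
  then obtain k where "c = of_int k" by (rule Ints_cases)
  with assms have "\<bar>k\<bar> = 1" unfolding primitive_def by blast
  then have "k = 1 \<or> k = -1" by linarith
  then show ?thesis using \<open>c = of_int k\<close> assms(3) by auto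
qed

lemma nonzero_lattice_multiple_primitive:
  assumes "v \<in> lattice" "v \<noteq> 0"
  obtains u and k :: int where "primitive u" "k \<ge> 1" "v = of_int k *\<^sub>R u"
proof -
  obtain i j :: int where ij: "v$1 = of_int i" "v$2 = of_int j"
    using assms(1) by (auto simp: lattice2 elim!: Ints_cases)
  have nz: "i \<noteq> 0 \<or> j \<noteq> 0" using assms(2) ij by (auto simp: eq2)
  define u :: "real^2" where "u = vector [of_int (i div gcd i j), of_int (j div gcd i j)]"
  have "coprime (i div gcd i j) (j div gcd i j)" using nz by (rule div_gcd_coprime)
  then have "primitive u" by (rule primitiveI) (auto simp: u_def)
  moreover have "v = of_int (gcd i j) *\<^sub>R u"
    by (simp add: eq2 u_def ij flip: of_int_mult)
  moreover have "gcd i j \<ge> 1" using nz by (meson gcd_pos_int int_one_le_iff_zero_less)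
  ultimately show thesis using that by blast
qed

definition rot :: "real^2 \<Rightarrow> real^2" where
  "rot w = vector [- w$2, w$1]"

lemma rot_nth [simp]: "rot w $ 1 = - w$2" "rot w $ 2 = w$1"
  by (simp_all add: rot_def)

lemma inner_rot [simp]: "w \<bullet> rot w = 0"
  by (simp add: inner2)

lemma rot_rot: "rot (rot w) = - w"
  by (simp add: eq2)

lemma primitive_rot [simp]: "primitive (rot w) \<longleftrightarrow> primitive w"
proof -
  have *: "primitive (rot w)" if "primitive w" for w
    using that by (elim primitiveE, intro primitiveI[of "-_" "_"]) (auto simp: coprime_commute)
  show ?thesis using *[of w] *[of "rot w"] primitive_uminus[of "rot (rot w)"] by (auto simp: rot_rot)
qed

lemma orthogonal_parallel_rot:
  assumes "w \<bullet> v = 0" "w \<noteq> 0" obtains c where "v = c *\<^sub>R rot w"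
proof -
  have o: "w$1 * v$1 + w$2 * v$2 = 0" using assms(1) by (simp add: inner2)
  have pos: "w \<bullet> w \<noteq> 0" using assms(2) by simp
  have "(w \<bullet> w) * v$1 - (v \<bullet> rot w) * (- w$2) = w$1 * (w$1 * v$1 + w$2 * v$2)"
       "(w \<bullet> w) * v$2 - (v \<bullet> rot w) * w$1 = w$2 * (w$1 * v$1 + w$2 * v$2)"
    by (simp_all add: inner2 algebra_simps)
  then have "(w \<bullet> w) * v$1 = (v \<bullet> rot w) * (- w$2)" "(w \<bullet> w) * v$2 = (v \<bullet> rot w) * w$1"
    unfolding o by linarith+
  then have "v = ((v \<bullet> rot w) / (w \<bullet> w)) *\<^sub>R rot w"
    using pos unfolding eq2 vector_scaleR_component rot_nth real_scaleR_def times_divide_eq_left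
    by (metis nonzero_mult_div_cancel_left)
  then show thesis using that by blast
qed

text \<open>The inner products with the rows of a matrix in \<open>GL\<^sub>2(\<int>)\<close> are coordinates of the lattice.\<close>

definition unimodular :: "real^2 \<Rightarrow> real^2 \<Rightarrow> bool" where
  "unimodular e f \<longleftrightarrow> e \<in> lattice \<and> f \<in> lattice \<and> \<bar>e$1 * f$2 - e$2 * f$1\<bar> = 1"

text \<open>The inverse of the coordinates \<open>(e \<bullet> v, f \<bullet> v)\<close>. The determinant is its own inverse, so it
  can stand in place of a division.\<close>

definition point_at :: "real^2 \<Rightarrow> real^2 \<Rightarrow> real \<Rightarrow> real \<Rightarrow> real^2" where
  "point_at e f x y = (e$1 * f$2 - e$2 * f$1) *\<^sub>R vector [x * f$2 - y * e$2, y * e$1 - x * f$1]"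

lemma unimodular_det:
  assumes "unimodular e f"
  shows "(e$1 * f$2 - e$2 * f$1) * (e$1 * f$2 - e$2 * f$1) = 1"
proof -
  have "e$1 * f$2 - e$2 * f$1 = 1 \<or> e$1 * f$2 - e$2 * f$1 = -1"
    using assms unfolding unimodular_def by linarith
  then show ?thesis by auto
qed

lemma inner_point_at:
  assumes "unimodular e f"
  shows "e \<bullet> point_at e f x y = x" "f \<bullet> point_at e f x y = y"
proof -
  define D where "D = e$1 * f$2 - e$2 * f$1"
  have D: "D * D = 1" using unimodular_det[OF assms] by (simp add: D_def)
  have "e \<bullet> point_at e f x y = D * D * x"
    unfolding inner2 point_at_def D_def[symmetric] by (simp add: D_def algebra_simps)
  then show "e \<bullet> point_at e f x y = x" using D by simp
  have "f \<bullet> point_at e f x y = D * D * y"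
    unfolding inner2 point_at_def D_def[symmetric] by (simp add: D_def algebra_simps)
  then show "f \<bullet> point_at e f x y = y" using D by simp
qed

lemma point_at_inner:
  assumes "unimodular e f"
  shows "point_at e f (e \<bullet> v) (f \<bullet> v) = v"
proof -
  define D where "D = e$1 * f$2 - e$2 * f$1"
  have D: "D * D = 1" using unimodular_det[OF assms] by (simp add: D_def)
  have "point_at e f (e \<bullet> v) (f \<bullet> v) $ 1 = D * D * v$1" "point_at e f (e \<bullet> v) (f \<bullet> v) $ 2 = D * D * v$2"
    unfolding inner2 point_at_def D_def[symmetric] by (simp_all add: D_def algebra_simps)
  then show ?thesis using D by (simp add: eq2)
qed

lemma point_at_linear:
  "point_at e f (x + x') (y + y') = point_at e f x y + point_at e f x' y'"
  "point_at e f (c * x) (c * y) = c *\<^sub>R point_at e f x y"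
  by (simp_all add: point_at_def eq2 algebra_simps)

lemma point_at_lattice:
  assumes "unimodular e f"
  shows "point_at e f x y \<in> lattice \<longleftrightarrow> x \<in> \<int> \<and> y \<in> \<int>"
proof
  assume "point_at e f x y \<in> lattice"
  then show "x \<in> \<int> \<and> y \<in> \<int>"
    using assms lattice_inner inner_point_at[OF assms, of x y] unfolding unimodular_def by metis
next
  assume "x \<in> \<int> \<and> y \<in> \<int>"
  then show "point_at e f x y \<in> lattice"
    using assms by (auto simp: unimodular_def point_at_def lattice2)
qed

lemma lattice_coords:
  assumes "unimodular e f"
  shows "v \<in> lattice \<longleftrightarrow> e \<bullet> v \<in> \<int> \<and> f \<bullet> v \<in> \<int>"
  by (metis assms point_at_inner point_at_lattice)

lemma coords_eqI:
  assumes "unimodular e f" "e \<bullet> v = e \<bullet> w" "f \<bullet> v = f \<bullet> w" shows "v = w"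
  by (metis assms point_at_inner)

lemma primitive_coords:
  assumes "unimodular e f" "primitive v"
  obtains i j where "coprime i j" "e \<bullet> v = of_int i" "f \<bullet> v = of_int j"
proof -
  have "e \<bullet> v \<in> \<int>" "f \<bullet> v \<in> \<int>" using assms lattice_coords primitive_in_lattice by blast+
  then obtain i j :: int where ij: "e \<bullet> v = of_int i" "f \<bullet> v = of_int j" by (auto elim!: Ints_cases)
  have "coprime i j"
  proof (rule coprimeI)
    fix c assume "c dvd i" "c dvd j"
    then obtain i' j' where c: "i = c * i'" "j = c * j'" by (auto elim!: dvdE)
    have "v = of_int c *\<^sub>R point_at e f (of_int i') (of_int j')"
      by (metis assms(1) ij c of_int_mult point_at_linear(2) point_at_inner)
    moreover have "point_at e f (of_int i') (of_int j') \<in> lattice"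
      using assms(1) by (simp add: point_at_lattice)
    ultimately have "\<bar>c\<bar> = 1" using assms(2) unfolding primitive_def by blast
    then show "is_unit c" by simp
  qed
  with ij that show thesis by blast
qed

lemma unimodular_complement:
  assumes "primitive f" obtains e where "unimodular e f"
proof -
  obtain z where "z \<in> lattice" "f \<bullet> z = 1" using assms by (rule primitive_dual)
  then have "unimodular (- rot z) f"
    using assms by (auto simp: unimodular_def lattice2 inner2 primitive_in_lattice mult.commute
       dest: primitive_in_lattice)
  then show thesis using that by blast
qed

lemma unimodular_shear: "unimodular e f \<Longrightarrow> unimodular (e + of_int j *\<^sub>R f) f"
  by (auto simp: unimodular_def algebra_simps intro!: lattice_add lattice_scaleR)

lemma unimodular_flip: "unimodular e f \<Longrightarrow> unimodular (- e) f"
  by (auto simp: unimodular_def algebra_simps)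

section \<open>Edges as supporting lines\<close>

abbreviation edge_at :: "(real^2) set \<Rightarrow> real^2 \<Rightarrow> int \<Rightarrow> (real^2) set" where
  "edge_at P w h \<equiv> {v\<in>P. w \<bullet> v = - of_int h}"

text \<open>An edge is handled through its primitive inner normal \<open>w\<close> and its height \<open>h\<close>. This needs linear
  inequalities only, and no definite description; the lemmas below translate between the two views.\<close>

definition edge_line :: "(real^2) set \<Rightarrow> real^2 \<Rightarrow> int \<Rightarrow> bool" where
  "edge_line P w h \<longleftrightarrow> primitive w \<and> (\<forall>v\<in>P. - of_int h \<le> w \<bullet> v) \<and>
     (\<exists>u\<in>P. \<exists>v\<in>P. u \<noteq> v \<and> w \<bullet> u = - of_int h \<and> w \<bullet> v = - of_int h)"

lemma fano_polygonD:
  assumes "fano_polygon P"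
  shows "polytope P" "convex P" "compact P" "bounded P" "closed P" "0 \<in> P" "0 \<in> interior P"
    "P = convex hull {v. v extreme_point_of P}" "finite {v. v extreme_point_of P}"
    "v extreme_point_of P \<Longrightarrow> primitive v"
proof -
  show p: "polytope P" and i: "0 \<in> interior P" and "v extreme_point_of P \<Longrightarrow> primitive v"
    using assms by (auto simp: fano_polygon_def)
  show "0 \<in> P" using i interior_subset by blast
  show "convex P" "compact P" "bounded P" "closed P"
    using p by (simp_all add: polytope_imp_convex polytope_imp_compact polytope_imp_bounded polytope_imp_closed)
  then show "P = convex hull {v. v extreme_point_of P}" by (simp add: Krein_Milman_Minkowski)
  show "finite {v. v extreme_point_of P}"
    using p finite_polyhedron_extreme_points polytope_imp_polyhedron by blast
qed

lemma fano_polygon_aff_dim: "fano_polygon P \<Longrightarrow> aff_dim P = 2"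
  using aff_dim_nonempty_interior[of P] by (auto simp: fano_polygon_def)

lemma edge_of_fano_polygon_segment:
  assumes "fano_polygon P" "E edge_of P"
  obtains u d and k :: int where "primitive d" "k \<ge> 1" "primitive u" "primitive (u + of_int k *\<^sub>R d)"
    "E = closed_segment u (u + of_int k *\<^sub>R d)"
proof -
  note P = fano_polygonD[OF assms(1)]
  have E: "E face_of P" "aff_dim E = 1" using assms(2) by (auto simp: edge_of_def)
  then have "polytope E" using P(1) face_of_polytope_polytope by blast
  then have "collinear E" "convex E" "compact E" "E \<noteq> {}"
    using E by (auto simp: collinear_aff_dim polytope_imp_convex polytope_imp_compact)
  then obtain u v where uv: "E = closed_segment u v"
    by (metis compact_convex_collinear_segment)
  have "u \<noteq> v" using E(2) uv by auto
  have "u extreme_point_of E" "v extreme_point_of E" by (simp_all add: uv extreme_point_of_segment)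
  then have pr: "primitive u" "primitive v" using P(10) extreme_point_of_face[OF E(1)] by blast+
  then have "v - u \<in> lattice" "v - u \<noteq> 0" using \<open>u \<noteq> v\<close> by (auto simp: primitive_in_lattice)
  then obtain d and k :: int where "primitive d" "k \<ge> 1" "v - u = of_int k *\<^sub>R d"
    by (rule nonzero_lattice_multiple_primitive)
  then show thesis using that[of d k u] pr uv by (simp add: algebra_simps)
qed

text \<open>Faces of a polytope are exposed. The exposing functional vanishes on the lattice direction of the
  edge, so it is a multiple of the quarter turn of that direction, which is primitive.\<close>

lemma edge_of_imp_edge_line:
  assumes "fano_polygon P" "E edge_of P"
  obtains w h where "edge_line P w h" "E = edge_at P w h"
proof -
  note P = fano_polygonD[OF assms(1)]
  obtain u d and k :: int where u: "primitive d" "k \<ge> 1" "primitive u" "primitive (u + of_int k *\<^sub>R d)"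
    "E = closed_segment u (u + of_int k *\<^sub>R d)"
    using edge_of_fano_polygon_segment[OF assms] .
  have E: "E face_of P" "aff_dim E = 1" using assms(2) by (auto simp: edge_of_def)
  then have "E exposed_face_of P"
    using P(1) exposed_face_of_polyhedron polytope_imp_polyhedron by blast
  then obtain a b where ab: "P \<subseteq> {x. a \<bullet> x \<le> b}" "E = P \<inter> {x. a \<bullet> x = b}"
    unfolding exposed_face_of_def by blast
  have ends: "u \<in> E" "u + of_int k *\<^sub>R d \<in> E" by (simp_all add: u(5))
  have "a \<noteq> 0"
  proof
    assume "a = 0"
    then have "E = P" using ab ends by auto
    then show False using E(2) fano_polygon_aff_dim[OF assms(1)] by simp
  qed
  have "a \<bullet> (u + of_int k *\<^sub>R d) = a \<bullet> u" using ends ab(2) by auto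
  then have "d \<bullet> a = 0" using u(2) by (simp add: inner_add_right inner_commute)
  then obtain c where c: "a = c *\<^sub>R rot d"
    using orthogonal_parallel_rot primitive_nonzero[OF u(1)] by blast
  define w where "w = (if c > 0 then - rot d else rot d)"
  have aw: "a = (- \<bar>c\<bar>) *\<^sub>R w" and "c \<noteq> 0" using c \<open>a \<noteq> 0\<close> by (auto simp: w_def)
  have w: "primitive w" using u(1) by (auto simp: w_def primitive_uminus)
  obtain h where h: "- (w \<bullet> u) = of_int h"
    by (meson Ints_cases Ints_minus lattice_inner primitive_in_lattice w u(3))
  have "b = - \<bar>c\<bar> * (w \<bullet> u)" using ends(1) ab(2) aw by auto
  then have b: "b = \<bar>c\<bar> * of_int h" using h by (metis mult_minus_left mult_minus_right)
  have pos: "\<bar>c\<bar> > 0" using \<open>c \<noteq> 0\<close> by simp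
  have le: "a \<bullet> x \<le> b \<longleftrightarrow> - of_int h \<le> w \<bullet> x" and eq: "a \<bullet> x = b \<longleftrightarrow> w \<bullet> x = - of_int h" for x
  proof -
    have "a \<bullet> x \<le> b \<longleftrightarrow> \<bar>c\<bar> * (- (w \<bullet> x)) \<le> \<bar>c\<bar> * of_int h" unfolding aw b by simp
    also have "\<dots> \<longleftrightarrow> - (w \<bullet> x) \<le> of_int h" using pos by (simp only: mult_le_cancel_left_pos)
    finally show "a \<bullet> x \<le> b \<longleftrightarrow> - of_int h \<le> w \<bullet> x" by linarith
    have "a \<bullet> x = b \<longleftrightarrow> \<bar>c\<bar> * (- (w \<bullet> x)) = \<bar>c\<bar> * of_int h" unfolding aw b by simp
    also have "\<dots> \<longleftrightarrow> - (w \<bullet> x) = of_int h" using pos unfolding mult_cancel_left by simp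
    finally show "a \<bullet> x = b \<longleftrightarrow> w \<bullet> x = - of_int h" by linarith
  qed
  have Eeq: "E = edge_at P w h" using ab(2) eq by auto
  have "u \<noteq> u + of_int k *\<^sub>R d" using u(1,2) primitive_nonzero by auto
  then have "edge_line P w h"
    unfolding edge_line_def using w ab(1) le Eeq ends by blast
  then show thesis using that Eeq by blast
qed

lemma edge_line_height_pos:
  assumes "fano_polygon P" "edge_line P w h" shows "h > 0"
proof -
  obtain r where r: "r > 0" "ball 0 r \<subseteq> P"
    using fano_polygonD(7)[OF assms(1)] mem_interior by blast
  have w: "primitive w" "\<forall>v\<in>P. - of_int h \<le> w \<bullet> v" using assms(2) by (auto simp: edge_line_def)
  define t where "t = r / (2 * norm w)"
  have nw: "norm w > 0" using primitive_nonzero[OF w(1)] by simp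
  have "(- t) *\<^sub>R w \<in> ball 0 r" using r nw by (simp add: t_def)
  then have "- of_int h \<le> w \<bullet> ((- t) *\<^sub>R w)" using r w(2) by blast
  moreover have "w \<bullet> ((- t) *\<^sub>R w) < 0" using r nw by (simp add: t_def)
  ultimately show ?thesis by linarith
qed

lemma edge_line_edge_of:
  assumes "fano_polygon P" "edge_line P w h"
  shows "edge_at P w h edge_of P"
proof -
  let ?E = "edge_at P w h"
  have w: "primitive w" "\<forall>v\<in>P. - of_int h \<le> w \<bullet> v" using assms(2) by (auto simp: edge_line_def)
  have E: "?E = P \<inter> {v. w \<bullet> v = - of_int h}" by auto
  have "?E face_of P" unfolding E
    by (rule face_of_Int_supporting_hyperplane_ge) (use w fano_polygonD[OF assms(1)] in auto)
  moreover have "aff_dim ?E \<le> aff_dim {v. w \<bullet> v = - of_int h}" by (rule aff_dim_subset) auto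
  then have "aff_dim ?E \<le> 1" using primitive_nonzero[OF w(1)] by (simp add: aff_dim_hyperplane)
  moreover obtain u v where "u \<in> ?E" "v \<in> ?E" "u \<noteq> v" using assms(2) unfolding edge_line_def by blast
  then have "aff_dim {u, v} \<le> aff_dim ?E" by (intro aff_dim_subset) blast
  moreover have "aff_dim {u, v} = 1" using \<open>u \<noteq> v\<close> by (simp add: aff_dim_2)
  ultimately show ?thesis by (simp add: edge_of_def)
qed

lemma edge_line_segment:
  assumes "fano_polygon P" "edge_line P w h"
  obtains u and k :: int where "k \<ge> 1" "primitive u" "primitive (u + of_int k *\<^sub>R rot w)"
    "edge_at P w h = closed_segment u (u + of_int k *\<^sub>R rot w)"
proof -
  let ?E = "edge_at P w h"
  have w: "primitive w" using assms(2) by (auto simp: edge_line_def)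
  obtain u d and k :: int where u: "primitive d" "k \<ge> 1" "primitive u" "primitive (u + of_int k *\<^sub>R d)"
    "?E = closed_segment u (u + of_int k *\<^sub>R d)"
    using edge_of_fano_polygon_segment[OF assms(1) edge_line_edge_of[OF assms]] .
  have "u \<in> ?E" "u + of_int k *\<^sub>R d \<in> ?E" unfolding u(5) by simp_all
  then have "w \<bullet> d = 0" using u(2) by (auto simp: inner_add_right)
  then obtain c where "d = c *\<^sub>R rot w"
    using orthogonal_parallel_rot primitive_nonzero[OF w] by blast
  then have "d = rot w \<or> d = - rot w" using primitive_parallel w u(1) primitive_rot by blast
  then show thesis
  proof
    assume "d = rot w" then show thesis using that u by blast
  next
    assume d: "d = - rot w"
    define u' where "u' = u + of_int k *\<^sub>R d"
    have "u = u' + of_int k *\<^sub>R rot w" by (simp add: u'_def d)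
    then show thesis using that[of k u'] u closed_segment_commute unfolding u'_def by metis
  qed
qed

text \<open>A normal is orthogonal to the edge and primitive, so only its sign is in doubt, and the sign is
  fixed because the origin lies inside.\<close>

lemma edge_line_inner_normal:
  assumes "fano_polygon P" "edge_line P w h"
  shows "inner_normal P (edge_at P w h) = w"
proof -
  let ?E = "edge_at P w h"
  have w: "primitive w" "\<forall>v\<in>P. - of_int h \<le> w \<bullet> v" using assms(2) by (auto simp: edge_line_def)
  obtain u v where uv: "u \<in> P" "v \<in> P" "u \<noteq> v" "w \<bullet> u = - of_int h" "w \<bullet> v = - of_int h"
    using assms(2) unfolding edge_line_def by blast
  show ?thesis unfolding inner_normal_def
  proof (rule the_equality)
    show "primitive w \<and> ?E = {v \<in> P. \<forall>u\<in>P. w \<bullet> v \<le> w \<bullet> u}"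
    proof (intro conjI w(1) Collect_cong)
      show "v \<in> P \<and> w \<bullet> v = - of_int h \<longleftrightarrow> v \<in> P \<and> (\<forall>u\<in>P. w \<bullet> v \<le> w \<bullet> u)" for v
        using w(2) uv(1,4) by (metis order.antisym)
    qed
  next
    fix w' assume w': "primitive w' \<and> ?E = {v \<in> P. \<forall>u\<in>P. w' \<bullet> v \<le> w' \<bullet> u}"
    then have min: "\<forall>x\<in>P. w' \<bullet> u \<le> w' \<bullet> x" "\<forall>x\<in>P. w' \<bullet> v \<le> w' \<bullet> x" using uv by auto
    then have "w' \<bullet> u = w' \<bullet> v" using uv by (simp add: order.antisym)
    then have 1: "w' \<bullet> (v - u) = 0" by (simp add: inner_diff_right)
    have 2: "w \<bullet> (v - u) = 0" using uv by (simp add: inner_diff_right)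
    obtain c where c: "v - u = c *\<^sub>R rot w" using orthogonal_parallel_rot[OF 2] primitive_nonzero w by blast
    then have "rot w \<bullet> w' = 0" using 1 uv(3) by (auto simp: inner_commute)
    then obtain c' where "w' = c' *\<^sub>R rot (rot w)"
      using orthogonal_parallel_rot primitive_nonzero w primitive_rot by metis
    then have "w' = (- c') *\<^sub>R w" by (simp add: rot_rot)
    then have "w' = w \<or> w' = - w" using primitive_parallel w w' by blast
    moreover have False if "w' = - w"
      using min(1) uv(4) that fano_polygonD(6)[OF assms(1)] edge_line_height_pos[OF assms] by fastforce
    ultimately show "w' = w" by blast
  qed
qed

lemma edge_line_local_index:
  assumes "fano_polygon P" "edge_line P w h"
  shows "local_index P (edge_at P w h) = nat h"
proof -
  obtain u where "u \<in> P" "w \<bullet> u = - of_int h" using assms(2) unfolding edge_line_def by blast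
  moreover have "h > 0" by (rule edge_line_height_pos[OF assms])
  ultimately show ?thesis
    unfolding local_index_def edge_line_inner_normal[OF assms]
  proof (intro the_equality)
    fix r assume "\<forall>v\<in>{v \<in> P. w \<bullet> v = - real_of_int h}. w \<bullet> v = - real r"
    then have "real r = of_int h" using \<open>u \<in> P\<close> \<open>w \<bullet> u = - of_int h\<close> by force
    then show "r = nat h" by linarith
  qed simp
qed

lemma lattice_segment_points:
  assumes "primitive d" "u \<in> lattice" "k \<ge> 0"
  shows "closed_segment u (u + of_int k *\<^sub>R d) \<inter> lattice = (\<lambda>i::int. u + of_int i *\<^sub>R d) ` {0..k}"
proof (intro equalityI subsetI)
  fix x assume x: "x \<in> closed_segment u (u + of_int k *\<^sub>R d) \<inter> lattice"
  then obtain t where t: "0 \<le> t" "t \<le> 1" "x = u + (t * of_int k) *\<^sub>R d"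
    by (auto simp: in_segment algebra_simps)
  then have "(t * of_int k) *\<^sub>R d \<in> lattice" using x lattice_diff[of x u] assms(2) by (simp add: algebra_simps)
  then obtain i where i: "t * of_int k = of_int i" using primitive_scaleR_lattice[OF assms(1)] Ints_cases by metis
  have "0 \<le> t * of_int k" "t * of_int k \<le> of_int k" using t assms(3) by (simp_all add: mult_left_le_one_le)
  then have "i \<in> {0..k}" unfolding i by auto
  then show "x \<in> (\<lambda>i::int. u + of_int i *\<^sub>R d) ` {0..k}" using t(3) i by auto
next
  fix x assume "x \<in> (\<lambda>i::int. u + of_int i *\<^sub>R d) ` {0..k}"
  then obtain i where i: "0 \<le> i" "i \<le> k" "x = u + of_int i *\<^sub>R d" by auto
  have "x \<in> lattice" using i assms primitive_in_lattice[OF assms(1)] by (auto intro!: lattice_add lattice_scaleR)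
  moreover have "x \<in> closed_segment u (u + of_int k *\<^sub>R d)"
  proof (cases "k = 0")
    case False
    have "x = (1 - of_int i / of_int k) *\<^sub>R u + (of_int i / of_int k) *\<^sub>R (u + of_int k *\<^sub>R d)"
      using False i by (simp add: algebra_simps)
    moreover have "0 \<le> real_of_int i / of_int k" "real_of_int i / of_int k \<le> 1"
      using i False by (auto simp: divide_le_eq)
    ultimately show ?thesis unfolding in_segment by blast
  qed (use i in auto)
  ultimately show "x \<in> closed_segment u (u + of_int k *\<^sub>R d) \<inter> lattice" by blast
qed

lemma width_segment:
  assumes "primitive d" "u \<in> lattice" "k \<ge> 0"
  shows "width (closed_segment u (u + of_int k *\<^sub>R d)) = nat k"
proof -
  have "inj_on (\<lambda>i::int. u + of_int i *\<^sub>R d) {0..k}"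
    using primitive_nonzero[OF assms(1)] by (auto simp: inj_on_def)
  then show ?thesis
    unfolding width_def lattice_segment_points[OF assms] using assms(3) by (simp add: card_image)
qed

lemma finite_edge_lines:
  assumes "fano_polygon P" shows "finite {(w, h). edge_line P w h}"
proof -
  let ?f = "\<lambda>E. (inner_normal P E, int (local_index P E))"
  have "finite {E. E edge_of P}"
    using finite_polytope_faces[OF fano_polygonD(1)[OF assms]] by (rule finite_subset[rotated]) (auto simp: edge_of_def)
  then have "finite (?f ` {E. E edge_of P})" by simp
  moreover have "{(w, h). edge_line P w h} \<subseteq> ?f ` {E. E edge_of P}"
  proof clarify
    fix w h assume e: "edge_line P w h"
    then have "?f (edge_at P w h) = (w, h)"
      using edge_line_inner_normal[OF assms e] edge_line_local_index[OF assms e] edge_line_height_pos[OF assms e] by simp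
    then show "(w, h) \<in> ?f ` {E. E edge_of P}"
      using edge_line_edge_of[OF assms e] by (metis (no_types, lifting) mem_Collect_eq rev_image_eqI)
  qed
  ultimately show ?thesis by (rule finite_subset[rotated])
qed

text \<open>The ray from the origin to a point outside leaves the polygon through an edge, and the inequality
  of that edge fails from there on.\<close>

lemma fano_polygon_halfspaces:
  assumes "fano_polygon P" "\<And>w h. edge_line P w h \<Longrightarrow> - of_int h \<le> w \<bullet> z"
  shows "z \<in> P"
proof (rule ccontr)
  assume z: "z \<notin> P"
  note P = fano_polygonD[OF assms(1)]
  have "z \<noteq> 0" using z P(6) by blast
  obtain d where d: "d > 0" "0 + d *\<^sub>R z \<in> frontier P" "\<And>e. 0 \<le> e \<Longrightarrow> e < d \<Longrightarrow> 0 + e *\<^sub>R z \<in> interior P"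
    using ray_to_frontier[OF P(4,7) \<open>z \<noteq> 0\<close>] by blast
  have dP: "d *\<^sub>R z \<in> P" using d(2) P(5) frontier_subset_closed by auto
  have "d \<noteq> 1" using dP z by auto
  moreover have "d \<le> 1" using d(3)[of 1] z interior_subset by force
  ultimately have "d < 1" by linarith
  have "rel_interior P = interior P" using P(7) by (metis empty_iff rel_interior_nonempty_interior)
  then have "d *\<^sub>R z \<in> P - rel_interior P" using dP d(2) by (simp add: frontier_def)
  then obtain F where F: "F facet_of P" "d *\<^sub>R z \<in> F"
    using rel_boundary_of_polyhedron[OF polytope_imp_polyhedron[OF P(1)]] by auto
  have "F edge_of P" using F(1) fano_polygon_aff_dim[OF assms(1)] by (simp add: facet_of_def edge_of_def)
  then obtain w h where e: "edge_line P w h" "F = edge_at P w h"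
    using edge_of_imp_edge_line[OF assms(1)] by blast
  have "d * (w \<bullet> z) = - of_int h" using F(2) e(2) by auto
  moreover have "- of_int h \<le> w \<bullet> z" "h > 0" using assms e(1) edge_line_height_pos by auto
  moreover have "d * (- of_int h) \<le> d * (w \<bullet> z)" using d(1) calculation(2) by (intro mult_left_mono) auto
  ultimately have "of_int h \<le> d * of_int h" by simp
  then show False using \<open>d < 1\<close> \<open>h > 0\<close> by simp
qed

text \<open>A local form of adjacency. Only finitely many inequalities describe the polygon, so one can move a
  little in direction \<open>v\<close> unless an inequality that is tight at \<open>z\<close> forbids it. Applied at the end of
  an edge, this yields the next edge together with a bound on its slope.\<close>

lemma tight_edge_line:
  assumes "fano_polygon P" "z \<in> P" "\<And>t. t > 0 \<Longrightarrow> z + t *\<^sub>R v \<notin> P"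
  obtains w h where "edge_line P w h" "w \<bullet> z = - of_int h" "w \<bullet> v < 0"
proof -
  have "\<exists>w h. edge_line P w h \<and> w \<bullet> z = - of_int h \<and> w \<bullet> v < 0"
  proof (rule ccontr)
    assume *: "\<not> ?thesis"
    have "\<forall>\<^sub>F t in at_right (0::real). - of_int h \<le> w \<bullet> (z + t *\<^sub>R v)" if e: "edge_line P w h" for w h
    proof (cases "w \<bullet> z = - of_int h")
      case True
      with * e have "w \<bullet> v \<ge> 0" by force
      then show ?thesis using True
        by (intro eventually_at_rightI[of 0 1]) (auto simp: inner_add_right)
    next
      case False
      then have "w \<bullet> z > - of_int h" using e assms(2) unfolding edge_line_def by force
      moreover have "((\<lambda>t. w \<bullet> (z + t *\<^sub>R v)) \<longlongrightarrow> w \<bullet> (z + 0 *\<^sub>R v)) (at_right 0)"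
        by (intro tendsto_intros)
      ultimately have "\<forall>\<^sub>F t in at_right (0::real). - of_int h < w \<bullet> (z + t *\<^sub>R v)"
        by (intro order_tendstoD(1)) auto
      then show ?thesis by (rule eventually_mono) simp
    qed
    then have "\<forall>\<^sub>F t in at_right (0::real). \<forall>(w, h)\<in>{(w, h). edge_line P w h}. - of_int h \<le> w \<bullet> (z + t *\<^sub>R v)"
      by (intro eventually_ball_finite[OF finite_edge_lines[OF assms(1)]]) auto
    then have "\<forall>\<^sub>F t in at_right (0::real). z + t *\<^sub>R v \<in> P"
      by (rule eventually_mono) (auto intro!: fano_polygon_halfspaces[OF assms(1)])
    then obtain b where "b > 0" "\<forall>t>0. t < b \<longrightarrow> z + t *\<^sub>R v \<in> P" 
      unfolding eventually_at_right_field by blast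
    then show False using assms(3)[of "b/2"] by auto
  qed
  then show thesis using that by blast
qed

section \<open>Gorenstein indices of residues\<close>

lemma primitive_if_dual:
  assumes "v \<in> lattice" "z \<in> lattice" "v \<bullet> z = 1" shows "primitive v"
  unfolding primitive_def
proof (intro conjI assms(1) ballI allI impI)
  fix u and k :: int assume u: "u \<in> lattice" "v = of_int k *\<^sub>R u"
  obtain j :: int where j: "u \<bullet> z = of_int j" using lattice_inner[OF u(1) assms(2)] Ints_cases by metis
  have "real_of_int (k * j) = 1" using assms(3) u(2) j by simp
  then have "k * j = 1" by linarith
  then show "\<bar>k\<bar> = 1" by (metis abs_zmult_eq_1 abs_one)
qed

lemma GL2Z_unimodular: "A \<in> GL2Z \<longleftrightarrow> unimodular (A$1) (A$2)"
  by (auto simp: GL2Z_def unimodular_def lattice2 det_2 forall_2)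

text \<open>The action of the matrix on the dual lattice, which carries normals along with the polygon.\<close>

lemma GL2Z_dual:
  assumes "A \<in> GL2Z" "w \<in> lattice"
  obtains w' where "w' \<in> lattice" "\<And>v. w' \<bullet> (A *v v) = w \<bullet> v"
proof -
  have u: "unimodular (A$1) (A$2)" using assms(1) by (simp add: GL2Z_unimodular)
  let ?p = "point_at (A$1) (A$2)"
  define w' :: "real^2" where "w' = vector [w \<bullet> ?p 1 0, w \<bullet> ?p 0 1]"
  have "w' \<in> lattice" using lattice_inner[OF assms(2)] point_at_lattice[OF u] by (simp add: lattice2 w'_def)
  moreover have "w' \<bullet> (A *v v) = w \<bullet> v" for v
  proof -
    have "v = ?p (A$1 \<bullet> v * 1 + A$2 \<bullet> v * 0) (A$1 \<bullet> v * 0 + A$2 \<bullet> v * 1)"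
      using point_at_inner[OF u] by simp
    then have "v = (A$1 \<bullet> v) *\<^sub>R ?p 1 0 + (A$2 \<bullet> v) *\<^sub>R ?p 0 1"
      by (simp only: point_at_linear)
    then have "w \<bullet> v = w \<bullet> ((A$1 \<bullet> v) *\<^sub>R ?p 1 0 + (A$2 \<bullet> v) *\<^sub>R ?p 0 1)" by simp
    then show ?thesis
      unfolding inner2[of w' "A *v v"]
      by (simp add: w'_def matrix_vector_mul_component inner_add_right mult.commute)
  qed
  ultimately show thesis using that by blast
qed

lemma GL2Z_lattice: "A \<in> GL2Z \<Longrightarrow> v \<in> lattice \<Longrightarrow> A *v v \<in> lattice"
  by (simp add: GL2Z_unimodular unimodular_def lattice2[of "A *v v"] matrix_vector_mul_component lattice_inner)

lemma GL2Z_primitive: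
  assumes "A \<in> GL2Z" "primitive v" shows "primitive (A *v v)"
proof -
  obtain z where z: "z \<in> lattice" "v \<bullet> z = 1" using primitive_dual[OF assms(2)] .
  obtain z' where z': "z' \<in> lattice" "\<And>v. z' \<bullet> (A *v v) = z \<bullet> v" using GL2Z_dual[OF assms(1) z(1)] by blast
  show ?thesis
  proof (rule primitive_if_dual[OF _ z'(1)])
    show "A *v v \<in> lattice" using assms by (simp add: GL2Z_lattice primitive_in_lattice)
    show "(A *v v) \<bullet> z' = 1" using z'(2) z(2) by (simp add: inner_commute)
  qed
qed

lemma GL2Z_primitive_dual:
  assumes "A \<in> GL2Z" "primitive w"
  obtains w' where "primitive w'" "\<And>v. w' \<bullet> (A *v v) = w \<bullet> v"
proof -
  obtain w' where w': "w' \<in> lattice" "\<And>v. w' \<bullet> (A *v v) = w \<bullet> v"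
    using GL2Z_dual[OF assms(1) primitive_in_lattice[OF assms(2)]] by blast
  obtain z where z: "z \<in> lattice" "w \<bullet> z = 1" using primitive_dual[OF assms(2)] .
  have "primitive w'" using primitive_if_dual[OF w'(1) GL2Z_lattice[OF assms(1) z(1)]] z w' by simp
  then show thesis using that w' by blast
qed

lemma gl2z_rel_refl: "(X, X) \<in> gl2z_rel"
proof -
  have "mat 1 \<in> GL2Z" by (simp add: GL2Z_unimodular unimodular_def lattice2 mat_def)
  then show ?thesis unfolding gl2z_rel_def by (auto intro!: bexI[of _ "mat 1"])
qed

lemma conic_hull_segment:
  "conic hull (closed_segment p q) = {s *\<^sub>R p + t *\<^sub>R q | s t. 0 \<le> s \<and> 0 \<le> (t::real)}"
proof (intro equalityI subsetI)
  fix x assume "x \<in> conic hull (closed_segment p q)"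
  then obtain c t where "0 \<le> c" "0 \<le> t" "t \<le> 1" "x = c *\<^sub>R ((1 - t) *\<^sub>R p + t *\<^sub>R q)"
    by (auto simp: conic_hull_explicit in_segment)
  then have "x = (c * (1 - t)) *\<^sub>R p + (c * t) *\<^sub>R q" "0 \<le> c * (1 - t)" "0 \<le> c * t"
    by (auto simp: algebra_simps mult_left_le)
  then show "x \<in> {s *\<^sub>R p + t *\<^sub>R q | s t. 0 \<le> s \<and> 0 \<le> t}" by blast
next
  fix x assume "x \<in> {s *\<^sub>R p + t *\<^sub>R q | s t. 0 \<le> s \<and> 0 \<le> t}"
  then obtain s t where st: "0 \<le> s" "0 \<le> t" "x = s *\<^sub>R p + t *\<^sub>R q" by blast
  show "x \<in> conic hull (closed_segment p q)"
  proof (cases "s + t = 0")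
    case True
    then have "x = 0 *\<^sub>R p" using st by (simp add: add_nonneg_eq_0_iff)
    then show ?thesis unfolding conic_hull_explicit using ends_in_segment by blast
  next
    case False
    have "x = (s + t) *\<^sub>R ((1 - t / (s + t)) *\<^sub>R p + (t / (s + t)) *\<^sub>R q)"
    proof -
      have "(s + t) * (1 - t / (s + t)) = s" "(s + t) * (t / (s + t)) = t" using False by (simp_all add: field_simps)
      then show ?thesis by (simp only: st(3) scaleR_add_right scaleR_scaleR)
    qed
    moreover have "(1 - t / (s + t)) *\<^sub>R p + (t / (s + t)) *\<^sub>R q \<in> closed_segment p q"
      using st(1,2) by (auto simp: in_segment divide_le_eq intro!: exI[of _ "t / (s + t)"])
    moreover have "0 \<le> s + t" using st by simp
    ultimately show ?thesis unfolding conic_hull_explicit by blast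
  qed
qed

text \<open>A positive combination of both generators lies inside an open segment between points of the two
  boundary rays, so the ray through it is not a face.\<close>

lemma ray_generators_segment:
  assumes "primitive p" "primitive q" "p \<noteq> q" "w \<bullet> p = r" "w \<bullet> q = r" "r > 0"
  shows "ray_generators (conic hull (closed_segment p q)) = {p, q}"
proof -
  have indep: "rot p \<bullet> q \<noteq> 0" if pq: "primitive p" "primitive q" "p \<noteq> q" "w \<bullet> p = r" "w \<bullet> q = r" for p q
  proof
    assume "rot p \<bullet> q = 0"
    then obtain c where "q = c *\<^sub>R rot (rot p)"
      using orthogonal_parallel_rot pq(1) primitive_nonzero primitive_rot by metis
    then have q: "q = (- c) *\<^sub>R p" by (simp add: rot_rot)
    then have "r = - c * r" using pq(4,5) by (metis inner_scaleR_right)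
    then have "(- c - 1) * r = 0" by (simp add: algebra_simps)
    then have "- c = 1" using assms(6) by simp
    then show False using q pq(3) by simp
  qed
  have mem: "p \<in> ray_generators (conic hull (closed_segment p q))"
    if pq: "primitive p" "primitive q" "p \<noteq> q" "w \<bullet> p = r" "w \<bullet> q = r" for p q
  proof -
    let ?C = "conic hull (closed_segment p q)"
    define a where "a = (if rot p \<bullet> q > 0 then rot p else - rot p)"
    have a: "a \<bullet> p = 0" "a \<bullet> q > 0" using indep[OF pq] by (auto simp: a_def inner_commute)
    have "(?C \<inter> {x. a \<bullet> x = 0}) face_of ?C"
    proof (rule face_of_Int_supporting_hyperplane_ge)
      show "convex ?C" by (simp add: convex_conic_hull)
      show "0 \<le> a \<bullet> x" if "x \<in> ?C" for x
        using that a by (auto simp: conic_hull_segment inner_add_right)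
    qed
    moreover have "?C \<inter> {x. a \<bullet> x = 0} = conic hull {p}"
      using a unfolding conic_hull_segment by (auto simp: conic_hull_explicit inner_add_right)
        (metis order_refl add.right_neutral scaleR_zero_left)
    ultimately show ?thesis using pq(1) by (simp add: ray_generators_def)
  qed
  have "u = p \<or> u = q" if u: "u \<in> ray_generators (conic hull (closed_segment p q))" for u
  proof -
    let ?C = "conic hull (closed_segment p q)"
    have pu: "primitive u" and face: "(conic hull {u}) face_of ?C" using u by (auto simp: ray_generators_def)
    have "u \<in> conic hull {u}" by (simp add: hull_inc)
    then have "u \<in> ?C" using face face_of_imp_subset by blast
    then obtain s t where st: "0 \<le> s" "0 \<le> t" "u = s *\<^sub>R p + t *\<^sub>R q" by (auto simp: conic_hull_segment)
    have *: "u = x" if "u = c *\<^sub>R x" "0 \<le> c" "primitive x" "w \<bullet> x = r" for c x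
    proof -
      have "w \<bullet> u \<ge> 0" using that assms(6) by simp
      moreover have "u = x \<or> u = - x" using primitive_parallel[OF that(3) pu that(1)] .
      moreover have "u \<noteq> - x"
      proof
        assume "u = - x"
        then have "w \<bullet> u = - r" using that(4) by simp
        then show False using \<open>w \<bullet> u \<ge> 0\<close> assms(6) by simp
      qed
      ultimately show ?thesis by blast
    qed
    have "s = 0 \<or> t = 0"
    proof (rule ccontr)
      assume "\<not> ?thesis"
      then have pos: "s > 0" "t > 0" using st by auto
      have ne: "(2 * s) *\<^sub>R p \<noteq> (2 * t) *\<^sub>R q"
      proof
        assume "(2 * s) *\<^sub>R p = (2 * t) *\<^sub>R q"
        then have "rot p \<bullet> ((2 * s) *\<^sub>R p) = rot p \<bullet> ((2 * t) *\<^sub>R q)" by simp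
        then show False using indep[OF assms(1-5)] pos by (simp add: inner_commute)
      qed
      have "u = (1 - 1/2) *\<^sub>R ((2 * s) *\<^sub>R p) + (1/2) *\<^sub>R ((2 * t) *\<^sub>R q)" by (simp add: st(3))
      then have "u \<in> open_segment ((2 * s) *\<^sub>R p) ((2 * t) *\<^sub>R q)"
        unfolding in_segment using ne by (intro conjI exI[of _ "1/2"]) auto
      moreover have "(2 * s) *\<^sub>R p \<in> ?C" "(2 * t) *\<^sub>R q \<in> ?C"
        unfolding conic_hull_explicit using pos ends_in_segment
        by (force intro: less_imp_le)+
      ultimately have "(2 * s) *\<^sub>R p \<in> conic hull {u}"
        using face \<open>u \<in> conic hull {u}\<close> unfolding face_of_def by blast
      then obtain c where c: "(2 * s) *\<^sub>R p = c *\<^sub>R u" by (auto simp: conic_hull_explicit)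
      then have "c \<noteq> 0" using pos primitive_nonzero[OF assms(1)] by auto
      have "rot p \<bullet> ((2 * s) *\<^sub>R p) = rot p \<bullet> (c *\<^sub>R u)" using c by simp
      then have "rot p \<bullet> u = 0" using \<open>c \<noteq> 0\<close> by (simp add: inner_commute)
      then show False using indep[OF assms(1-5)] pos by (simp add: st(3) inner_add_right inner_commute)
    qed
    then show ?thesis using *[of s p] *[of t q] st assms by auto
  qed
  then show ?thesis
    using mem[OF assms(1-5)] mem[of q p] assms by (auto simp: closed_segment_commute)
qed

text \<open>Functionals that are constant on the segment are multiples of \<open>w\<close>, and an integral one is an
  integral multiple because \<open>w\<close> is primitive.\<close>

lemma cone_gorenstein_index_segment:
  fixes r :: nat
  assumes "primitive p" "primitive q" "p \<noteq> q" "primitive w" "w \<bullet> p = r" "w \<bullet> q = r" "r > 0"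
  shows "cone_gorenstein_index (conic hull (closed_segment p q)) = r"
  unfolding cone_gorenstein_index_def
proof (rule Least_equality)
  have rays: "ray_generators (conic hull (closed_segment p q)) = {p, q}"
    using ray_generators_segment[OF assms(1-3,5,6)] assms(7) by simp
  show "0 < r \<and> (\<exists>w\<in>lattice. \<forall>u\<in>ray_generators (conic hull closed_segment p q). w \<bullet> u = real r)"
    using assms primitive_in_lattice by (auto simp: rays)
  fix n assume n: "0 < n \<and> (\<exists>w\<in>lattice. \<forall>u\<in>ray_generators (conic hull closed_segment p q). w \<bullet> u = real n)"
  then obtain w' where w': "w' \<in> lattice" "w' \<bullet> p = n" "w' \<bullet> q = n" by (auto simp: rays)
  have "w \<bullet> (q - p) = 0" "w' \<bullet> (q - p) = 0" using assms w' by (simp_all add: inner_diff_right)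
  then obtain c where c: "q - p = c *\<^sub>R rot w"
    using orthogonal_parallel_rot primitive_nonzero[OF assms(4)] by blast
  then have "rot w \<bullet> w' = 0" using assms(3) \<open>w' \<bullet> (q - p) = 0\<close> by (auto simp: inner_commute)
  then obtain c' where "w' = c' *\<^sub>R rot (rot w)"
    using orthogonal_parallel_rot assms(4) primitive_nonzero primitive_rot by metis
  then have c': "w' = (- c') *\<^sub>R w" by (simp add: rot_rot)
  then obtain j where j: "- c' = of_int j"
    using primitive_scaleR_lattice[OF assms(4)] w'(1) Ints_cases by metis
  have "real n = of_int j * real r" using w'(2) c' j assms(5) by simp
  then have "int n = j * int r" by (metis of_int_eq_iff of_int_mult of_int_of_nat_eq)
  moreover have "j > 0"
    using n calculation zero_less_mult_pos2[of j "int r"] assms(7) by simp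
  ultimately show "r \<le> n" using mult_right_mono[of 1 j "int r"] by simp
qed

text \<open>A common factor of the shifted vector divides its height, hence divides the shift, hence divides
  \<open>u\<close>. This is why pieces whose width is a multiple of the height end at primitive points.\<close>

lemma primitive_shift:
  fixes h i :: int
  assumes "primitive u" "d \<in> lattice" "w \<in> lattice" "w \<bullet> d = 0" "w \<bullet> u = of_int h"
  shows "primitive (u + of_int (i * h) *\<^sub>R d)"
  unfolding primitive_def
proof (intro conjI ballI allI impI)
  show "u + of_int (i * h) *\<^sub>R d \<in> lattice"
    using assms(2) primitive_in_lattice[OF assms(1)] by (intro lattice_add lattice_scaleR) auto
  fix z and k :: int assume z: "z \<in> lattice" "u + of_int (i * h) *\<^sub>R d = of_int k *\<^sub>R z"
  obtain j :: int where j: "w \<bullet> z = of_int j" using lattice_inner[OF assms(3) z(1)] Ints_cases by metis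
  have "w \<bullet> (u + of_int (i * h) *\<^sub>R d) = of_int h" using assms(4,5) by (simp add: inner_add_right)
  then have "of_int h = real_of_int (k * j)" unfolding z(2) using j by simp
  then have h: "h = k * j" by linarith
  have "u = of_int k *\<^sub>R z - of_int (i * h) *\<^sub>R d" using z(2) by (simp add: algebra_simps)
  then have "u = of_int k *\<^sub>R (z - of_int (i * j) *\<^sub>R d)" by (simp add: h algebra_simps)
  moreover have "z - of_int (i * j) *\<^sub>R d \<in> lattice" using z(1) assms(2) by (intro lattice_diff lattice_scaleR) auto
  ultimately show "\<bar>k\<bar> = 1" using assms(1) unfolding primitive_def by blast
qed

lemma residual_segment_primitive:
  assumes "fano_polygon P" "edge_line P w h" "E = edge_at P w h"
    "residual_segment (nat h) E S" "width E mod nat h \<noteq> 0"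
  obtains p q where "S = closed_segment p q" "p \<noteq> q" "primitive p" "primitive q"
    "w \<bullet> p = - of_int h" "w \<bullet> q = - of_int h"
proof -
  have h: "h > 0" by (rule edge_line_height_pos[OF assms(1,2)])
  have w: "primitive w" using assms(2) by (simp add: edge_line_def)
  obtain u and k :: int where u: "k \<ge> 1" "primitive u" "primitive (u + of_int k *\<^sub>R rot w)"
    "E = closed_segment u (u + of_int k *\<^sub>R rot w)"
    using edge_line_segment[OF assms(1,2)] assms(3) by metis
  obtain a d i where S: "primitive d" "E = closed_segment a (a + real (width E) *\<^sub>R d)"
    "i \<le> width E div nat h"
    "S = closed_segment (a + real (i * nat h) *\<^sub>R d) (a + real (i * nat h + width E mod nat h) *\<^sub>R d)"
    using assms(4) unfolding residual_segment_def by blast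
  define b where "b = a + real (width E) *\<^sub>R d"
  have "closed_segment a b = closed_segment u (u + of_int k *\<^sub>R rot w)"
    using S(2) u(4) unfolding b_def by (rule trans[OF sym])
  then have "{a, b} = {u, u + of_int k *\<^sub>R rot w}" by (simp only: closed_segment_eq)
  then have prim: "primitive a" "primitive b" using u by (auto simp: doubleton_eq_iff)
  have "a \<in> E" "b \<in> E" by (subst S(2), simp add: b_def)+
  then have on: "w \<bullet> a = of_int (- h)" "w \<bullet> b = of_int (- h)" using assms(3) by auto
  have "width E \<noteq> 0" using assms(5) by (metis mod_0)
  then have wd: "w \<bullet> d = 0" using on by (auto simp: b_def inner_add_right)
  define j where "j = width E div nat h - i"
  have split: "i * nat h + width E mod nat h + j * nat h = width E"
  proof -
    have "i * nat h + j * nat h = width E div nat h * nat h"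
      using S(3) by (simp add: j_def flip: add_mult_distrib)
    then show ?thesis using div_mult_mod_eq[of "width E" "nat h"] by linarith
  qed
  note shift = primitive_shift[OF _ primitive_in_lattice[OF S(1)] primitive_in_lattice[OF w] wd]
  let ?p = "a + real (i * nat h) *\<^sub>R d" and ?q = "a + real (i * nat h + width E mod nat h) *\<^sub>R d"
  have "?p = a + of_int ((- int i) * (- h)) *\<^sub>R d" using h by simp
  then have p: "primitive ?p" using shift[OF prim(1) on(1)] by metis
  have "real (i * nat h + width E mod nat h) = real (width E) + of_int (int j * - h)"
    using arg_cong[OF split, of real] h by simp
  then have "?q = b + of_int (int j * (- h)) *\<^sub>R d" by (simp add: b_def scaleR_diff_left)
  then have q: "primitive ?q" using shift[OF prim(2) on(2)] by metis
  have "?p \<noteq> ?q" using assms(5) primitive_nonzero[OF S(1)] by simp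
  then show thesis using that[OF S(4) _ p q] on wd by (simp add: inner_add_right)
qed

text \<open>All cones that represent the residue are images of cones over segments at height \<open>h\<close> with primitive
  endpoints, and such a cone has index \<open>h\<close>.\<close>

lemma residue_gorenstein_index:
  assumes "fano_polygon P" "edge_line P w h" "E = edge_at P w h"
    "width E mod nat h \<noteq> 0"
  shows "gorenstein_index (residue P E) = nat h"
proof -
  have h: "h > 0" by (rule edge_line_height_pos[OF assms(1,2)])
  have w: "primitive w" using assms(2) by (simp add: edge_line_def)
  have res: "residue P E = gl2z_rel `` {conic hull S | S. residual_segment (nat h) E S}"
    using edge_line_local_index[OF assms(1,2)] assms(3) by (simp add: residue_def)
  have index: "cone_gorenstein_index C = nat h" if C: "C \<in> residue P E" for C
  proof -
    obtain S A where S: "residual_segment (nat h) E S" "A \<in> GL2Z" "C = (*v) A ` (conic hull S)"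
      using C unfolding res gl2z_rel_def by blast
    obtain p q where pq: "S = closed_segment p q" "p \<noteq> q" "primitive p" "primitive q"
      "w \<bullet> p = - of_int h" "w \<bullet> q = - of_int h"
      using residual_segment_primitive[OF assms(1-3) S(1) assms(4)] .
    have lin: "linear ((*v) A)" by simp
    have Ceq: "C = conic hull (closed_segment (A *v p) (A *v q))"
      unfolding S(3) pq(1) closed_segment_linear_image[OF lin] conic_hull_linear_image[OF lin] ..
    obtain w' where w': "primitive w'" "\<And>v. w' \<bullet> (A *v v) = w \<bullet> v" using GL2Z_primitive_dual[OF S(2) w] by blast
    obtain z where z: "z \<in> lattice" "w \<bullet> z = 1" using primitive_dual[OF w] .
    have "A *v p \<noteq> A *v q"
    proof
      assume eq: "A *v p = A *v q"
      have "unimodular (A$1) (A$2)" using S(2) by (simp add: GL2Z_unimodular)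
      then have "p = q" using eq by (intro coords_eqI[of "A$1" "A$2"]) (simp_all flip: matrix_vector_mul_component)
      then show False using pq(2) by simp
    qed
    then show ?thesis unfolding Ceq using pq S(2) w' h
      by (intro cone_gorenstein_index_segment[of _ _ "- w'"]) (auto simp: GL2Z_primitive primitive_uminus)
  qed
  obtain u and k :: int where u: "k \<ge> 1" "primitive u" "primitive (u + of_int k *\<^sub>R rot w)"
    "E = closed_segment u (u + of_int k *\<^sub>R rot w)"
    using edge_line_segment[OF assms(1,2)] assms(3) by metis
  have k: "width E = nat k" unfolding u(4) using width_segment u w by (simp add: primitive_in_lattice)
  have "residual_segment (nat h) E (closed_segment (u + real (0 * nat h) *\<^sub>R rot w)
      (u + real (0 * nat h + width E mod nat h) *\<^sub>R rot w))"
    unfolding residual_segment_def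
  proof (intro exI conjI)
    show "primitive (rot w)" using w by simp
    show "E = closed_segment u (u + real (width E) *\<^sub>R rot w)" using u(1,4) k by simp
  qed (rule le0 refl)+
  then obtain S where "residual_segment (nat h) E S" by blast
  then have "residue P E \<noteq> {}" unfolding res using gl2z_rel_refl by blast
  then have "cone_gorenstein_index ` residue P E = {nat h}" using index by auto
  then show ?thesis by (simp add: gorenstein_index_def)
qed

lemma Arg2pi_eq_imp_pos_multiple:
  assumes "Arg2pi z = Arg2pi z'" "z \<noteq> 0"
  obtains c where "c \<ge> 0" "z' = of_real c * z"
proof -
  let ?u = "exp (\<i> * of_real (Arg2pi z))"
  have z: "of_real (norm z) * ?u = z" and z': "of_real (norm z') * ?u = z'"
    using Arg2pi_eq[of z] Arg2pi_eq[of z'] assms(1) by simp_all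
  have "of_real (norm z' / norm z) * (of_real (norm z) * ?u) = of_real (norm z') * ?u"
    using assms(2) by simp
  then have "z' = of_real (norm z' / norm z) * z" unfolding z z' by (rule sym)
  then show thesis using that[of "norm z' / norm z"] by simp
qed

lemma (in linorder) set_sorted_key_list_of_inj_on:
  assumes "inj_on k S" "finite S" shows "set (sorted_key_list_of_set k S) = S"
proof -
  interpret folding_insort_key "(\<le>)" "(<)" S k by unfold_locales (rule assms(1))
  show ?thesis using assms(2) by (rule set_sorted_key_list_of_set[OF subset_refl])
qed

text \<open>The sorting key is injective: normals with equal angle are positive multiples of each other, and
  both are primitive.\<close>

lemma set_edges:
  assumes "fano_polygon P" shows "set (edges P) = {E. E edge_of P}"
proof -
  let ?key = "\<lambda>E. Arg2pi (Complex (inner_normal P E $ 1) (inner_normal P E $ 2))"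
  have inj: "inj_on ?key {E. E edge_of P}"
  proof (rule inj_onI, clarsimp)
    fix E F assume E: "E edge_of P" and F: "F edge_of P" and eq: "?key E = ?key F"
    obtain w h where w: "edge_line P w h" "E = edge_at P w h"
      using edge_of_imp_edge_line[OF assms E] .
    obtain w' h' where w': "edge_line P w' h'" "F = {v\<in>P. w' \<bullet> v = - of_int h'}"
      using edge_of_imp_edge_line[OF assms F] .
    have n: "inner_normal P E = w" "inner_normal P F = w'"
      using edge_line_inner_normal[OF assms] w w' by auto
    have prim: "primitive w" "primitive w'" using w w' by (auto simp: edge_line_def)
    have "Complex (w$1) (w$2) \<noteq> 0" using primitive_nonzero[OF prim(1)] by (auto simp: eq2 complex_eq_iff)
    then obtain c where c: "c \<ge> 0" "Complex (w'$1) (w'$2) = of_real c * Complex (w$1) (w$2)"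
      using Arg2pi_eq_imp_pos_multiple eq unfolding n by blast
    then have "w' = c *\<^sub>R w" by (simp add: eq2 complex_eq_iff)
    moreover from this have "w' = w \<or> w' = - w" using primitive_parallel prim by blast
    moreover have "w' \<noteq> - w"
    proof
      assume "w' = - w"
      then have "(c + 1) *\<^sub>R w = 0" using \<open>w' = c *\<^sub>R w\<close> by (simp add: scaleR_add_left)
      then show False using c(1) primitive_nonzero[OF prim(1)] by auto
    qed
    ultimately have "w' = w" by blast
    moreover obtain u v where "u \<in> P" "w \<bullet> u = - of_int h" "v \<in> P" "w' \<bullet> v = - of_int h'"
      using w(1) w'(1) unfolding edge_line_def by blast
    ultimately have "h = h'" using w(1) w'(1) unfolding edge_line_def by fastforce
    then show "E = F" using w w' \<open>w' = w\<close> by simp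
  qed
  have "finite {E. E edge_of P}"
    using finite_polytope_faces[OF fano_polygonD(1)[OF assms]] by (rule finite_subset[rotated]) (auto simp: edge_of_def)
  with inj show ?thesis unfolding edges_def by (rule set_sorted_key_list_of_inj_on)
qed

text \<open>An edge whose width is not a multiple of its height leaves a residue, whose index is that height.\<close>

lemma high_edge_width_dvd:
  assumes "fano_polygon P" "max_local_index (residual_basket P) \<le> K"
    "edge_line P w h" "h > int K"
  shows "nat h dvd width (edge_at P w h)"
proof (rule ccontr)
  let ?E = "edge_at P w h" and ?B = "residual_basket P"
  assume "\<not> nat h dvd width ?E"
  then have m: "width ?E mod nat h \<noteq> 0" by (simp add: dvd_eq_mod_eq_0)
  have "?E \<in> set (edges P)" using set_edges[OF assms(1)] edge_line_edge_of[OF assms(1,3)] by simp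
  then have "residue P ?E \<in> set ?B"
    using m edge_line_local_index[OF assms(1,3)] by (auto simp: residual_basket_def)
  then have "gorenstein_index (residue P ?E) \<in> gorenstein_index ` set ?B" by (rule imageI)
  then have "gorenstein_index (residue P ?E) \<le> Max (gorenstein_index ` set ?B)" by (intro Max_ge) auto
  moreover have "gorenstein_index (residue P ?E) = nat h"
    by (rule residue_gorenstein_index[OF assms(1,3) refl m])
  moreover have "?B \<noteq> []" using \<open>residue P ?E \<in> set ?B\<close> by auto
  moreover have "Max (gorenstein_index ` set ?B) \<le> K"
    using assms(2) \<open>?B \<noteq> []\<close> by (simp only: max_local_index_def if_False)
  ultimately show False using assms(4) by linarith
qed

section \<open>The mutated polygon\<close>

text \<open>If a vertex with positive weight in \<open>z\<close> could be lowered within its own level of \<open>f\<close>, then \<open>z\<close> could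
  be lowered as well. So the part of the boundary that is minimal along the levels is spanned by
  vertices of the same kind, which gives the left and, for \<open>- e\<close>, the right boundary of a polygon.\<close>

lemma fibrewise_minimum_in_hull:
  fixes P :: "'a::euclidean_space set"
  assumes "compact P" "convex P" "finite {v. v extreme_point_of P}"
    and z: "z \<in> P" "\<And>v. v \<in> P \<Longrightarrow> f \<bullet> v = f \<bullet> z \<Longrightarrow> a \<bullet> z \<le> a \<bullet> v"
  shows "z \<in> convex hull {v. v extreme_point_of P \<and> (\<forall>u\<in>P. f \<bullet> u = f \<bullet> v \<longrightarrow> a \<bullet> v \<le> a \<bullet> u)}"
    (is "_ \<in> convex hull ?B")
proof -
  define X where "X = {v. v extreme_point_of P}"
  have fin: "finite X" using assms(3) by (simp add: X_def)
  have XP: "X \<subseteq> P" by (auto simp: X_def extreme_point_of_def)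
  have "z \<in> convex hull X" using Krein_Milman_Minkowski[OF assms(1,2)] z(1) by (simp add: X_def)
  then obtain c where c: "\<forall>v\<in>X. 0 \<le> c v" "sum c X = 1" "(\<Sum>v\<in>X. c v *\<^sub>R v) = z"
    unfolding convex_hull_finite[OF fin] by blast
  define Y where "Y = {v\<in>X. c v \<noteq> 0}"
  have Y: "finite Y" "Y \<subseteq> X" using fin by (auto simp: Y_def)
  have "Y \<subseteq> ?B"
  proof
    fix v assume v: "v \<in> Y"
    then have cv: "c v > 0" "v \<in> X" using c(1) by (auto simp: Y_def less_le)
    have "a \<bullet> v \<le> a \<bullet> u" if u: "u \<in> P" "f \<bullet> u = f \<bullet> v" for u
    proof -
      let ?g = "\<lambda>x. if x = v then u else x"
      have "(\<Sum>x\<in>X. c x *\<^sub>R ?g x) \<in> P"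
        by (intro convex_sum[OF fin assms(2) c(2)]) (use c(1) u XP in auto)
      moreover have "(\<Sum>x\<in>X. c x *\<^sub>R ?g x) = z + c v *\<^sub>R (u - v)"
      proof -
        have "(\<Sum>x\<in>X. c x *\<^sub>R ?g x) = (\<Sum>x\<in>X. c x *\<^sub>R x) + (\<Sum>x\<in>X. if x = v then c v *\<^sub>R (u - v) else 0)"
          unfolding sum.distrib[symmetric] by (intro sum.cong) (auto simp: algebra_simps)
        then show ?thesis using cv fin c(3) by simp
      qed
      ultimately have "z + c v *\<^sub>R (u - v) \<in> P" by simp
      then have "a \<bullet> z \<le> a \<bullet> (z + c v *\<^sub>R (u - v))"
        by (intro z(2)) (simp_all add: u(2) inner_add_right inner_diff_right)
      then have "0 \<le> c v * (a \<bullet> u - a \<bullet> v)" by (simp add: inner_add_right inner_diff_right)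
      then show ?thesis using cv(1) by (simp add: zero_le_mult_iff)
    qed
    then show "v \<in> ?B" using cv(2) by (simp add: X_def)
  qed
  then have "Y \<subseteq> convex hull ?B" by (meson hull_subset subset_trans)
  moreover have "sum c Y = 1"
    unfolding c(2)[symmetric] using fin by (intro sum.mono_neutral_left) (auto simp: Y_def)
  ultimately have "(\<Sum>v\<in>Y. c v *\<^sub>R v) \<in> convex hull ?B"
    using Y c(1) by (intro convex_sum[OF Y(1) convex_convex_hull]) auto
  moreover have "(\<Sum>v\<in>Y. c v *\<^sub>R v) = z"
    unfolding c(3)[symmetric] using fin by (intro sum.mono_neutral_left) (auto simp: Y_def)
  ultimately show ?thesis by simp
qed

text \<open>A supporting line would have to be horizontal because of the points on both sides, and then one of
  \<open>p\<close> and \<open>q\<close> is on its wrong side.\<close>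

lemma interior_pointI:
  assumes "convex Q" "unimodular e f" "z \<in> Q"
    and "z - s *\<^sub>R point_at e f 1 0 \<in> Q" "s > 0" "z + t *\<^sub>R point_at e f 1 0 \<in> Q" "t > 0"
    and "p \<in> Q" "f \<bullet> p < f \<bullet> z" "q \<in> Q" "f \<bullet> z < f \<bullet> q"
  shows "z \<in> interior Q"
proof (rule ccontr)
  assume z: "z \<notin> interior Q"
  obtain a where a: "a \<noteq> 0" "\<And>x. x \<in> Q \<Longrightarrow> a \<bullet> z \<le> a \<bullet> x"
  proof (cases "interior Q = {}")
    case True
    then show ?thesis using empty_interior_subset_hyperplane[OF assms(1)] assms(3) that
      by (metis (mono_tags, lifting) mem_Collect_eq order_refl subsetD)
  next
    case False
    then have "z \<notin> rel_interior Q" using z by (simp add: rel_interior_nonempty_interior)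
    then show ?thesis using supporting_hyperplane_rel_boundary[OF assms(1,3)] that by metis
  qed
  have "0 \<le> - s * (a \<bullet> point_at e f 1 0)" "0 \<le> t * (a \<bullet> point_at e f 1 0)"
    using a(2)[OF assms(4)] a(2)[OF assms(6)] by (simp_all add: inner_add_right inner_diff_right)
  then have 0: "a \<bullet> point_at e f 1 0 = 0" using assms(5,7) by (auto simp: zero_le_mult_iff mult_le_0_iff)
  define b where "b = a \<bullet> point_at e f 0 1"
  have ab: "a \<bullet> v = b * (f \<bullet> v)" for v
  proof -
    have "v = point_at e f (e \<bullet> v * 1 + f \<bullet> v * 0) (e \<bullet> v * 0 + f \<bullet> v * 1)"
      using point_at_inner[OF assms(2)] by simp
    then have "v = (e \<bullet> v) *\<^sub>R point_at e f 1 0 + (f \<bullet> v) *\<^sub>R point_at e f 0 1"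
      by (simp only: point_at_linear)
    then have "a \<bullet> v = a \<bullet> ((e \<bullet> v) *\<^sub>R point_at e f 1 0 + (f \<bullet> v) *\<^sub>R point_at e f 0 1)" by simp
    then show ?thesis using 0 by (simp add: inner_add_right b_def)
  qed
  have "b \<noteq> 0" using a(1) ab[of a] by auto
  moreover have "0 \<le> b * (f \<bullet> p - f \<bullet> z)" "0 \<le> b * (f \<bullet> q - f \<bullet> z)"
    using a(2)[OF assms(8)] a(2)[OF assms(10)] by (simp_all add: ab algebra_simps)
  ultimately show False using assms(9,11) by (auto simp: zero_le_mult_iff)
qed

lemma card_lattice_by_rows:
  assumes "unimodular e f" "bounded S" "\<And>v. v \<in> S \<Longrightarrow> of_int a \<le> f \<bullet> v \<and> f \<bullet> v \<le> of_int b"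
  shows "card (S \<inter> lattice) = (\<Sum>y=a..b. card {x::int. point_at e f (of_int x) (of_int y) \<in> S})"
    "finite {x::int. point_at e f (of_int x) (of_int y) \<in> S}" "finite (S \<inter> lattice)"
proof -
  let ?R = "\<lambda>y::int. {x::int. point_at e f (of_int x) (of_int y) \<in> S}"
  obtain B where B: "\<forall>v\<in>S. norm v \<le> B" using assms(2) bounded_iff by blast
  have fin: "finite (?R y)" for y
  proof (rule finite_subset)
    show "?R y \<subseteq> {- \<lceil>norm e * B\<rceil>..\<lceil>norm e * B\<rceil>}"
    proof
      fix x assume "x \<in> ?R y"
      then have v: "point_at e f (of_int x) (of_int y) \<in> S" by simp
      have "\<bar>real_of_int x\<bar> \<le> norm e * norm (point_at e f (of_int x) (of_int y))"
        using Cauchy_Schwarz_ineq2[of e "point_at e f (of_int x) (of_int y)"]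
        by (simp add: inner_point_at[OF assms(1)])
      also have "\<dots> \<le> norm e * B" using B v by (intro mult_left_mono) auto
      finally show "x \<in> {- \<lceil>norm e * B\<rceil>..\<lceil>norm e * B\<rceil>}" by (auto simp: abs_le_iff) linarith+
    qed
  qed simp
  then show "finite (?R y)" .
  have img: "S \<inter> lattice = (\<lambda>(y, x). point_at e f (of_int x) (of_int y)) ` (SIGMA y:{a..b}. ?R y)"
  proof (intro equalityI subsetI)
    fix v assume v: "v \<in> S \<inter> lattice"
    then obtain x y :: int where xy: "e \<bullet> v = of_int x" "f \<bullet> v = of_int y"
      using lattice_coords[OF assms(1)] Ints_cases by (metis IntD2)
    then have "v = point_at e f (of_int x) (of_int y)" using point_at_inner[OF assms(1)] by metis
    moreover have "y \<in> {a..b}" using assms(3)[of v] v xy by auto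
    ultimately show "v \<in> (\<lambda>(y, x). point_at e f (of_int x) (of_int y)) ` (SIGMA y:{a..b}. ?R y)"
      using v by (intro image_eqI[of _ _ "(y, x)"]) auto
  next
    fix v assume "v \<in> (\<lambda>(y, x). point_at e f (of_int x) (of_int y)) ` (SIGMA y:{a..b}. ?R y)"
    then show "v \<in> S \<inter> lattice" using point_at_lattice[OF assms(1)] by auto
  qed
  show "finite (S \<inter> lattice)" unfolding img using fin by (intro finite_imageI finite_SigmaI) auto
  have "inj_on (\<lambda>(y, x). point_at e f (of_int x) (of_int y)) (SIGMA y:{a..b}. ?R y)"
    by (intro inj_onI) (clarsimp, metis inner_point_at[OF assms(1)] of_int_eq_iff)
  then have "card (S \<inter> lattice) = card (SIGMA y:{a..b}. ?R y)" by (simp add: img card_image)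
  also have "\<dots> = (\<Sum>y=a..b. card (?R y))" using fin by (intro card_SigmaI) auto
  finally show "card (S \<inter> lattice) = (\<Sum>y=a..b. card (?R y))" .
qed

text \<open>Coordinates in which the edge to be mutated is the lower boundary, of height \<open>m\<close> and width \<open>k\<close>. The
  number \<open>M\<close> is the height of the polygon above the origin. As \<open>m \<le> k\<close>, the edge can be shortened
  by \<open>m\<close>.\<close>

locale mutable_edge =
  fixes P :: "(real^2) set" and e f :: "real^2" and m M k x0 xt :: int
  assumes fano: "fano_polygon P" and uni: "unimodular e f" and line: "edge_line P f m"
    and bottom: "edge_at P f m =
      closed_segment (point_at e f (of_int x0) (- of_int m)) (point_at e f (of_int (x0 + k)) (- of_int m))"
    and long: "m \<le> k"
    and top: "\<And>v. v \<in> P \<Longrightarrow> f \<bullet> v \<le> of_int M" "point_at e f (of_int xt) (of_int M) \<in> P"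
begin

abbreviation "pt \<equiv> point_at e f"

lemmas coord = inner_point_at[OF uni]

lemma P: "convex P" "compact P" "bounded P" "closed P" "0 \<in> P" "0 \<in> interior P"
  using fano_polygonD[OF fano] by auto

lemma m_pos: "m > 0" by (rule edge_line_height_pos[OF fano line])

lemma above_bottom: "v \<in> P \<Longrightarrow> - of_int m \<le> f \<bullet> v"
  using line by (simp add: edge_line_def)

lemma pt_bounds: "pt x y \<in> P \<Longrightarrow> - of_int m \<le> y \<and> y \<le> of_int M"
  using above_bottom top(1) coord by metis

lemma pt_comb: "(1 - t) *\<^sub>R pt x y + t *\<^sub>R pt x' y' = pt ((1 - t) * x + t * x') ((1 - t) * y + t * y')"
  by (simp only: point_at_linear)

lemma pt_zero: "pt 0 0 = 0" by (simp add: point_at_def eq2)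

lemma pt_convex:
  assumes "pt x y \<in> P" "pt x' y' \<in> P" "0 \<le> t" "t \<le> 1"
  shows "pt ((1 - t) * x + t * x') ((1 - t) * y + t * y') \<in> P"
  using convexD_alt[OF P(1) assms] pt_comb by simp

lemma bottom_mem: "pt (of_int x0) (- of_int m) \<in> P" "pt (of_int (x0 + k)) (- of_int m) \<in> P"
  using bottom by (metis (no_types, lifting) ends_in_segment mem_Collect_eq)+

lemma M_pos: "M > 0"
proof -
  obtain r where r: "r > 0" "ball 0 r \<subseteq> P" using P(6) mem_interior by blast
  have "primitive f" using line by (simp add: edge_line_def)
  then have nf: "norm f > 0" using primitive_nonzero by simp
  have "(r / (2 * norm f)) *\<^sub>R f \<in> ball 0 r" using r nf by simp
  then have "f \<bullet> ((r / (2 * norm f)) *\<^sub>R f) \<le> of_int M" using r top(1) by blast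
  moreover have "f \<bullet> ((r / (2 * norm f)) *\<^sub>R f) > 0" using r nf by simp
  ultimately show ?thesis by linarith
qed

definition lower :: "real \<Rightarrow> real" where "lower y = Inf {x. pt x y \<in> P}"
definition upper :: "real \<Rightarrow> real" where "upper y = Sup {x. pt x y \<in> P}"

lemma slice_nonempty:
  assumes "- of_int m \<le> y" "y \<le> of_int M" shows "\<exists>x. pt x y \<in> P"
proof -
  have "y \<in> closed_segment (- of_int m) (of_int M)"
    using assms M_pos m_pos by (simp add: closed_segment_eq_real_ivl)
  then obtain t where "0 \<le> t" "t \<le> 1" "y = (1 - t) * (- of_int m) + t * of_int M"
    by (auto simp: in_segment)
  then show ?thesis using pt_convex[OF bottom_mem(1) top(2)] by auto
qed

lemma slice_iff:
  assumes "- of_int m \<le> y" "y \<le> of_int M"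
  shows "pt x y \<in> P \<longleftrightarrow> lower y \<le> x \<and> x \<le> upper y"
proof -
  let ?S = "{x. pt x y \<in> P}"
  have ne: "?S \<noteq> {}" using slice_nonempty[OF assms] by blast
  have "?S = (\<lambda>v. e \<bullet> v) ` (P \<inter> {v. f \<bullet> v = y})"
  proof (intro equalityI subsetI)
    fix x assume "x \<in> ?S"
    then show "x \<in> (\<lambda>v. e \<bullet> v) ` (P \<inter> {v. f \<bullet> v = y})"
      by (intro image_eqI[of _ _ "pt x y"]) (simp_all add: coord)
  next
    fix x assume "x \<in> (\<lambda>v. e \<bullet> v) ` (P \<inter> {v. f \<bullet> v = y})"
    then show "x \<in> ?S" using point_at_inner[OF uni] by auto
  qed
  moreover have "compact (P \<inter> {v. f \<bullet> v = y})" using P(2) closed_hyperplane by (rule compact_Int_closed)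
  ultimately have cS: "compact ?S" by (simp only:) (intro compact_continuous_image continuous_intros)
  then have bd: "bdd_below ?S" "bdd_above ?S" and cl: "closed ?S"
    by (auto simp: compact_imp_bounded bounded_imp_bdd_below bounded_imp_bdd_above compact_imp_closed)
  have in1: "lower y \<in> ?S" unfolding lower_def by (rule closed_contains_Inf[OF ne bd(1) cl])
  have in2: "upper y \<in> ?S" unfolding upper_def by (rule closed_contains_Sup[OF ne bd(2) cl])
  show ?thesis
  proof
    assume "pt x y \<in> P"
    then show "lower y \<le> x \<and> x \<le> upper y"
      unfolding lower_def upper_def using bd by (auto intro: cInf_lower cSup_upper)
  next
    assume x: "lower y \<le> x \<and> x \<le> upper y"
    then have "x \<in> closed_segment (lower y) (upper y)" by (simp add: closed_segment_eq_real_ivl)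
    then obtain u where u: "0 \<le> u" "u \<le> 1" "x = (1 - u) * lower y + u * upper y"
      by (auto simp: in_segment)
    have "pt ((1 - u) * lower y + u * upper y) ((1 - u) * y + u * y) \<in> P"
      using in1 in2 u by (intro pt_convex) auto
    moreover have "(1 - u) * y + u * y = y" by (simp add: algebra_simps)
    ultimately show "pt x y \<in> P" using u(3) by simp
  qed
qed

lemma lower_le_upper:
  assumes "- of_int m \<le> y" "y \<le> of_int M" shows "pt (lower y) y \<in> P" "pt (upper y) y \<in> P" "lower y \<le> upper y"
proof -
  show *: "lower y \<le> upper y" using slice_nonempty[OF assms] slice_iff[OF assms] by force
  show "pt (lower y) y \<in> P" "pt (upper y) y \<in> P" unfolding slice_iff[OF assms] using * by simp_all
qed

lemma lower_less_upper:
  assumes "- of_int m < y" "y < of_int M" shows "lower y < upper y"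
proof -
  define t where "t = (y + of_int m) / of_int (M + m)"
  have pos: "real_of_int (M + m) > 0" using M_pos m_pos by linarith
  then have t: "0 \<le> t" "t < 1" "t * of_int (M + m) = y + of_int m"
    using assms by (auto simp: t_def divide_less_eq)
  have y: "(1 - t) * (- of_int m) + t * of_int M = y" using t(3) by (simp add: algebra_simps)
  have "pt ((1 - t) * of_int x0 + t * of_int xt) y \<in> P" "pt ((1 - t) * of_int (x0 + k) + t * of_int xt) y \<in> P"
    using pt_convex[OF bottom_mem(1) top(2), of t] pt_convex[OF bottom_mem(2) top(2), of t] t y by auto
  then have "(1 - t) * of_int (x0 + k) \<le> upper y - t * of_int xt" "lower y - t * of_int xt \<le> (1 - t) * of_int x0"
    using slice_iff[of y] assms by (auto simp: algebra_simps)
  moreover have "(1 - t) * real_of_int x0 < (1 - t) * of_int (x0 + k)"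
    using t long m_pos by (intro mult_strict_left_mono) auto
  ultimately show ?thesis by linarith
qed

text \<open>Below the origin, the slices are long enough to be shortened by the mutation: they contain
  slices of the triangle spanned by the origin and the edge.\<close>

lemma slice_length:
  assumes "- of_int m \<le> y" "y \<le> of_int M" shows "lower y \<le> upper y + y"
proof (cases "y \<ge> 0")
  case True
  then show ?thesis using lower_le_upper[OF assms] by linarith
next
  case False
  define t where "t = - y / of_int m"
  have t: "0 \<le> t" "t \<le> 1" "t * of_int m = - y"
    using False assms m_pos by (simp_all add: t_def pos_divide_le_eq divide_le_0_iff pos_le_divide_eq)
  have "pt ((1 - t) * 0 + t * of_int x0) ((1 - t) * 0 + t * (- of_int m)) \<in> P"
       "pt ((1 - t) * 0 + t * of_int (x0 + k)) ((1 - t) * 0 + t * (- of_int m)) \<in> P"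
    using P(5) pt_zero bottom_mem t(1,2) by (intro pt_convex; simp)+
  then have "pt (t * of_int x0) y \<in> P" "pt (t * of_int (x0 + k)) y \<in> P" using t(3) by simp_all
  then have "lower y \<le> t * of_int x0" "t * of_int (x0 + k) \<le> upper y" using slice_iff[OF assms] by auto
  moreover have "t * of_int m \<le> t * of_int k" using t(1) long by (intro mult_left_mono) auto
  moreover have "t * real_of_int (x0 + k) = t * of_int x0 + t * of_int k" by (simp add: algebra_simps)
  ultimately show ?thesis using t(3) by linarith
qed

text \<open>The mutation keeps the left boundary and shears the right boundary. The formulation with two points
  of \<open>P\<close> on the same level makes convexity evident; in terms of the boundaries, a level \<open>y\<close> runs from
  \<open>lower y\<close> to \<open>upper y + y\<close>.\<close>

definition mutated :: "(real^2) set" where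
  "mutated = {v. \<exists>l r. pt l (f \<bullet> v) \<in> P \<and> pt r (f \<bullet> v) \<in> P \<and> l \<le> e \<bullet> v \<and> e \<bullet> v \<le> r + f \<bullet> v}"

lemma pt_mutated:
  "pt x y \<in> mutated \<longleftrightarrow> - of_int m \<le> y \<and> y \<le> of_int M \<and> lower y \<le> x \<and> x \<le> upper y + y"
proof (cases "- of_int m \<le> y \<and> y \<le> of_int M")
  case True
  show ?thesis
  proof
    assume "pt x y \<in> mutated"
    then show "- of_int m \<le> y \<and> y \<le> of_int M \<and> lower y \<le> x \<and> x \<le> upper y + y"
      using True slice_iff[of y] unfolding mutated_def coord mem_Collect_eq by force
  next
    assume "- of_int m \<le> y \<and> y \<le> of_int M \<and> lower y \<le> x \<and> x \<le> upper y + y"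
    then show "pt x y \<in> mutated"
      using lower_le_upper(1,2)[of y] unfolding mutated_def coord mem_Collect_eq by blast
  qed
qed (use pt_bounds in \<open>auto simp: mutated_def coord\<close>)

lemma convex_mutated: "convex mutated"
  unfolding convex_alt
proof (intro ballI allI impI)
  fix v w and u :: real assume vw: "v \<in> mutated" "w \<in> mutated" and u: "0 \<le> u \<and> u \<le> 1"
  obtain l r l' r' where lr: "pt l (f \<bullet> v) \<in> P" "pt r (f \<bullet> v) \<in> P" "l \<le> e \<bullet> v" "e \<bullet> v \<le> r + f \<bullet> v"
    "pt l' (f \<bullet> w) \<in> P" "pt r' (f \<bullet> w) \<in> P" "l' \<le> e \<bullet> w" "e \<bullet> w \<le> r' + f \<bullet> w"
    using vw unfolding mutated_def by blast
  let ?z = "(1 - u) *\<^sub>R v + u *\<^sub>R w"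
  have z: "f \<bullet> ?z = (1 - u) * (f \<bullet> v) + u * (f \<bullet> w)" "e \<bullet> ?z = (1 - u) * (e \<bullet> v) + u * (e \<bullet> w)"
    by (simp_all add: inner_add_right)
  have "pt ((1 - u) * l + u * l') (f \<bullet> ?z) \<in> P" "pt ((1 - u) * r + u * r') (f \<bullet> ?z) \<in> P"
    unfolding z using lr u by (auto intro: pt_convex)
  moreover have "(1 - u) * l + u * l' \<le> e \<bullet> ?z" unfolding z
    using lr u by (intro add_mono mult_left_mono) auto
  moreover have "(1 - u) * (e \<bullet> v) + u * (e \<bullet> w) \<le> (1 - u) * (r + f \<bullet> v) + u * (r' + f \<bullet> w)"
    using lr u by (intro add_mono mult_left_mono) auto
  then have "e \<bullet> ?z \<le> (1 - u) * r + u * r' + f \<bullet> ?z" unfolding z by (simp add: algebra_simps)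
  ultimately show "?z \<in> mutated" unfolding mutated_def by blast
qed

definition left_vertices :: "(real^2) set" where
  "left_vertices = {v. v extreme_point_of P \<and> e \<bullet> v = lower (f \<bullet> v)}"
definition right_vertices :: "(real^2) set" where
  "right_vertices = {v. v extreme_point_of P \<and> e \<bullet> v = upper (f \<bullet> v)}"
definition shear :: "real^2 \<Rightarrow> real^2" where
  "shear v = v + (f \<bullet> v) *\<^sub>R pt 1 0"

lemma mem_iff:
  "v \<in> P \<longleftrightarrow> - of_int m \<le> f \<bullet> v \<and> f \<bullet> v \<le> of_int M \<and> lower (f \<bullet> v) \<le> e \<bullet> v \<and> e \<bullet> v \<le> upper (f \<bullet> v)"
  using slice_iff[of "f \<bullet> v" "e \<bullet> v"] above_bottom top(1) point_at_inner[OF uni] by metis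

lemma mem_mutated:
  "v \<in> mutated \<longleftrightarrow> - of_int m \<le> f \<bullet> v \<and> f \<bullet> v \<le> of_int M \<and> lower (f \<bullet> v) \<le> e \<bullet> v \<and> e \<bullet> v \<le> upper (f \<bullet> v) + f \<bullet> v"
  using pt_mutated[of "e \<bullet> v" "f \<bullet> v"] point_at_inner[OF uni] by simp

lemma linear_shear: "linear shear"
  by (rule linearI) (simp_all add: shear_def inner_add_right algebra_simps)

lemma left_in_hull:
  assumes "- of_int m \<le> y" "y \<le> of_int M" shows "pt (lower y) y \<in> convex hull left_vertices"
proof -
  have "pt (lower y) y \<in> convex hull {v. v extreme_point_of P \<and> (\<forall>u\<in>P. f \<bullet> u = f \<bullet> v \<longrightarrow> e \<bullet> v \<le> e \<bullet> u)}"
  proof (rule fibrewise_minimum_in_hull[OF P(2,1) fano_polygonD(9)[OF fano] lower_le_upper(1)[OF assms]])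
    fix v assume "v \<in> P" "f \<bullet> v = f \<bullet> pt (lower y) y"
    then show "e \<bullet> pt (lower y) y \<le> e \<bullet> v" using mem_iff[of v] by (simp add: coord)
  qed
  also have "\<dots> \<subseteq> convex hull left_vertices"
  proof (rule hull_mono, clarsimp simp: left_vertices_def)
    fix v assume v: "v extreme_point_of P" "\<forall>u\<in>P. f \<bullet> u = f \<bullet> v \<longrightarrow> e \<bullet> v \<le> e \<bullet> u"
    have vP: "v \<in> P" using v(1) by (simp add: extreme_point_of_def)
    then have "pt (lower (f \<bullet> v)) (f \<bullet> v) \<in> P" using above_bottom top(1) lower_le_upper by blast
    then have "e \<bullet> v \<le> lower (f \<bullet> v)" using v(2) coord by metis
    then show "e \<bullet> v = lower (f \<bullet> v)" using mem_iff[of v] vP by linarith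
  qed
  finally show ?thesis .
qed

lemma right_in_hull:
  assumes "- of_int m \<le> y" "y \<le> of_int M" shows "pt (upper y) y \<in> convex hull right_vertices"
proof -
  have "pt (upper y) y \<in> convex hull {v. v extreme_point_of P \<and> (\<forall>u\<in>P. f \<bullet> u = f \<bullet> v \<longrightarrow> (- e) \<bullet> v \<le> (- e) \<bullet> u)}"
  proof (rule fibrewise_minimum_in_hull[OF P(2,1) fano_polygonD(9)[OF fano] lower_le_upper(2)[OF assms]])
    fix v assume "v \<in> P" "f \<bullet> v = f \<bullet> pt (upper y) y"
    then show "(- e) \<bullet> pt (upper y) y \<le> (- e) \<bullet> v" using mem_iff[of v] by (simp add: coord)
  qed
  also have "\<dots> \<subseteq> convex hull right_vertices"
  proof (rule hull_mono, clarsimp simp: right_vertices_def)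
    fix v assume v: "v extreme_point_of P" "\<forall>u\<in>P. f \<bullet> u = f \<bullet> v \<longrightarrow> e \<bullet> u \<le> e \<bullet> v"
    have vP: "v \<in> P" using v(1) by (simp add: extreme_point_of_def)
    then have "pt (upper (f \<bullet> v)) (f \<bullet> v) \<in> P" using above_bottom top(1) lower_le_upper by blast
    then have "upper (f \<bullet> v) \<le> e \<bullet> v" using v(2) coord by metis
    then show "e \<bullet> v = upper (f \<bullet> v)" using mem_iff[of v] vP by linarith
  qed
  finally show ?thesis .
qed

text \<open>The left boundary is spanned by vertices of \<open>P\<close> and the right boundary by sheared vertices, and each
  level is a segment between the two.\<close>

lemma mutated_subset_hull: "mutated \<subseteq> convex hull (left_vertices \<union> shear ` right_vertices)"
proof
  fix v assume v: "v \<in> mutated"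
  define x y where "x = e \<bullet> v" and "y = f \<bullet> v"
  have vxy: "v = pt x y" using point_at_inner[OF uni] by (simp add: x_def y_def)
  have y: "- of_int m \<le> y" "y \<le> of_int M" and x: "lower y \<le> x" "x \<le> upper y + y"
    using v unfolding vxy pt_mutated by auto
  let ?H = "convex hull (left_vertices \<union> shear ` right_vertices)"
  have l: "pt (lower y) y \<in> ?H" by (rule subsetD[OF hull_mono[OF Un_upper1] left_in_hull[OF y]])
  have "shear (pt (upper y) y) \<in> shear ` (convex hull right_vertices)" using right_in_hull[OF y] by blast
  then have "shear (pt (upper y) y) \<in> convex hull (shear ` right_vertices)"
    by (simp only: convex_hull_linear_image[OF linear_shear])
  then have "shear (pt (upper y) y) \<in> ?H" by (rule subsetD[OF hull_mono[OF Un_upper2]])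
  moreover have "shear (pt (upper y) y) = pt (upper y + y * 1) (y + y * 0)"
    unfolding shear_def coord by (simp only: point_at_linear)
  ultimately have r: "pt (upper y + y) y \<in> ?H" by simp
  have "x \<in> closed_segment (lower y) (upper y + y)" using x by (simp add: closed_segment_eq_real_ivl)
  then obtain u where u: "0 \<le> u" "u \<le> 1" "x = (1 - u) * lower y + u * (upper y + y)"
    by (auto simp: in_segment)
  have "(1 - u) *\<^sub>R pt (lower y) y + u *\<^sub>R pt (upper y + y) y \<in> ?H"
    using l r u by (intro convexD_alt) auto
  moreover have "(1 - u) * y + u * y = y" by (simp add: algebra_simps)
  ultimately show "v \<in> ?H" unfolding pt_comb vxy u(3) by (simp only:)
qed

lemma vertices_mutated: "left_vertices \<union> shear ` right_vertices \<subseteq> mutated"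
proof -
  have "v \<in> P" if "v extreme_point_of P" for v using that by (simp add: extreme_point_of_def)
  then show ?thesis
    using slice_length by (auto simp: left_vertices_def right_vertices_def mem_mutated shear_def mem_iff inner_add_right coord)
qed

lemma compact_mutated: "compact mutated"
proof -
  have "mutated = convex hull (left_vertices \<union> shear ` right_vertices)"
    using mutated_subset_hull hull_minimal[where S = convex, OF vertices_mutated convex_mutated]
    by (rule equalityI)
  moreover have "finite (left_vertices \<union> shear ` right_vertices)"
    using fano_polygonD(9)[OF fano] by (auto simp: left_vertices_def right_vertices_def intro: finite_subset)
  ultimately show ?thesis by (simp add: finite_imp_compact_convex_hull)
qed

text \<open>The lattice points of the mutated polygon on a level below the origin; their hull serves as \<open>G\<^sub>h\<close>.\<close>

definition generators :: "int \<Rightarrow> (real^2) set" where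
  "generators h = {v \<in> lattice. f \<bullet> v = of_int h \<and> lower (of_int h) \<le> e \<bullet> v \<and> e \<bullet> v \<le> upper (of_int h) + of_int h}"

definition summand :: "int \<Rightarrow> (real^2) set" where
  "summand h = convex hull (generators h)"

lemma generators_mutated:
  assumes "- m \<le> h" "h < 0" shows "generators h \<subseteq> mutated"
proof
  fix v assume v: "v \<in> generators h"
  have "real_of_int h \<le> of_int M" "- real_of_int m \<le> of_int h" using assms M_pos by linarith+
  then have "pt (e \<bullet> v) (f \<bullet> v) \<in> mutated" using v unfolding pt_mutated generators_def by auto
  then show "v \<in> mutated" using point_at_inner[OF uni] by simp
qed

end

section \<open>Boundary points of the mutated polygon\<close>

lemma minkowski_sum_hull_subset:
  assumes "convex C" "\<And>a b. a \<in> A \<Longrightarrow> b \<in> B \<Longrightarrow> a + b \<in> C"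
  shows "minkowski_sum (convex hull A) (convex hull B) \<subseteq> C"
proof -
  have "convex hull A + convex hull B = convex hull (A + B)" by (simp add: convex_hull_set_plus)
  also have "\<dots> \<subseteq> C" using assms by (intro hull_minimal) (auto simp: set_plus_def)
  finally show ?thesis by (auto simp: minkowski_sum_def set_plus_def)
qed

lemma frontier_if_exits:
  fixes P :: "'a::real_normed_vector set"
  assumes "v \<in> P" "\<And>t. t > 0 \<Longrightarrow> v + t *\<^sub>R d \<notin> P" shows "v \<in> frontier P"
proof -
  have "v \<notin> interior P"
  proof
    assume "v \<in> interior P"
    then obtain r where r: "r > 0" "ball v r \<subseteq> P" using mem_interior by blast
    have "d \<noteq> 0" using assms(1) assms(2)[of 1] by auto
    then have "v + (r / (2 * norm d)) *\<^sub>R d \<in> ball v r" "r / (2 * norm d) > 0" using r by (auto simp: dist_norm)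
    then show False using assms(2) r(2) by blast
  qed
  then show ?thesis using assms(1) closure_subset by (auto simp: frontier_def)
qed

context mutable_edge
begin

lemma h_min_eq: "h_min P f = - of_int m"
  unfolding h_min_def
proof (rule cInf_eq_minimum)
  show "- real_of_int m \<in> (\<bullet>) f ` P"
    using bottom_mem(1) by (intro image_eqI[of _ _ "pt (of_int x0) (- of_int m)"]) (simp_all add: coord)
qed (use above_bottom in auto)

lemma h_max_eq: "h_max P f = of_int M"
  unfolding h_max_def
proof (rule cSup_eq_maximum)
  show "real_of_int M \<in> (\<bullet>) f ` P"
    using top(2) by (intro image_eqI[of _ _ "pt (of_int xt) (of_int M)"]) (simp_all add: coord)
qed (use top(1) in auto)

lemma primitive_step: "primitive (pt 1 0)"
  using uni by (intro primitive_if_dual[of _ e])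
    (auto simp: point_at_lattice coord inner_commute unimodular_def)

lemma dilate_segment: "dilate h (convex hull {0, pt 1 0}) = convex hull {0, of_int h *\<^sub>R pt 1 0}"
  unfolding dilate_def convex_hull_scaling[symmetric] by simp

lemma shift_coord: "e \<bullet> (v + c *\<^sub>R pt 1 0) = e \<bullet> v + c" "f \<bullet> (v + c *\<^sub>R pt 1 0) = f \<bullet> v"
    "e \<bullet> (v - c *\<^sub>R pt 1 0) = e \<bullet> v - c" "f \<bullet> (v - c *\<^sub>R pt 1 0) = f \<bullet> v"
  by (simp_all add: inner_add_right inner_diff_right coord)

lemma shift_lattice: "v \<in> lattice \<Longrightarrow> v + of_int c *\<^sub>R pt 1 0 \<in> lattice"
  using primitive_in_lattice[OF primitive_step] by (intro lattice_add lattice_scaleR) auto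

lemma summand_subset_slice:
  assumes "- m \<le> h" "h < 0"
  shows "minkowski_sum (summand h) (dilate \<bar>h\<bar> (convex hull {0, pt 1 0})) \<subseteq> slice P f h"
  unfolding summand_def dilate_segment
proof (rule minkowski_sum_hull_subset)
  show "convex (slice P f h)" by (simp add: slice_def convex_convex_hull)
  fix a b assume a: "a \<in> generators h" and b: "b \<in> {0, of_int \<bar>h\<bar> *\<^sub>R pt 1 0}"
  obtain c where c: "b = of_int c *\<^sub>R pt 1 0" "0 \<le> c" "c \<le> - h" 
    using b assms(2) by (cases "b = 0") (auto intro: that[of 0] that[of "- h"])
  have g: "a \<in> lattice" "f \<bullet> a = of_int h" "lower (of_int h) \<le> e \<bullet> a" "e \<bullet> a \<le> upper (of_int h) + of_int h"
    using a by (auto simp: generators_def)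
  have "real_of_int c \<le> - of_int h" "- real_of_int m \<le> of_int h" "real_of_int h \<le> of_int M" "0 \<le> real_of_int c"
    using c assms M_pos by linarith+
  then have "a + b \<in> P" unfolding mem_iff c(1) shift_coord g(2) using g(3,4) by linarith
  moreover have "a + b \<in> lattice" unfolding c(1) using g(1) by (rule shift_lattice)
  moreover have "f \<bullet> (a + b) = of_int h" unfolding c(1) shift_coord by (rule g(2))
  ultimately show "a + b \<in> slice P f h" unfolding slice_def by (intro hull_inc) blast
qed

lemma vertex_on_boundary:
  assumes "v extreme_point_of P" shows "e \<bullet> v = lower (f \<bullet> v) \<or> e \<bullet> v = upper (f \<bullet> v)"
proof (rule ccontr)
  assume neg: "\<not> ?thesis"
  have vP: "v \<in> P" using assms by (simp add: extreme_point_of_def)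
  define y where "y = f \<bullet> v"
  have y: "- of_int m \<le> y" "y \<le> of_int M" "lower y < e \<bullet> v" "e \<bullet> v < upper y"
    using vP neg unfolding mem_iff y_def by linarith+
  then have "e \<bullet> v \<in> open_segment (lower y) (upper y)" by (simp add: open_segment_eq_real_ivl)
  then obtain u where u: "0 < u" "u < 1" "e \<bullet> v = (1 - u) * lower y + u * upper y" by (auto simp: in_segment)
  have "(1 - u) * y + u * y = y" by (simp add: algebra_simps)
  then have "v = (1 - u) *\<^sub>R pt (lower y) y + u *\<^sub>R pt (upper y) y"
    unfolding pt_comb u(3)[symmetric] using point_at_inner[OF uni, of v] by (simp add: y_def)
  moreover have "pt (lower y) y \<noteq> pt (upper y) y" using y coord(1) by (metis order.asym order_less_trans less_irrefl)
  ultimately have "v \<in> open_segment (pt (lower y) y) (pt (upper y) y)" unfolding in_segment using u by blast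
  then show False using assms lower_le_upper[OF y(1,2)] unfolding extreme_point_of_def by blast
qed

text \<open>A vertex is an integral end of its level, so the level still contains lattice points after the
  right end is moved by \<open>h\<close>; translates of these by at most \<open>\<bar>h\<bar>\<close> reach the vertex.\<close>

lemma vertex_in_summand:
  assumes v: "v extreme_point_of P" "f \<bullet> v = of_int h" and h: "- m \<le> h" "h < 0"
  shows "v \<in> minkowski_sum (summand h) (dilate \<bar>h\<bar> (convex hull {0, pt 1 0}))"
proof -
  let ?l = "lower (of_int h)" and ?u = "upper (of_int h)"
  have vP: "v \<in> P" using v(1) by (simp add: extreme_point_of_def)
  have "v \<in> lattice" using fano_polygonD(10)[OF fano v(1)] by (rule primitive_in_lattice)
  then obtain x where x: "e \<bullet> v = of_int x" using lattice_coords[OF uni] Ints_cases by blast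
  have xb: "?l \<le> of_int x" "of_int x \<le> ?u" using vP x v(2) mem_iff by metis+
  have len: "?l \<le> ?u + of_int h" using h M_pos by (intro slice_length) linarith+
  define g where "g = min x (\<lfloor>?u\<rfloor> + h)"
  have "?l \<le> of_int \<lfloor>?u\<rfloor> + of_int h"
    using vertex_on_boundary[OF v(1)] unfolding x v(2)
  proof
    assume "of_int x = ?l"
    then have "of_int (x - h) \<le> ?u" using len by linarith
    then have "x - h \<le> \<lfloor>?u\<rfloor>" by (simp only: le_floor_iff)
    then show ?thesis using \<open>of_int x = ?l\<close> by linarith
  next
    assume "of_int x = ?u"
    then show ?thesis using len by (metis floor_of_int)
  qed
  then have g1: "?l \<le> of_int g" using xb by (simp add: g_def min_def)
  have "x \<le> \<lfloor>?u\<rfloor>" using xb(2) by (simp add: le_floor_iff)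
  then have g2: "0 \<le> x - g" "x - g \<le> - h" using h by (auto simp: g_def)
  have "of_int g \<le> ?u + of_int h"
    using of_int_floor_le[of ?u] unfolding g_def by linarith
  then have "pt (of_int g) (of_int h) \<in> generators h"
    using g1 by (simp add: generators_def point_at_lattice[OF uni] coord)
  then have gs: "pt (of_int g) (of_int h) \<in> summand h" unfolding summand_def by (rule hull_inc)
  define t where "t = of_int (x - g) / real_of_int \<bar>h\<bar>"
  have "0 < real_of_int \<bar>h\<bar>" "0 \<le> real_of_int (x - g)" "real_of_int (x - g) \<le> of_int \<bar>h\<bar>"
    using g2 h by linarith+
  then have t: "0 \<le> t" "t \<le> 1" "of_int \<bar>h\<bar> * t = of_int (x - g)"
    unfolding t_def by (simp_all only: divide_le_eq_1_pos zero_le_divide_iff, auto)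
  have "t *\<^sub>R pt 1 0 \<in> convex hull {0, pt 1 0}"
    unfolding segment_convex_hull[symmetric] in_segment using t by (intro exI[of _ t]) simp
  then have "of_int \<bar>h\<bar> *\<^sub>R t *\<^sub>R pt 1 0 \<in> dilate \<bar>h\<bar> (convex hull {0, pt 1 0})"
    unfolding dilate_def by blast
  then have d: "of_int (x - g) *\<^sub>R pt 1 0 \<in> dilate \<bar>h\<bar> (convex hull {0, pt 1 0})"
    using t(3) by (metis scaleR_scaleR)
  have "v = pt (of_int g) (of_int h) + of_int (x - g) *\<^sub>R pt 1 0"
    by (rule coords_eqI[OF uni]; unfold shift_coord coord x v(2)) auto
  then show ?thesis unfolding minkowski_sum_def using gs d by blast
qed

lemma lattice_polytope_summand:
  assumes "- m \<le> h" "h < 0" shows "lattice_polytope (summand h)"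
proof -
  have "generators h \<subseteq> mutated \<inter> lattice" using generators_mutated[OF assms] by (auto simp: generators_def)
  moreover have "finite (mutated \<inter> lattice)"
    using card_lattice_by_rows(3)[OF uni compact_imp_bounded[OF compact_mutated], of "-m" M] mem_mutated by auto
  ultimately have "finite (generators h)" by (rule finite_subset)
  then show ?thesis unfolding lattice_polytope_def summand_def by (auto simp: generators_def)
qed

text \<open>The hull that defines the mutation contains the vertices and sheared vertices that span the set
  \<open>mutated\<close>, and all its pieces lie in this set.\<close>

lemma is_mutation_mutated: "is_mutation P mutated"
  unfolding is_mutation_def
proof (intro exI conjI)
  let ?E = "edge_at P f m" and ?F = "convex hull {0, pt 1 0}"
  show "?E edge_of P" by (rule edge_line_edge_of[OF fano line])
  show "f = inner_normal P ?E" by (rule edge_line_inner_normal[OF fano line, symmetric])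
  show "primitive (pt 1 0)" by (rule primitive_step)
  show "f \<bullet> pt 1 0 = 0" by (simp add: coord)
  show "?F = convex hull {0, pt 1 0}" ..
  show "\<forall>h. h_min P f \<le> of_int h \<and> h < 0 \<longrightarrow> lattice_polytope (summand h) \<and>
      {u. u extreme_point_of P \<and> f \<bullet> u = of_int h} \<subseteq> minkowski_sum (summand h) (dilate \<bar>h\<bar> ?F) \<and>
      minkowski_sum (summand h) (dilate \<bar>h\<bar> ?F) \<subseteq> slice P f h"
  proof (intro allI impI)
    fix h :: int assume "h_min P f \<le> of_int h \<and> h < 0"
    then have h: "- m \<le> h" "h < 0" unfolding h_min_eq by linarith+
    show "lattice_polytope (summand h) \<and>
      {u. u extreme_point_of P \<and> f \<bullet> u = of_int h} \<subseteq> minkowski_sum (summand h) (dilate \<bar>h\<bar> ?F) \<and>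
      minkowski_sum (summand h) (dilate \<bar>h\<bar> ?F) \<subseteq> slice P f h"
      using lattice_polytope_summand[OF h] vertex_in_summand[OF _ _ h] summand_subset_slice[OF h] by blast
  qed
  let ?A = "(\<Union>h\<in>{h. h_min P f \<le> of_int h \<and> h < 0}. summand h) \<union>
            (\<Union>h\<in>{h. 0 \<le> h \<and> of_int h \<le> h_max P f}. minkowski_sum (slice P f h) (dilate h ?F))"
  have "?A \<subseteq> mutated"
  proof (intro Un_least UN_least)
    fix h :: int assume "h \<in> {h. h_min P f \<le> of_int h \<and> h < 0}"
    then have h: "- m \<le> h" "h < 0" unfolding h_min_eq by auto
    show "summand h \<subseteq> mutated"
      unfolding summand_def using generators_mutated[OF h] convex_mutated by (rule hull_minimal)
  next
    fix h :: int assume "h \<in> {h. 0 \<le> h \<and> of_int h \<le> h_max P f}"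
    then have h: "0 \<le> h" by auto
    show "minkowski_sum (slice P f h) (dilate h ?F) \<subseteq> mutated"
      unfolding slice_def dilate_segment
    proof (rule minkowski_sum_hull_subset[OF convex_mutated])
      fix a b assume a: "a \<in> {v \<in> P \<inter> lattice. f \<bullet> v = of_int h}" and b: "b \<in> {0, of_int h *\<^sub>R pt 1 0}"
      obtain c where c: "b = c *\<^sub>R pt 1 0" "0 \<le> c" "c \<le> of_int h"
        using b h by (cases "b = 0") (auto intro: that[of 0] that[of "of_int h"])
      have a': "a \<in> P" "f \<bullet> a = of_int h" using a by auto
      show "a + b \<in> mutated"
        using a'(1) c(2,3) unfolding mem_iff[of a] mem_mutated c(1) shift_coord a'(2) by linarith
    qed
  qed
  then have 1: "convex hull ?A \<subseteq> mutated" using convex_mutated by (rule hull_minimal)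
  have 2: "left_vertices \<union> shear ` right_vertices \<subseteq> ?A"
  proof
    fix v assume v: "v \<in> left_vertices \<union> shear ` right_vertices"
    then obtain u where u: "u extreme_point_of P" "v = u \<or> v = shear u"
      unfolding left_vertices_def right_vertices_def by blast
    have uP: "u \<in> P" using u(1) by (simp add: extreme_point_of_def)
    have ul: "u \<in> lattice" using fano_polygonD(10)[OF fano u(1)] by (rule primitive_in_lattice)
    then obtain h where h: "f \<bullet> u = of_int h" using lattice_coords[OF uni] Ints_cases by blast
    have fv: "f \<bullet> v = of_int h" using u(2) h by (auto simp: shear_def shift_coord)
    have vl: "v \<in> lattice" using u(2) ul shift_lattice by (auto simp: shear_def h)
    have vm: "v \<in> mutated" using v vertices_mutated by blast
    have hb: "- real_of_int m \<le> of_int h" "real_of_int h \<le> of_int M" using uP h mem_iff by metis+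
    show "v \<in> ?A"
    proof (cases "h < 0")
      case True
      have "v \<in> generators h" using vl fv vm unfolding generators_def mem_mutated by auto
      then have "v \<in> summand h" unfolding summand_def by (rule hull_inc)
      then show ?thesis using True hb h_min_eq by auto
    next
      case False
      have "u \<in> slice P f h" unfolding slice_def using uP ul h by (intro hull_inc) auto
      moreover have "v = u + 0 \<or> v = u + of_int h *\<^sub>R pt 1 0" using u(2) h by (auto simp: shear_def)
      moreover have "0 \<in> dilate h ?F" "of_int h *\<^sub>R pt 1 0 \<in> dilate h ?F"
        unfolding dilate_segment by (auto intro: hull_inc)
      ultimately have "v \<in> minkowski_sum (slice P f h) (dilate h ?F)" unfolding minkowski_sum_def by blast
      then show ?thesis using False hb h_max_eq by auto
    qed
  qed
  show "mutated = convex hull ?A"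
    using 1 mutated_subset_hull hull_mono[OF 2, of convex] by blast
qed

abbreviation row :: "(real^2) set \<Rightarrow> int \<Rightarrow> int set" where
  "row S y \<equiv> {x. pt (of_int x) (of_int y) \<in> S}"

lemma frontier_mutated:
  assumes "v \<in> frontier mutated"
  shows "v \<in> mutated"
    "f \<bullet> v = - of_int m \<or> f \<bullet> v = of_int M \<or> e \<bullet> v = lower (f \<bullet> v) \<or> e \<bullet> v = upper (f \<bullet> v) + f \<bullet> v"
proof -
  show v: "v \<in> mutated"
    using assms compact_mutated compact_imp_closed frontier_subset_closed by blast
  show "f \<bullet> v = - of_int m \<or> f \<bullet> v = of_int M \<or> e \<bullet> v = lower (f \<bullet> v) \<or> e \<bullet> v = upper (f \<bullet> v) + f \<bullet> v"
  proof (rule ccontr)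
    assume neg: "\<not> ?thesis"
    have vi: "- of_int m \<le> f \<bullet> v" "f \<bullet> v \<le> of_int M" "lower (f \<bullet> v) \<le> e \<bullet> v" "e \<bullet> v \<le> upper (f \<bullet> v) + f \<bullet> v"
      using v unfolding mem_mutated by auto
    have Mm: "- real_of_int m \<le> of_int M" using M_pos m_pos by linarith
    have "v \<in> interior mutated"
    proof (rule interior_pointI[OF convex_mutated uni v])
      show "v - (e \<bullet> v - lower (f \<bullet> v)) *\<^sub>R pt 1 0 \<in> mutated"
        using vi slice_length[OF vi(1,2)] by (simp add: mem_mutated shift_coord)
      show "v + (upper (f \<bullet> v) + f \<bullet> v - e \<bullet> v) *\<^sub>R pt 1 0 \<in> mutated"
        using vi slice_length[OF vi(1,2)] by (simp add: mem_mutated shift_coord)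
      show "pt (lower (- of_int m)) (- of_int m) \<in> mutated" "pt (lower (of_int M)) (of_int M) \<in> mutated"
        using slice_length[of "- of_int m"] slice_length[of "of_int M"] Mm by (auto simp: pt_mutated)
    qed (use neg vi in \<open>auto simp: coord\<close>)
    then show False using assms by (simp add: frontier_def)
  qed
qed

lemma frontier_sides:
  assumes "v \<in> P"
    "f \<bullet> v = - of_int m \<or> f \<bullet> v = of_int M \<or> e \<bullet> v = lower (f \<bullet> v) \<or> e \<bullet> v = upper (f \<bullet> v)"
  shows "v \<in> frontier P"
proof -
  have vv: "f \<bullet> (v + t *\<^sub>R pt 0 s) = f \<bullet> v + t * s" for t s by (simp add: inner_add_right coord)
  consider "f \<bullet> v = - of_int m" | "f \<bullet> v = of_int M" | "e \<bullet> v = lower (f \<bullet> v)" | "e \<bullet> v = upper (f \<bullet> v)"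
    using assms(2) by blast
  then show ?thesis
  proof cases
    case 1
    show ?thesis
      by (rule frontier_if_exits[OF assms(1), of "pt 0 (-1)"])
        (use above_bottom vv[of _ "-1"] 1 in \<open>force\<close>)
  next
    case 2
    show ?thesis
      by (rule frontier_if_exits[OF assms(1), of "pt 0 1"])
        (use top(1) vv[of _ 1] 2 in \<open>force\<close>)
  next
    case 3
    show ?thesis
    proof (rule frontier_if_exits[OF assms(1), of "- pt 1 0"])
      fix t :: real assume "t > 0"
      then show "v + t *\<^sub>R - pt 1 0 \<notin> P" using 3 shift_coord[of v "- t"] by (simp add: mem_iff)
    qed
  next
    case 4
    show ?thesis
      by (rule frontier_if_exits[OF assms(1), of "pt 1 0"]) (use 4 in \<open>simp add: mem_iff shift_coord\<close>)
  qed
qed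

lemma bottom_range:
  assumes "pt x (- of_int m) \<in> P" shows "of_int x0 \<le> x" "x \<le> of_int (x0 + k)"
proof -
  have "pt x (- of_int m) \<in> edge_at P f m" using assms by (simp add: coord)
  then obtain t where t: "0 \<le> t" "t \<le> 1"
    "pt x (- of_int m) = (1 - t) *\<^sub>R pt (of_int x0) (- of_int m) + t *\<^sub>R pt (of_int (x0 + k)) (- of_int m)"
    unfolding bottom in_segment by blast
  have "x = (1 - t) * of_int x0 + t * of_int (x0 + k)" using t(3) unfolding pt_comb by (metis coord(1))
  then have x: "x = of_int x0 + t * of_int k" by (simp add: algebra_simps)
  have "0 \<le> t * of_int k" "t * of_int k \<le> of_int k"
    using t long m_pos by (auto intro: mult_left_le_one_le)
  then show "of_int x0 \<le> x" "x \<le> of_int (x0 + k)" using x by simp_all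
qed

lemma finite_row: "bounded S \<Longrightarrow> (\<And>v. v \<in> S \<Longrightarrow> - of_int m \<le> f \<bullet> v \<and> f \<bullet> v \<le> of_int M) \<Longrightarrow> finite (row S y)"
  using card_lattice_by_rows(2)[OF uni, of S "-m" M y] by simp

lemma frontier_P_bounds: "v \<in> frontier P \<Longrightarrow> - of_int m \<le> f \<bullet> v \<and> f \<bullet> v \<le> of_int M"
  using P(4) frontier_subset_closed above_bottom top(1) by blast

lemma finite_row_frontier: "finite (row (frontier P) y)"
  by (rule finite_row[OF _ frontier_P_bounds]) (use P(3) in \<open>auto simp: compact_frontier_bounded compact_imp_bounded\<close>)

text \<open>The boundary points are compared level by level. The lowest level loses \<open>m\<close> lattice points and the
  highest gains \<open>M\<close>. On a level in between, both polygons have at most two boundary points, at the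
  ends; the mutation moves the right end by an integer and can at worst make the two ends coincide.\<close>

lemma bottom_row: "int (card (row (frontier mutated) (- m))) + m \<le> int (card (row (frontier P) (- m)))"
proof -
  have m: "- real_of_int m \<le> - of_int m" "- real_of_int m \<le> of_int M" using M_pos m_pos by linarith+
  have "row (frontier mutated) (- m) \<subseteq> {x0..x0 + k - m}"
  proof
    fix x assume "x \<in> row (frontier mutated) (- m)"
    then have "pt (of_int x) (- of_int m) \<in> mutated" using frontier_mutated(1) by auto
    then have "lower (- of_int m) \<le> of_int x" "of_int x \<le> upper (- of_int m) - of_int m" by (auto simp: pt_mutated)
    then have "real_of_int x0 \<le> of_int x" "real_of_int x \<le> of_int (x0 + k) - of_int m"
      using bottom_range[OF lower_le_upper(1)[OF m]] bottom_range[OF lower_le_upper(2)[OF m]] by linarith+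
    then show "x \<in> {x0..x0 + k - m}" by auto
  qed
  then have "card (row (frontier mutated) (- m)) \<le> card {x0..x0 + k - m}" by (intro card_mono) auto
  moreover have "{x0..x0 + k} \<subseteq> row (frontier P) (- m)"
  proof
    fix x assume "x \<in> {x0..x0 + k}"
    then have "lower (- of_int m) \<le> of_int x" "of_int x \<le> upper (- of_int m)"
      using bottom_mem unfolding slice_iff[OF m] by (auto intro: order_trans)
    then have "pt (of_int x) (- of_int m) \<in> P" unfolding slice_iff[OF m] by blast
    then show "x \<in> row (frontier P) (- m)" using frontier_sides[of "pt (of_int x) (- of_int m)"] by (simp add: coord)
  qed
  then have "card {x0..x0 + k} \<le> card (row (frontier P) (- m))" by (intro card_mono finite_row_frontier)
  ultimately show ?thesis using long m_pos by simp
qed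

lemma top_row: "int (card (row (frontier mutated) M)) \<le> int (card (row (frontier P) M)) + M"
proof -
  have m: "- real_of_int m \<le> of_int M" "real_of_int M \<le> of_int M" using M_pos m_pos by linarith+
  let ?l = "\<lceil>lower (of_int M)\<rceil>" and ?u = "\<lfloor>upper (of_int M)\<rfloor>"
  have "row (frontier mutated) M \<subseteq> {?l..?u + M}"
  proof
    fix x assume "x \<in> row (frontier mutated) M"
    then have "pt (of_int x) (of_int M) \<in> mutated" using frontier_mutated(1) by auto
    then have "lower (of_int M) \<le> of_int x" "of_int (x - M) \<le> upper (of_int M)" by (auto simp: pt_mutated)
    then have "?l \<le> x" "x - M \<le> ?u" by (simp_all only: ceiling_le_iff le_floor_iff)
    then show "x \<in> {?l..?u + M}" by auto
  qed
  then have "card (row (frontier mutated) M) \<le> card {?l..?u + M}" by (intro card_mono) auto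
  moreover have "{?l..?u} \<subseteq> row (frontier P) M"
  proof
    fix x assume "x \<in> {?l..?u}"
    then have "pt (of_int x) (of_int M) \<in> P" unfolding slice_iff[OF m] by (simp add: ceiling_le_iff le_floor_iff)
    then show "x \<in> row (frontier P) M" using frontier_sides[of "pt (of_int x) (of_int M)"] by (simp add: coord)
  qed
  then have "card {?l..?u} \<le> card (row (frontier P) M)" by (intro card_mono finite_row_frontier)
  moreover have "?l \<le> xt" "xt \<le> ?u" using top(2) unfolding slice_iff[OF m] by (simp_all add: ceiling_le_iff le_floor_iff)
  ultimately show ?thesis using M_pos by simp
qed

lemma middle_row:
  assumes "- m < y" "y < M" shows "card (row (frontier mutated) y) \<le> card (row (frontier P) y)"
proof -
  have r: "- real_of_int m < of_int y" "real_of_int y < of_int M" using assms by linarith+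
  then have r': "- real_of_int m \<le> of_int y" "real_of_int y \<le> of_int M" by linarith+
  let ?L = "{x::int. of_int x = lower (of_int y)}" and ?U = "{x::int. of_int x = upper (of_int y)}"
  have single: "finite {x::int. of_int x = c}" for c :: real
  proof (cases "{x::int. of_int x = c} = {}")
    case False
    then obtain a where "of_int a = c" by blast
    then have "{x::int. of_int x = c} = {a}" by auto
    then show ?thesis by simp
  qed simp
  have "row (frontier mutated) y \<subseteq> ?L \<union> (\<lambda>x. x + y) ` ?U"
  proof
    fix x assume x: "x \<in> row (frontier mutated) y"
    then have "of_int x = lower (of_int y) \<or> of_int x = upper (of_int y) + of_int y"
      using frontier_mutated(2)[of "pt (of_int x) (of_int y)"] r unfolding coord by auto
    then show "x \<in> ?L \<union> (\<lambda>x. x + y) ` ?U"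
    proof
      assume "of_int x = upper (of_int y) + of_int y"
      then show ?thesis by (intro UnI2 image_eqI[of _ _ "x - y"]) auto
    qed auto
  qed
  then have "card (row (frontier mutated) y) \<le> card (?L \<union> (\<lambda>x. x + y) ` ?U)"
    using single by (intro card_mono) auto
  also have "\<dots> \<le> card ?L + card ((\<lambda>x. x + y) ` ?U)" by (rule card_Un_le)
  also have "\<dots> \<le> card ?L + card ?U" using single card_image_le by (intro add_left_mono) blast
  also have "\<dots> = card (?L \<union> ?U)"
    using lower_less_upper[OF r] single by (intro card_Un_disjoint[symmetric]) auto
  also have "\<dots> \<le> card (row (frontier P) y)"
  proof (intro card_mono finite_row_frontier Un_least subsetI)
    fix x assume "x \<in> ?L"
    then show "x \<in> row (frontier P) y"
      using frontier_sides[of "pt (of_int x) (of_int y)"] lower_le_upper(1)[OF r'] by (simp add: coord)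
  next
    fix x assume "x \<in> ?U"
    then show "x \<in> row (frontier P) y"
      using frontier_sides[of "pt (of_int x) (of_int y)"] lower_le_upper(2)[OF r'] by (simp add: coord)
  qed
  finally show ?thesis .
qed

lemma card_frontier_mutated:
  "int (card (frontier mutated \<inter> lattice)) + m \<le> int (card (frontier P \<inter> lattice)) + M"
proof -
  have set: "{-m..M} = insert (-m) (insert M {-m<..<M})" using m_pos M_pos by auto
  have "-m \<noteq> M" using m_pos M_pos by auto
  then have split: "(\<Sum>y=-m..M. g y) = g (-m) + g M + (\<Sum>y\<in>{-m<..<M}. g y)" for g :: "int \<Rightarrow> nat"
    unfolding set by simp
  have "card (frontier mutated \<inter> lattice) = (\<Sum>y=-m..M. card (row (frontier mutated) y))"
  proof (rule card_lattice_by_rows(1)[OF uni])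
    show "bounded (frontier mutated)" using compact_mutated by (simp add: compact_frontier compact_imp_bounded)
    fix v assume "v \<in> frontier mutated"
    then show "of_int (- m) \<le> f \<bullet> v \<and> f \<bullet> v \<le> of_int M" using frontier_mutated(1) mem_mutated by auto
  qed
  moreover have "card (frontier P \<inter> lattice) = (\<Sum>y=-m..M. card (row (frontier P) y))"
    using frontier_P_bounds P(3) by (intro card_lattice_by_rows(1)[OF uni]) (auto simp: compact_frontier_bounded compact_imp_bounded)
  moreover have "(\<Sum>y\<in>{-m<..<M}. card (row (frontier mutated) y)) \<le> (\<Sum>y\<in>{-m<..<M}. card (row (frontier P) y))"
    using middle_row by (intro sum_mono) auto
  ultimately show ?thesis using bottom_row top_row unfolding split by linarith
qed

end

text \<open>Mutation at a long edge raises the number of boundary points by at most \<open>M - h\<close>, where \<open>M\<close> is the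
  height of the polygon opposite to the edge. Minimality therefore demands \<open>h \<le> M\<close>.\<close>

lemma minimal_fano_polygon_long_edge:
  assumes "minimal_fano_polygon P" "edge_line P w h" "h \<le> int (width (edge_at P w h))"
  shows "\<exists>v\<in>P. of_int h \<le> w \<bullet> v"
proof -
  have P: "fano_polygon P" using assms(1) by (simp add: minimal_fano_polygon_def)
  have w: "primitive w" using assms(2) by (simp add: edge_line_def)
  obtain u and k :: int where u: "k \<ge> 1" "primitive u" "primitive (u + of_int k *\<^sub>R rot w)"
    "edge_at P w h = closed_segment u (u + of_int k *\<^sub>R rot w)"
    using edge_line_segment[OF P assms(2)] .
  have k: "h \<le> k" using assms(3) unfolding u(4) using width_segment[of "rot w" u k] w u by (simp add: primitive_in_lattice)
  obtain e0 where e0: "unimodular e0 w" using unimodular_complement[OF w] .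
  have "e0 \<bullet> rot w = 1 \<or> (- e0) \<bullet> rot w = 1" using e0 unfolding unimodular_def inner2 by (auto simp: abs_if split: if_splits)
  then obtain e where e: "unimodular e w" "e \<bullet> rot w = 1" using e0 unimodular_flip by blast
  obtain x0 y0 where "e \<bullet> u = of_int x0" "w \<bullet> u = of_int y0" using primitive_coords[OF e(1) u(2)] by blast
  have "u \<in> edge_at P w h" unfolding u(4) by simp
  then have wu: "w \<bullet> u = - of_int h" by blast
  have bottom: "u = point_at e w (of_int x0) (- of_int h)"
    "u + of_int k *\<^sub>R rot w = point_at e w (of_int (x0 + k)) (- of_int h)"
    by (rule coords_eqI[OF e(1)]; simp add: inner_point_at[OF e(1)] inner_add_right e(2) wu \<open>e \<bullet> u = of_int x0\<close>)+
  let ?X = "{v. v extreme_point_of P}"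
  have "?X \<noteq> {}" using fano_polygonD(6,8)[OF P] by (metis convex_hull_empty empty_iff)
  then have "Max ((\<bullet>) w ` ?X) \<in> (\<bullet>) w ` ?X" using fano_polygonD(9)[OF P] by (intro Max_in) auto
  then obtain v where v: "v \<in> ?X" "w \<bullet> v = Max ((\<bullet>) w ` ?X)" by auto
  then have max: "w \<bullet> x \<le> w \<bullet> v" if "x \<in> ?X" for x using fano_polygonD(9)[OF P] that by simp
  obtain xt M where xt: "e \<bullet> v = of_int xt" "w \<bullet> v = of_int M"
    using primitive_coords[OF e(1) fano_polygonD(10)[OF P]] v(1) by blast
  have vP: "v \<in> P" using v(1) by (simp add: extreme_point_of_def)
  have "convex hull ?X \<subseteq> {x. w \<bullet> x \<le> w \<bullet> v}"
    using max by (intro hull_minimal) (auto simp: convex_halfspace_le)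
  then have top: "w \<bullet> x \<le> of_int M" if "x \<in> P" for x using fano_polygonD(8)[OF P] xt(2) that by auto
  interpret mutable_edge P e w h M k x0 xt
  proof
    show "point_at e w (of_int xt) (of_int M) \<in> P" using vP point_at_inner[OF e(1), of v] xt by simp
  qed (use P e assms(2) u(4) bottom k top in auto)
  have "card (frontier P \<inter> lattice) \<le> card (frontier mutated \<inter> lattice)"
    using assms(1) is_mutation_mutated by (simp add: minimal_fano_polygon_def)
  then have "h \<le> M" using card_frontier_mutated by linarith
  then show ?thesis using vP xt(2) by (intro bexI[of _ v]) auto
qed

section \<open>Polygons standing on their highest edge\<close>

text \<open>What the bound on heights uses of a minimal polygon, in coordinates: \<open>R\<close> is the polygon and
  \<open>facet d c h\<close> says that \<open>d * x - c * y \<ge> - h\<close> is the inequality of an edge, so that \<open>(c, d)\<close> is the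
  direction of the edge. Edges of height above \<open>K\<close> have no residue, and the polygon reaches at least
  as far on the opposite side. All heights are at most \<open>m\<close>, which is assumed large in order to reach
  a contradiction. The arguments of \<open>R\<close> are real because convex combinations of lattice points occur.\<close>

locale plane_polygon =
  fixes K m :: int and R :: "real \<Rightarrow> real \<Rightarrow> bool" and facet :: "int \<Rightarrow> int \<Rightarrow> int \<Rightarrow> bool"
  assumes K: "3 \<le> K" and m: "6 * K < m"
    and R_convex: "\<lbrakk>R x y; R x' y'; 0 \<le> t; t \<le> 1\<rbrakk> \<Longrightarrow> R ((1 - t) * x + t * x') ((1 - t) * y + t * y')"
    and facet_ge: "\<lbrakk>facet d c h; R x y\<rbrakk> \<Longrightarrow> - of_int h \<le> of_int d * x - of_int c * y"
    and tight: "\<lbrakk>R x y; \<And>t. t > 0 \<Longrightarrow> \<not> R (x + t * p) (y + t * q)\<rbrakk> \<Longrightarrow>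
      \<exists>d c h. facet d c h \<and> of_int d * x - of_int c * y = - of_int h \<and> of_int d * p - of_int c * q < 0"
    and facetI: "\<lbrakk>coprime d c; \<And>x y. R x y \<Longrightarrow> - of_int h \<le> of_int d * x - of_int c * y; R x y; R x' y';
      x \<noteq> x' \<or> y \<noteq> y'; of_int d * x - of_int c * y = - of_int h; of_int d * x' - of_int c * y' = - of_int h\<rbrakk>
      \<Longrightarrow> facet d c h"
    and facet_coprime: "facet d c h \<Longrightarrow> coprime d c"
    and height_pos: "facet d c h \<Longrightarrow> 0 < h" and height_le: "facet d c h \<Longrightarrow> h \<le> m"
    and facet_segment: "facet d c h \<Longrightarrow> \<exists>x0 y0 k. 1 \<le> k \<and> d * x0 - c * y0 = - h \<and>
      coprime x0 y0 \<and> coprime (x0 + k * c) (y0 + k * d) \<and>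
      (\<forall>t. R (of_int x0 + t * of_int c) (of_int y0 + t * of_int d) \<longleftrightarrow> 0 \<le> t \<and> t \<le> of_int k) \<and>
      (K < h \<longrightarrow> h dvd k)"
    and facet_opposite: "\<lbrakk>facet d c h; K < h\<rbrakk> \<Longrightarrow> \<exists>x y. R x y \<and> of_int h \<le> of_int d * x - of_int c * y"
    and facet_direction: "p \<noteq> 0 \<or> q \<noteq> 0 \<Longrightarrow> \<exists>d c h. facet d c h \<and> of_int d * p - of_int c * q < (0::real)"
begin

abbreviation edge_points :: "int \<Rightarrow> int \<Rightarrow> int \<Rightarrow> int \<Rightarrow> int \<Rightarrow> bool" where
  "edge_points d c x0 y0 k \<equiv>
    \<forall>t. R (of_int x0 + t * of_int c) (of_int y0 + t * of_int d) \<longleftrightarrow> 0 \<le> t \<and> t \<le> of_int k"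

lemma facet_ge_int:
  assumes "facet d c h" "R (of_int x) (of_int y)" shows "- h \<le> d * x - c * y"
proof -
  have "real_of_int (- h) \<le> of_int (d * x - c * y)" using facet_ge[OF assms] by simp
  then show ?thesis by (simp only: of_int_le_iff)
qed

text \<open>Edges are often recognised as sets of real points. Two parametrisations by the same primitive
  direction differ by an integral shift, so they have the same length.\<close>

lemma facet_length_dvd:
  assumes f: "facet d c h" "K < h" and eq: "d * x1 - c * y1 = - h" and "0 \<le> L"
    and L: "\<And>t. R (of_int x1 + t * of_int c) (of_int y1 + t * of_int d) \<longleftrightarrow> 0 \<le> t \<and> t \<le> of_int L"
  shows "h dvd L"
proof -
  obtain x0 y0 k where k: "1 \<le> k" "d * x0 - c * y0 = - h"
    "edge_points d c x0 y0 k" "h dvd k"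
    using facet_segment[OF f(1)] f(2) by blast
  have cop: "coprime d c" by (rule facet_coprime[OF f(1)])
  have par: "d * (x1 - x0) = c * (y1 - y0)" using eq k(2) by (simp add: algebra_simps)
  obtain s where s: "x1 = x0 + s * c" "y1 = y0 + s * d"
  proof (cases "c = 0")
    case True
    then have "d = 1 \<or> d = -1" using cop by (simp add: zdvd1_eq abs_eq_iff')
    then show ?thesis using that[of "(y1 - y0) * d"] True par by (auto simp: algebra_simps)
  next
    case False
    have "c dvd d * (x1 - x0)" unfolding par by simp
    then have "c dvd x1 - x0" using cop coprime_commute coprime_dvd_mult_right_iff by blast
    then obtain s where s: "x1 - x0 = c * s" by (elim dvdE)
    then have "c * (d * s) = c * (y1 - y0)" using par by (simp add: algebra_simps)
    then have "y1 - y0 = d * s" using False by simp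
    then show ?thesis using that[of s] s by (simp add: algebra_simps)
  qed
  have shift: "0 \<le> t \<and> t \<le> of_int L \<longleftrightarrow> 0 \<le> of_int s + t \<and> of_int s + t \<le> of_int k" for t :: real
    using L[of t] k(3)[rule_format, of "of_int s + t"] unfolding s by (simp add: algebra_simps)
  have "0 \<le> s" using shift[of 0] assms(4) by simp
  moreover have "s \<le> 0" using shift[of "- of_int s"] k(1) by simp
  ultimately have "s = 0" by simp
  then have "L = k" using shift[of "of_int L"] shift[of "of_int k"] assms(4) k(1) by simp
  then show ?thesis using k(4) by simp
qed

lemma vertical_facet_dvd:
  assumes f: "d = 1 \<or> d = -1" "K < h" and b: "\<And>x y. R x y \<Longrightarrow> - of_int h \<le> of_int d * x"
    and y: "y1 < y2" "R (of_int (- d * h)) (of_int y1)" "R (of_int (- d * h)) (of_int y2)"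
      "\<And>y. R (of_int (- d * h)) y \<Longrightarrow> of_int y1 \<le> y \<and> y \<le> of_int y2"
  shows "h dvd y2 - y1"
proof -
  have seg: "R (of_int (- d * h)) y \<longleftrightarrow> of_int y1 \<le> y \<and> y \<le> of_int y2" for y
  proof
    assume "of_int y1 \<le> y \<and> y \<le> of_int y2"
    then have "y \<in> closed_segment (of_int y1) (of_int y2)" by (simp add: closed_segment_eq_real_ivl)
    then obtain t where t: "0 \<le> t" "t \<le> 1" "y = (1 - t) * of_int y1 + t * of_int y2"
      by (auto simp: in_segment)
    have "(1 - t) * X + t * X = X" for X :: real by (simp add: algebra_simps)
    then show "R (of_int (- d * h)) y" using R_convex[OF y(2,3) t(1,2)] unfolding t(3) by (simp only:)
  qed (rule y(4))
  have "facet d 0 h"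
  proof (rule facetI[OF _ _ y(2,3)])
    show "coprime d 0" using f(1) by auto
    show "real_of_int d * of_int (- d * h) - of_int 0 * of_int y1 = - of_int h"
      "real_of_int d * of_int (- d * h) - of_int 0 * of_int y2 = - of_int h" using f(1) by auto
  qed (use b y(1) in auto)
  then show ?thesis
  proof (rule facet_length_dvd[where ?x1.0 = "- d * h" and ?y1.0 = "if d = 1 then y1 else y2"])
    show "d * (- d * h) - 0 * (if d = 1 then y1 else y2) = - h" using f(1) by auto
    show "0 \<le> y2 - y1" using y(1) by simp
    fix t :: real
    show "R (of_int (- d * h) + t * of_int 0) (of_int (if d = 1 then y1 else y2) + t * of_int d) \<longleftrightarrow>
      0 \<le> t \<and> t \<le> of_int (y2 - y1)"
      using f(1) seg[of "of_int (if d = 1 then y1 else y2) + t * of_int d"] by auto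
  qed (rule f(2))
qed

end

text \<open>An edge of maximal height \<open>m\<close> is the lower boundary, and \<open>(0, - m)\<close> is one of its inner
  points. Primitivity of the vertices makes \<open>a\<close> and \<open>b\<close> coprime to \<open>m\<close>; so if one of them divides
  \<open>2 * m\<close>, it divides \<open>2\<close> and is less than \<open>K\<close>.\<close>

locale polygon_on_edge = plane_polygon +
  fixes a b :: int
  assumes a: "0 < a" and b: "0 < b" and coprime_a: "coprime a m" and coprime_b: "coprime b m"
    and bottom_facet: "facet 0 (-1) m"
    and bottom: "R x (- of_int m) \<longleftrightarrow> - of_int a \<le> x \<and> x \<le> of_int b"
begin

lemma dvd_two_m: "a dvd 2 * m \<Longrightarrow> a \<le> K" "b dvd 2 * m \<Longrightarrow> b \<le> K"
proof -
  have *: "x \<le> K" if "x dvd 2 * m" "coprime x m" for x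
    using that K coprime_dvd_mult_left_iff[of x m 2] zdvd_imp_le[of x 2] by (auto simp: mult.commute)
  show "a dvd 2 * m \<Longrightarrow> a \<le> K" "b dvd 2 * m \<Longrightarrow> b \<le> K" using * coprime_a coprime_b by blast+
qed

lemma bottom_ends: "R (- of_int a) (- of_int m)" "R (of_int b) (- of_int m)"
  using a b by (simp_all add: bottom)

lemma above_bottom: "R x y \<Longrightarrow> - of_int m \<le> y"
  using facet_ge[OF bottom_facet, of x y] by simp

lemma high_point: obtains p q where "R p q" "of_int m \<le> q"
  using facet_opposite[OF bottom_facet] m K by auto

lemma facet_corners:
  assumes "facet d c h" shows "d * a \<le> c * m + h" "- (d * b) \<le> c * m + h"
  using facet_ge_int[OF assms, of "- a" "- m"] facet_ge_int[OF assms, of b "- m"] bottom_ends by auto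

text \<open>A second edge that faces down would be higher than \<open>m\<close>: its inequality has to hold at both ends of
  the bottom edge, one on each side of the vertical line through the origin.\<close>

lemma facet_upward:
  assumes f: "facet d c h" and ne: "d \<noteq> 0 \<or> c \<noteq> -1" shows "0 \<le> c"
proof (rule ccontr)
  assume "\<not> 0 \<le> c"
  then have "(c + 1) * m \<le> 0" using m K by (simp add: mult_le_0_iff)
  then have "d * a \<le> 0" "- (d * b) \<le> 0"
    using facet_corners[OF f] height_le[OF f] by (simp_all add: distrib_right)
  then have "d = 0" using a b by (simp add: mult_le_0_iff zero_le_mult_iff)
  then have "c = -1" using facet_coprime[OF f] \<open>\<not> 0 \<le> c\<close> by (simp add: zdvd1_eq)
  then show False using ne \<open>d = 0\<close> by simp
qed

text \<open>At each end of the bottom edge another edge begins, and it cannot lean outwards.\<close>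

lemma strip:
  assumes "R x y" shows "- of_int a \<le> x" "x \<le> of_int b"
proof -
  have y: "0 \<le> y + of_int m" using above_bottom[OF assms] by simp
  have "\<exists>d c h. facet d c h \<and> real_of_int d * (- of_int a) - of_int c * (- of_int m) = - of_int h
      \<and> of_int d * (-1) - of_int c * 0 < (0::real)"
    using bottom_ends(1) by (rule tight) (simp add: bottom)
  then obtain d c h where f: "facet d c h" "d > 0" "real_of_int c * of_int m - real_of_int d * of_int a = - of_int h"
    by auto
  have "0 \<le> real_of_int c * (y + of_int m)" using facet_upward[OF f(1)] f(2) y by simp
  also have "\<dots> \<le> of_int d * (x + of_int a)" using facet_ge[OF f(1) assms] f(3) by (simp add: algebra_simps)
  finally show "- of_int a \<le> x" using f(2) by (simp add: zero_le_mult_iff)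
  have "\<exists>d c h. facet d c h \<and> real_of_int d * of_int b - of_int c * (- of_int m) = - of_int h
      \<and> of_int d * 1 - of_int c * 0 < (0::real)"
    using bottom_ends(2) by (rule tight) (simp add: bottom)
  then obtain d c h where f: "facet d c h" "d < 0" "real_of_int c * of_int m + real_of_int d * of_int b = - of_int h"
    by auto
  have "0 \<le> real_of_int c * (y + of_int m)" using facet_upward[OF f(1)] f(2) y by simp
  also have "\<dots> \<le> of_int d * (x - of_int b)" using facet_ge[OF f(1) assms] f(3) by (simp add: algebra_simps)
  finally show "x \<le> of_int b" using f(2) by (simp add: zero_le_mult_iff)
qed

lemma side_facets_dvd:
  assumes "- m < y2"
  shows "\<lbrakk>K < a; \<And>y. R (- of_int a) y \<Longrightarrow> y \<le> of_int y2; R (- of_int a) (of_int y2)\<rbrakk> \<Longrightarrow> a dvd y2 + m"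
    "\<lbrakk>K < b; \<And>y. R (of_int b) y \<Longrightarrow> y \<le> of_int y2; R (of_int b) (of_int y2)\<rbrakk> \<Longrightarrow> b dvd y2 + m"
  using vertical_facet_dvd[of 1 a "- m" y2] vertical_facet_dvd[of "-1" b "- m" y2]
    assms strip above_bottom bottom_ends by auto

text \<open>With two multiples of \<open>m\<close> on the edge, two strips meet in a triangle of height \<open>2 * m\<close>.\<close>

lemma not_two_strips:
  assumes n: "a + b = n * m" "2 \<le> n"
    and strip': "\<And>x y. R x y \<Longrightarrow> x + of_int (n - 1) * y \<le> of_int (m - a)"
  shows False
proof -
  obtain p q where pq: "R p q" "of_int m \<le> q" using high_point .
  have m0: "0 < real_of_int m" using m K by simp
  have "of_int (n - 1) * q \<le> of_int m" using strip'[OF pq(1)] strip(1)[OF pq(1)] by simp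
  moreover have "of_int (n - 1) * real_of_int m \<le> of_int (n - 1) * q"
    using pq(2) n(2) by (intro mult_left_mono) auto
  ultimately have "real_of_int ((n - 1) * m) \<le> of_int (1 * m)" by simp
  then have "(n - 1) * m \<le> 1 * m" by (simp only: of_int_le_iff)
  then have "n = 2" using m K n(2) by (simp add: mult_le_cancel_right)
  then have le: "x + y \<le> of_int (m - a)" if "R x y" for x y using strip'[OF that] by simp
  have q: "q = of_int m" "p = - of_int a" using le[OF pq(1)] strip(1)[OF pq(1)] pq(2) by auto
  have corner: "R (- of_int a) (of_int m)" using pq(1) q by simp
  have b2: "b = 2 * m - a" using n(1) \<open>n = 2\<close> by simp
  have a_le: "a \<le> K"
  proof (rule ccontr)
    assume "\<not> a \<le> K"
    then have "a dvd m + m"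
      using corner le m0 by (intro side_facets_dvd(1)) force+
    then show False using dvd_two_m(1) \<open>\<not> a \<le> K\<close> by simp
  qed
  have "m - a \<le> K"
  proof (rule ccontr)
    assume big: "\<not> m - a \<le> K"
    have ma: "facet (-1) 1 (m - a)"
      by (rule facetI[OF _ _ bottom_ends(2) corner]) (use le b2 m0 in force)+
    have "m - a dvd 2 * m"
    proof (rule facet_length_dvd[OF ma, where ?x1.0 = "- a" and ?y1.0 = m])
      fix t :: real
      show "R (of_int (- a) + t * of_int 1) (of_int m + t * of_int (- 1)) \<longleftrightarrow> 0 \<le> t \<and> t \<le> of_int (2 * m)"
      proof
        assume t: "0 \<le> t \<and> t \<le> of_int (2 * m)"
        define s where "s = t / (2 * of_int m)"
        have s: "0 \<le> s" "s \<le> 1" "2 * (s * of_int m) = t" using t m0 by (auto simp: s_def)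
        show "R (of_int (- a) + t * of_int 1) (of_int m + t * of_int (- 1))"
          using R_convex[OF corner bottom_ends(2) s(1,2)] s(3) b2 by (simp add: algebra_simps)
      qed (use strip(1) above_bottom in force)
    qed (use big m K in auto)
    moreover have "coprime (m - a) m"
    proof (rule coprimeI)
      fix x assume "x dvd m - a" "x dvd m"
      then have "x dvd m - (m - a)" using dvd_diff by blast
      then show "is_unit x" using coprime_common_divisor[OF coprime_a] \<open>x dvd m\<close> by simp
    qed
    ultimately have "m - a dvd 2" using coprime_dvd_mult_left_iff by blast
    then show False using big K zdvd_imp_le[of "m - a" 2] by auto
  qed
  then show False using a_le m K by linarith
qed

end

locale narrow_polygon = polygon_on_edge +
  assumes width: "a + b = m"
begin

lemma upper_facet_segment:
  assumes f: "facet d c h" "1 \<le> c"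
  shows "\<exists>x0 y0 k. 1 \<le> k \<and> d * x0 - c * y0 = - h \<and> - a \<le> x0 \<and> x0 + k * c \<le> b \<and> k * c \<le> m \<and>
    (edge_points d c x0 y0 k) \<and>
    (K < h \<longrightarrow> h dvd k \<and> h \<le> k)"
proof -
  obtain x0 y0 k where k: "1 \<le> k" "d * x0 - c * y0 = - h"
    "edge_points d c x0 y0 k" "K < h \<longrightarrow> h dvd k"
    using facet_segment[OF f(1)] by blast
  have "- real_of_int a \<le> of_int x0" using strip(1) k(1) k(3)[rule_format, of 0] by simp
  then have 1: "- a \<le> x0" by linarith
  have "of_int x0 + of_int k * of_int c \<le> real_of_int b" using strip(2) k(1) k(3)[rule_format, of "of_int k"] by simp
  then have "real_of_int (x0 + k * c) \<le> of_int b" by simp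
  then have 2: "x0 + k * c \<le> b" by (simp only: of_int_le_iff)
  have "k * c \<le> m" using 1 2 width by linarith
  moreover have "K < h \<longrightarrow> h dvd k \<and> h \<le> k" using k(1,4) zdvd_imp_le by simp
  ultimately show ?thesis using k(1-3) 1 2 by blast
qed

text \<open>Otherwise the polygon contains a point \<open>(0, t)\<close> with \<open>t \<ge> m\<close>. An edge above it has maximal height \<open>m\<close>,
  is horizontal because of the high points on both sides, and being at least as wide as it is high
  it fills the strip. Then the polygon is a rectangle whose vertical sides have length \<open>2 * m\<close>, so their
  heights \<open>a\<close> and \<open>b\<close> are at most \<open>K\<close>.\<close>

lemma high_points_one_sided:
  assumes "R p1 q1" "of_int m \<le> q1" "p1 < 0" "R p2 q2" "of_int m \<le> q2" "0 < p2"
  shows False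
proof -
  define s where "s = - p1 / (p2 - p1)"
  have s: "0 \<le> s" "s \<le> 1" "s * (p2 - p1) = - p1"
    using assms by (simp_all add: s_def divide_le_0_iff pos_le_divide_eq)
  define t where "t = (1 - s) * q1 + s * q2"
  have "(1 - s) * p1 + s * p2 = 0" using s(3) by (simp add: algebra_simps)
  then have R0: "R 0 t" using R_convex[OF assms(1,4) s(1,2)] by (simp add: t_def)
  have "(1 - s) * of_int m + s * of_int m \<le> t" unfolding t_def
    using s assms by (intro add_mono mult_left_mono) auto
  then have t: "of_int m \<le> t" by (simp add: algebra_simps)
  have m0: "0 < real_of_int m" using m K by simp
  obtain d c h where f: "facet d c h" "real_of_int d * 0 - of_int c * 1 < 0"
    using facet_direction[of 0 1] by auto
  then have c: "1 \<le> c" by simp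
  have "of_int c * t \<le> of_int h" using facet_ge[OF f(1) R0] by simp
  moreover have "of_int c * real_of_int m \<le> of_int c * t" using t c by (intro mult_left_mono) auto
  ultimately have ct: "of_int c * real_of_int m \<le> of_int h" by linarith
  then have "real_of_int (c * m) \<le> of_int h" by simp
  then have cm: "c * m \<le> h" by (simp only: of_int_le_iff)
  then have "c * m \<le> 1 * m" using height_le[OF f(1)] by simp
  then have c1: "c = 1" using c m K by (simp add: mult_le_cancel_right)
  then have hm: "h = m" using cm height_le[OF f(1)] by simp
  have "0 \<le> of_int d * p1" "0 \<le> of_int d * p2"
    using facet_ge[OF f(1) assms(1)] facet_ge[OF f(1) assms(4)] assms c1 hm by simp_all
  then have d0: "d = 0" using assms by (auto simp: zero_le_mult_iff)
  obtain x0 y0 k where k: "1 \<le> k" "d * x0 - c * y0 = - h" "- a \<le> x0" "x0 + k * c \<le> b" "k * c \<le> m"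
    "edge_points d c x0 y0 k"
    "K < h \<longrightarrow> h dvd k \<and> h \<le> k" using upper_facet_segment[OF f(1) c] by blast
  have "k = m" "x0 = - a" "y0 = m" using k(2-5,7) m K width hm c1 d0 by auto
  moreover from this have "real_of_int x0 + of_int k = of_int b" using width by linarith
  ultimately have corners: "R (- of_int a) (of_int m)" "R (of_int b) (of_int m)"
    using k(6)[rule_format, of 0] k(6)[rule_format, of "of_int k"] k(1) c1 d0 by simp_all
  have y: "y \<le> of_int m" if "R x y" for x y using facet_ge[OF f(1) that] c1 d0 hm by simp
  have "a \<le> K"
  proof (rule ccontr)
    assume "\<not> a \<le> K"
    then have "a dvd m + m" using corners m K y by (intro side_facets_dvd(1)) auto
    then show False using dvd_two_m(1) \<open>\<not> a \<le> K\<close> by simp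
  qed
  moreover have "b \<le> K"
  proof (rule ccontr)
    assume "\<not> b \<le> K"
    then have "b dvd m + m" using corners m K y by (intro side_facets_dvd(2)) auto
    then show False using dvd_two_m(2) \<open>\<not> b \<le> K\<close> by simp
  qed
  ultimately show False using width m K by linarith
qed

end

text \<open>By reflection, all points of height at least \<open>m\<close> may be assumed to lie on the right.\<close>

locale right_leaning_polygon = narrow_polygon +
  assumes high: "R x y \<Longrightarrow> of_int m \<le> y \<Longrightarrow> 0 \<le> x"
begin

abbreviation upper_edge :: "int \<Rightarrow> int \<Rightarrow> int \<Rightarrow> int \<Rightarrow> bool" where
  "upper_edge d x0 y0 k \<equiv>
    \<forall>t. R (of_int x0 + t) (of_int y0 + t * of_int d) \<longleftrightarrow> 0 \<le> t \<and> t \<le> of_int k"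

text \<open>A descending or horizontal upper edge has height \<open>m\<close>, so it is as wide as the strip and starts at
  a point on the far left that is still of height at least \<open>m\<close>.\<close>

lemma upper_facet_ascends:
  assumes f: "facet d c h" "1 \<le> c" shows "1 \<le> d"
proof (rule ccontr)
  assume "\<not> 1 \<le> d"
  then have d: "d \<le> 0" by simp
  obtain p q where pq: "R p q" "of_int m \<le> q" using high_point .
  have "of_int d * p \<le> 0" using d high[OF pq] by (simp add: mult_le_0_iff)
  then have "of_int c * q \<le> of_int h" using facet_ge[OF f(1) pq(1)] by linarith
  moreover have "of_int c * real_of_int m \<le> of_int c * q" using pq(2) f(2) by (intro mult_left_mono) auto
  ultimately have "real_of_int (c * m) \<le> of_int h" by simp
  then have cm: "c * m \<le> h" by (simp only: of_int_le_iff)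
  then have "c * m \<le> 1 * m" using height_le[OF f(1)] by simp
  then have c1: "c = 1" using f(2) m K by (simp add: mult_le_cancel_right)
  then have hm: "h = m" using cm height_le[OF f(1)] by simp
  obtain x0 y0 k where k: "1 \<le> k" "d * x0 - c * y0 = - h" "- a \<le> x0" "x0 + k * c \<le> b" "k * c \<le> m"
    "edge_points d c x0 y0 k"
    "K < h \<longrightarrow> h dvd k \<and> h \<le> k" using upper_facet_segment[OF f] by blast
  have x0: "x0 = - a" using k(3-5,7) m K width hm c1 by auto
  then have "y0 = m - d * a" using k(2) c1 hm by simp
  then have "m \<le> y0" using d a by (simp add: mult_le_0_iff)
  moreover have "R (of_int x0) (of_int y0)" using k(6)[rule_format, of 0] k(1) by simp
  ultimately have "0 \<le> real_of_int x0" by (intro high) auto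
  then show False using x0 a by simp
qed

text \<open>As upper edges ascend, only a vertical edge can bound the polygon on the right.\<close>

lemma right_facet:
  "\<exists>y1. - m < y1 \<and> (\<forall>y. R (of_int b) y \<longleftrightarrow> - of_int m \<le> y \<and> y \<le> of_int y1) \<and>
    (K < b \<longrightarrow> (\<exists>x y. R x y \<and> x \<le> - of_int b))"
proof -
  obtain d c h where f: "facet d c h" "real_of_int d * 1 - of_int c * 0 < 0"
    using facet_direction[of 1 0] by auto
  then have d: "d < 0" by simp
  then have "0 \<le> c" using facet_upward[OF f(1)] by simp
  moreover have "\<not> 1 \<le> c" using upper_facet_ascends[OF f(1)] d by auto
  ultimately have c: "c = 0" by simp
  then have d1: "d = -1" using facet_coprime[OF f(1)] d by (simp add: zdvd1_eq)
  have f1: "facet (-1) 0 h" using f(1) c d1 by simp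
  obtain x0 y0 k where k: "1 \<le> k" "- 1 * x0 - 0 * y0 = - h"
    "\<forall>t. R (of_int x0 + t * of_int 0) (of_int y0 + t * of_int (- 1)) \<longleftrightarrow> 0 \<le> t \<and> t \<le> of_int k"
    using facet_segment[OF f1] by blast
  have "R (of_int x0) (of_int y0)" using k(1) k(3)[rule_format, of 0] by simp
  then have "x0 \<le> b" using strip(2)[of "of_int x0" "of_int y0"] by simp
  moreover have "b \<le> h" using facet_ge[OF f1 bottom_ends(2)] by simp
  ultimately have h: "x0 = b" "h = b" using k(2) by auto
  have seg: "R (of_int b) y \<longleftrightarrow> of_int (y0 - k) \<le> y \<and> y \<le> of_int y0" for y
    using k(3)[rule_format, of "of_int y0 - y"] h by auto
  have "- real_of_int m = of_int (y0 - k)"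
  proof (rule antisym)
    show "of_int (y0 - k) \<le> - real_of_int m" using seg[of "- of_int m"] bottom_ends(2) by simp
    have "R (of_int b) (of_int (y0 - k))" using seg k(1) by simp
    then show "- real_of_int m \<le> of_int (y0 - k)" by (rule above_bottom)
  qed
  then have "- m = y0 - k" by linarith
  show ?thesis
  proof (intro exI[of _ y0] conjI allI impI)
    show "- m < y0" using \<open>- m = y0 - k\<close> k(1) by simp
    show "R (of_int b) y \<longleftrightarrow> - of_int m \<le> y \<and> y \<le> of_int y0" for y
      using seg \<open>- real_of_int m = of_int (y0 - k)\<close> by simp
    show "\<exists>x y. R x y \<and> x \<le> - of_int b" if "K < b"
      using facet_opposite[OF f1] that h(2) by fastforce
  qed
qed

text \<open>The upper end of the right-hand edge is the highest point of the polygon, since an ascending edge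
  ends there. So the inequality of each upper edge can be evaluated at a point of height at least \<open>m\<close>.\<close>

lemma upper_facet_at_right_end:
  assumes right: "\<And>y. R (of_int b) y \<longleftrightarrow> - of_int m \<le> y \<and> y \<le> of_int y1" and y1: "- m < y1"
  obtains d c h where "facet d c h" "1 \<le> c" "d * b - c * y1 = - h"
    "\<And>d c h. facet d c h \<Longrightarrow> 1 \<le> c \<Longrightarrow> c * m \<le> h + d * b"
proof -
  have Rb: "R (of_int b) (of_int y1)" using right y1 by simp
  have "\<exists>d c h. facet d c h \<and> real_of_int d * of_int b - of_int c * of_int y1 = - of_int h
      \<and> of_int d * 0 - of_int c * 1 < (0::real)"
    using Rb by (rule tight) (use right in auto)
  then obtain d c h where f: "facet d c h" "real_of_int (d * b - c * y1) = of_int (- h)" "1 \<le> c" by auto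
  then have eq: "d * b - c * y1 = - h" by (simp only: of_int_eq_iff)
  obtain p q where pq: "R p q" "of_int m \<le> q" using high_point .
  have d: "1 \<le> d" by (rule upper_facet_ascends[OF f(1,3)])
  have "of_int d * (p - of_int b) \<le> 0" using d strip(2)[OF pq(1)] by (simp add: mult_le_0_iff)
  then have "of_int c * (q - of_int y1) \<le> 0" using facet_ge[OF f(1) pq(1)] f(2) by (simp add: algebra_simps)
  then have "q \<le> of_int y1" using f(3) by (simp add: mult_le_0_iff)
  then have my: "m \<le> y1" using pq(2) by linarith
  have "c' * m \<le> h' + d' * b" if f': "facet d' c' h'" "1 \<le> c'" for d' c' h'
  proof -
    have "c' * m \<le> c' * y1" using f'(2) my by simp
    also have "\<dots> \<le> h' + d' * b" using facet_ge_int[OF f'(1) Rb] by simp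
    finally show ?thesis .
  qed
  then show thesis using that[OF f(1,3) eq] by blast
qed

text \<open>Leaving an upper edge at its left end in the direction of the edge violates the inequality of a
  steeper edge. A vertical edge cannot be the cause before the left end of the strip is reached.\<close>

lemma next_upper_facet:
  assumes f: "facet d 1 h" "d * x0 - y0 = - h" "- a < x0" and k: "0 \<le> k"
    and seg: "upper_edge d x0 y0 k"
  obtains d' c' h' where "facet d' c' h'" "1 \<le> c'" "c' * d < d'" "d' * x0 - c' * y0 = - h'"
proof -
  have R0: "R (of_int x0) (of_int y0)" using seg[rule_format, of 0] k by simp
  have "\<exists>d' c' h'. facet d' c' h' \<and> real_of_int d' * of_int x0 - of_int c' * of_int y0 = - of_int h'
      \<and> of_int d' * (-1) - of_int c' * (- of_int d) < (0::real)"
    using R0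
  proof (rule tight)
    fix t :: real assume "t > 0"
    then show "\<not> R (of_int x0 + t * (-1)) (of_int y0 + t * (- of_int d))" using seg[rule_format, of "- t"] by simp
  qed
  then obtain d' c' h' where f': "facet d' c' h'" "real_of_int (d' * x0 - c' * y0) = of_int (- h')"
    "real_of_int (c' * d) < of_int d'" by auto
  then have eq: "d' * x0 - c' * y0 = - h'" and lt: "c' * d < d'" by (simp_all only: of_int_eq_iff of_int_less_iff)
  have "1 \<le> c'"
  proof (rule ccontr)
    assume c': "\<not> 1 \<le> c'"
    show False
    proof (cases "d' = 0 \<and> c' = -1")
      case True
      have "- h \<le> d * (- a) + m" using facet_ge_int[OF f(1), of "- a" "- m"] bottom_ends by simp
      moreover have "y0 \<le> - m" using eq True facet_corners(1)[OF f'(1)] by simp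
      moreover have "- m \<le> y0" using above_bottom[OF R0] by linarith
      moreover have "1 \<le> d" using lt True by simp
      ultimately have "d * (x0 + a) \<le> 0" "1 \<le> d" using f(2) by (auto simp: algebra_simps)
      then show False using f(3) by (simp add: mult_le_0_iff)
    next
      case False
      then have "0 \<le> c'" using facet_upward[OF f'(1)] by blast
      then have "c' = 0" using c' by simp
      then have "d' = 1" using facet_coprime[OF f'(1)] lt by (simp add: zdvd1_eq)
      then have "- x0 = h'" "a \<le> h'" using eq \<open>c' = 0\<close> facet_corners(1)[OF f'(1)] by simp_all
      then show False using f(3) by simp
    qed
  qed
  then show thesis using that f'(1) lt eq by blast
qed

lemma upper_facet_seg1:
  assumes f: "facet d 1 h"
  shows "\<exists>x0 y0 k. 1 \<le> k \<and> d * x0 - y0 = - h \<and> - a \<le> x0 \<and> x0 + k \<le> b \<and>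
    (upper_edge d x0 y0 k) \<and>
    (K < h \<longrightarrow> h dvd k) \<and> (K < h \<longrightarrow> m < 2 * h \<longrightarrow> k = h)"
proof -
  obtain x0 y0 k where k: "1 \<le> k" "d * x0 - 1 * y0 = - h" "- a \<le> x0" "x0 + k * 1 \<le> b" "k * 1 \<le> m"
    "\<forall>t. R (of_int x0 + t * of_int 1) (of_int y0 + t * of_int d) \<longleftrightarrow> 0 \<le> t \<and> t \<le> of_int k"
    "K < h \<longrightarrow> h dvd k \<and> h \<le> k" using upper_facet_segment[OF f order_refl] by blast
  have "k = h" if h: "K < h" "m < 2 * h"
  proof -
    obtain j where j: "k = h * j" using k(7) h(1) by (blast elim: dvdE)
    have "h * j < h * 2" using k(5) h(2) j by simp
    then have "j < 2" using h(1) K by (simp add: mult_less_cancel_left)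
    moreover have "0 < j" using j k(1) h(1) K zero_less_mult_pos[of h j] by simp
    ultimately show ?thesis using j by simp
  qed
  then show ?thesis using k by (intro exI[of _ x0] exI[of _ y0] exI[of _ k]) simp
qed

text \<open>Consecutive edges share a vertex, so their widths add up along the strip.\<close>

lemma next_upper_facet_ends:
  assumes f: "facet d 1 h" "d * x0 - y0 = - h" and f': "facet d' 1 h'" "d < d'" "d' * x0 - y0 = - h'"
    and R0: "R (of_int x0) (of_int y0)"
    and k': "d' * x0' - y0' = - h'" "0 \<le> k'"
      "upper_edge d' x0' y0' k'"
  shows "x0' + k' = x0"
proof (rule antisym)
  have "R (of_int (x0' + k')) (of_int (y0' + k' * d'))" using k'(3)[rule_format, of "of_int k'"] k'(2) by simp
  then have "- h \<le> d * (x0' + k') - 1 * (y0' + k' * d')" by (rule facet_ge_int[OF f(1)])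
  then have "(d' - d) * (x0' + k' - x0) \<le> 0" using f(2) f'(3) k'(1) by (simp add: algebra_simps)
  then show "x0' + k' \<le> x0" using f'(2) by (simp add: mult_le_0_iff)
  have "y0 = y0' + (x0 - x0') * d'" using f'(3) k'(1) by (simp add: algebra_simps)
  then have "R (of_int x0' + of_int (x0 - x0')) (of_int y0' + of_int (x0 - x0') * of_int d')"
    using R0 by simp
  then show "x0 \<le> x0' + k'" unfolding k'(3)[rule_format] by simp
qed

lemma first_upper_facet_right_end:
  assumes right: "\<And>y. R (of_int b) y \<longleftrightarrow> - of_int m \<le> y \<and> y \<le> of_int y1" and y1: "- m < y1"
    and f: "d * b - y1 = - h" and k: "d * x0 - y0 = - h" "x0 + k \<le> b"
      "upper_edge d x0 y0 k"
  shows "x0 + k = b"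
proof (rule antisym[OF k(2)])
  have "y1 = y0 + (b - x0) * d" using f k(1) by (simp add: algebra_simps)
  moreover have "R (of_int b) (of_int y1)" using right y1 by simp
  ultimately have "R (of_int x0 + of_int (b - x0)) (of_int y0 + of_int (b - x0) * of_int d)" by simp
  then show "b \<le> x0 + k" unfolding k(3)[rule_format] by simp
qed

text \<open>The upper boundary is explored from right to left: its first edge ends at the top of the right-hand
  edge, and unless it spans the strip, it is followed by a steeper one.\<close>

lemma first_upper_edge:
  assumes flat: "\<forall>d c h. facet d c h \<longrightarrow> 1 \<le> c \<longrightarrow> c = 1"
    and right: "\<And>y. R (of_int b) y \<longleftrightarrow> - of_int m \<le> y \<and> y \<le> of_int y1" and y1: "- m < y1"
    and f: "facet d 1 h" "d * b - y1 = - h"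
  shows "\<exists>x0 y0 k. 1 \<le> k \<and> d * x0 - y0 = - h \<and> - a \<le> x0 \<and> x0 + k = b \<and> R (of_int x0) (of_int y0) \<and>
    (K < h \<longrightarrow> h dvd k) \<and> (K < h \<longrightarrow> m < 2 * h \<longrightarrow> k = h) \<and>
    (x0 \<noteq> - a \<longrightarrow> (\<exists>d' h' x0' y0' k'. facet d' 1 h' \<and> d < d' \<and> d' * x0 - y0 = - h' \<and> 1 \<le> k' \<and>
      d' * x0' - y0' = - h' \<and> - a \<le> x0' \<and> x0' + k' = x0 \<and> upper_edge d' x0' y0' k' \<and>
      (K < h' \<longrightarrow> m < 2 * h' \<longrightarrow> k' = h')))"
proof -
  obtain x0 y0 k where k: "1 \<le> k" "d * x0 - y0 = - h" "- a \<le> x0" "x0 + k \<le> b" "upper_edge d x0 y0 k"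
    "K < h \<longrightarrow> h dvd k" "K < h \<longrightarrow> m < 2 * h \<longrightarrow> k = h" using upper_facet_seg1[OF f(1)] by blast
  have R0: "R (of_int x0) (of_int y0)" using k(5)[rule_format, of 0] k(1) by simp
  have "\<exists>d' h' x0' y0' k'. facet d' 1 h' \<and> d < d' \<and> d' * x0 - y0 = - h' \<and> 1 \<le> k' \<and>
      d' * x0' - y0' = - h' \<and> - a \<le> x0' \<and> x0' + k' = x0 \<and> upper_edge d' x0' y0' k' \<and>
      (K < h' \<longrightarrow> m < 2 * h' \<longrightarrow> k' = h')" if "x0 \<noteq> - a"
  proof -
    have x0: "- a < x0" using k(3) that by simp
    obtain d' c' h' where f': "facet d' c' h'" "1 \<le> c'" "c' * d < d'" "d' * x0 - c' * y0 = - h'"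
      using next_upper_facet[OF f(1) k(2) x0 _ k(5)] k(1) by auto
    then have g: "facet d' 1 h'" "d < d'" "d' * x0 - y0 = - h'" using flat[rule_format, OF f'(1,2)] by auto
    obtain x0' y0' k' where k': "1 \<le> k'" "d' * x0' - y0' = - h'" "- a \<le> x0'" "upper_edge d' x0' y0' k'"
      "K < h' \<longrightarrow> m < 2 * h' \<longrightarrow> k' = h'" using upper_facet_seg1[OF g(1)] by blast
    have "x0' + k' = x0" using next_upper_facet_ends[OF f(1) k(2) g R0 k'(2) _ k'(4)] k'(1) by simp
    then show ?thesis using g k' by blast
  qed
  then show ?thesis using k R0 first_upper_facet_right_end[OF right y1 f(2) k(2,4,5)] by blast
qed

lemma left_facet_above_upper:
  assumes big: "K < a" and f: "facet d 1 h" "d * (- a) - y0 = - h" "- m < y0" "R (- of_int a) (of_int y0)"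
  shows "a dvd y0 + m"
proof (rule side_facets_dvd(1)[OF f(3) big _ f(4)])
  fix y assume "R (- of_int a) y"
  then have "- of_int h \<le> of_int d * - of_int a - of_int 1 * y" by (rule facet_ge[OF f(1)])
  moreover have "real_of_int (d * (- a) - y0) = of_int (- h)" using f(2) by simp
  ultimately show "y \<le> of_int y0" by simp
qed

text \<open>If \<open>b \<le> K\<close>, then all upper edges have slope 1 or 2 and are wider than half of the strip, so there is
  only one. It starts above the left end of the bottom edge, so there is a vertical edge on the left.
  Its height \<open>a\<close> exceeds \<open>K\<close>, but the polygon reaches only as far as \<open>b < a\<close> on the opposite side.\<close>

lemma no_low_right_facet: "K < b"
proof (rule ccontr)
  assume "\<not> K < b"
  then have b6: "6 * b < m" and a_eq: "a = m - b" and bK: "b \<le> K" using m width by auto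
  then have aK: "K < a" using m K by simp
  have no_left: False if y0: "- m < y0" "R (of_int (- a)) (of_int y0)" for y0
  proof -
    have "facet 1 0 a"
    proof (rule facetI[OF _ _ bottom_ends(1) y0(2)])
      show "- real_of_int a \<le> of_int 1 * x - of_int 0 * y" if "R x y" for x y using strip(1)[OF that] by simp
    qed (use y0(1) in auto)
    then obtain x y where "R x y" "real_of_int a \<le> of_int 1 * x - of_int 0 * y" using facet_opposite aK by blast
    then have "a \<le> b" using strip(2)[of x y] by simp
    then show False using aK bK by simp
  qed
  obtain y1 where y1: "- m < y1" and "\<forall>y. R (of_int b) y \<longleftrightarrow> - of_int m \<le> y \<and> y \<le> of_int y1"
    using right_facet by blast
  then have y1: "- m < y1" "\<And>y. R (of_int b) y \<longleftrightarrow> - of_int m \<le> y \<and> y \<le> of_int y1" by blast+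
  obtain d c h where U: "facet d c h" "1 \<le> c" "d * b - c * y1 = - h"
    and cm: "\<And>d c h. facet d c h \<Longrightarrow> 1 \<le> c \<Longrightarrow> c * m \<le> h + d * b"
    using upper_facet_at_right_end[OF y1(2,1)] by blast
  have upper: "c = 1 \<and> d \<in> {1, 2} \<and> K < h \<and> m < 2 * h" if f: "facet d c h" "1 \<le> c" for d c h
  proof -
    have d1: "1 \<le> d" by (rule upper_facet_ascends[OF f])
    have hm: "h \<le> m" by (rule height_le[OF f(1)])
    have "d * (m - b) \<le> c * m + h" using facet_corners(1)[OF f(1)] a_eq by simp
    then have le: "d * (m - 2 * b) \<le> 2 * m" using cm[OF f] hm by (simp add: algebra_simps)
    have d2: "d \<le> 2"
    proof (rule ccontr)
      assume "\<not> d \<le> 2"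
      then have "3 * (m - 2 * b) \<le> d * (m - 2 * b)" using b6 b by (intro mult_right_mono) auto
      then show False using le b6 by simp
    qed
    have db: "d * b \<le> 2 * K" using d2 d1 bK b by (intro mult_mono) auto
    then have "c * m < 2 * m" using cm[OF f] hm m K by linarith
    then have "c < 2" using m K by (simp add: mult_less_cancel_right)
    then have "c = 1" using f(2) by simp
    moreover from this have "m - 2 * K \<le> h" using cm[OF f] db by simp
    ultimately show ?thesis using d1 d2 m K by auto
  qed
  have c: "c = 1" and d: "d \<in> {1, 2}" and h: "K < h" "m < 2 * h" using upper[OF U(1,2)] by auto
  have f: "facet d 1 h" using U(1) c by simp
  have flat: "\<forall>d c h. facet d c h \<longrightarrow> 1 \<le> c \<longrightarrow> c = 1" using upper by blast
  have eq: "d * b - y1 = - h" using U(3) c by simp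
  obtain x0 y0 k where k: "d * x0 - y0 = - h" "x0 + k = b" "R (of_int x0) (of_int y0)"
    "K < h \<longrightarrow> m < 2 * h \<longrightarrow> k = h"
    and left: "x0 \<noteq> - a \<longrightarrow> (\<exists>d' h' x0' k'. facet d' 1 h' \<and> - a \<le> x0' \<and> x0' + k' = x0 \<and>
      (K < h' \<longrightarrow> m < 2 * h' \<longrightarrow> k' = h'))"
    using first_upper_edge[OF flat y1(2,1) f eq] by blast
  have kh: "k = h" using k(4) h by simp
  show False
  proof (cases "x0 = - a")
    case True
    then have "h = m" using k(2) kh width by simp
    then have "y0 = m - d * a" using k(1) True by simp
    moreover have "d * a < 2 * m" using d a_eq b m K by auto
    ultimately show False using no_left[of y0] k(3) True by simp
  next
    case False
    then obtain d' h' x0' k' where n: "facet d' 1 h'" "- a \<le> x0'" "x0' + k' = x0"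
      "K < h' \<longrightarrow> m < 2 * h' \<longrightarrow> k' = h'" using left by blast
    then show False using upper[OF n(1)] k(2) kh h(2) width by simp
  qed
qed

text \<open>Now the right-hand edge is high, so \<open>b\<close> divides its length, and minimality gives \<open>b \<le> a\<close>. The corners
  on the left and on the right restrict the upper edges to the slopes 1, 2 and 3, and edges of slope 1
  or 3 are wider than half of the strip. So there are at most two upper edges, and if they fit into
  the strip, divisibility leads to a contradiction: a number that divides \<open>2 * n\<close> and is coprime to \<open>n\<close>
  is at most 2. The only low upper edge, of slope 2 across the whole strip, has a height \<open>h\<close> with
  \<open>m \<le> 5 * h\<close>.\<close>

lemma impossible: False
proof -
  have bK: "K < b" by (rule no_low_right_facet)
  obtain y1 where "- m < y1" "\<forall>y. R (of_int b) y \<longleftrightarrow> - of_int m \<le> y \<and> y \<le> of_int y1"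
    and opp: "\<exists>x y. R x y \<and> x \<le> - of_int b"
    using right_facet bK by blast
  then have y1: "- m < y1" "\<And>y. R (of_int b) y \<longleftrightarrow> - of_int m \<le> y \<and> y \<le> of_int y1" by blast+
  have b_dvd: "b dvd y1 + m" using bK y1 by (intro side_facets_dvd(2)) auto
  obtain x y where "R x y" "x \<le> - of_int b" using opp by blast
  then have "b \<le> a" using strip(1)[of x y] by simp
  moreover have "a \<noteq> b"
  proof
    assume "a = b"
    then have "b dvd 2 * m" using width by (intro dvdI[of _ _ 4]) simp
    then show False using dvd_two_m(2) bK by simp
  qed
  ultimately have ab: "2 * b < m" "m < 2 * a" using width by auto
  have aK: "K < a" using ab m K by simp
  have not_dvd: "\<not> a dvd 2 * m" "\<not> b dvd 2 * m" using dvd_two_m aK bK by auto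
  obtain d c h where U: "facet d c h" "1 \<le> c" "d * b - c * y1 = - h"
    and cm: "\<And>d c h. facet d c h \<Longrightarrow> 1 \<le> c \<Longrightarrow> c * m \<le> h + d * b"
    using upper_facet_at_right_end[OF y1(2,1)] by blast
  (* The two corners give \<bar>d - 2 * c\<bar> * m < 2 * h. For low edges this means d = 2 * c. High edges have
     h * c \<le> m because they fit into the strip. As c and d are coprime, c = 1 in both cases. *)
  have upper: "c = 1 \<and> 1 \<le> d \<and> d \<le> 3 \<and> (d \<noteq> 2 \<longrightarrow> K < h)" if f: "facet d c h" "1 \<le> c" for d c h
  proof -
    have d1: "1 \<le> d" by (rule upper_facet_ascends[OF f])
    have hm: "h \<le> m" by (rule height_le[OF f(1)])
    have "d * m < d * (2 * a)" using d1 ab by simp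
    then have lo: "d * m < 2 * (c * m) + 2 * h" using facet_corners(1)[OF f(1)] by (simp add: algebra_simps)
    have "d * (2 * b) < d * m" using d1 ab by simp
    then have hi: "2 * (c * m) < 2 * h + d * m" using cm[OF f] by (simp add: algebra_simps)
    have "\<bar>(d - 2 * c) * m\<bar> < 2 * h" using lo hi by (simp add: abs_less_iff algebra_simps)
    then have abs: "\<bar>d - 2 * c\<bar> * m < 2 * h" using m K by (simp add: abs_mult)
    have m0: "0 \<le> m" using m K by simp
    have step: "d = 2 * c" if "2 * h \<le> m"
    proof -
      have "\<bar>d - 2 * c\<bar> * m < 1 * m" by (rule order.strict_trans2[OF abs]) (use that in simp)
      then have "\<bar>d - 2 * c\<bar> < 1" using m0 by (rule mult_right_less_imp_less)
      then show ?thesis by simp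
    qed
    have c1: "c = 1" if "d = 2 * c" using facet_coprime[OF f(1)] f(2) that by simp
    show ?thesis
    proof (cases "h \<le> K")
      case True
      then have "d = 2 * c" using step m K by simp
      then show ?thesis using c1 by simp
    next
      case False
      obtain k where k: "k * c \<le> m" "h \<le> k" using upper_facet_segment[OF f] False by force
      have "c = 1"
      proof (rule ccontr)
        assume "c \<noteq> 1"
        then have "h * 2 \<le> k * c" using f(2) k(2) height_pos[OF f(1)] by (intro mult_mono) auto
        then have "d = 2 * c" using step k(1) by simp
        then show False using c1 \<open>c \<noteq> 1\<close> by simp
      qed
      have "\<bar>d - 2 * c\<bar> * m < 2 * m" by (rule order.strict_trans2[OF abs]) (use hm in simp)
      then have "\<bar>d - 2 * c\<bar> < 2" using m0 by (rule mult_right_less_imp_less)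
      then show ?thesis using \<open>c = 1\<close> False by auto
    qed
  qed
  have c: "c = 1" and d: "1 \<le> d" "d \<le> 3" using upper[OF U(1,2)] by auto
  have f: "facet d 1 h" using U(1) c by simp
  have hm: "h \<le> m" by (rule height_le[OF f])
  have y1_eq: "y1 = d * b + h" using U(3) c by simp
  have flat: "\<forall>d c h. facet d c h \<longrightarrow> 1 \<le> c \<longrightarrow> c = 1" using upper by blast
  have eq: "d * b - y1 = - h" using U(3) c by simp
  obtain x0 y0 k where k: "1 \<le> k" "d * x0 - y0 = - h" "- a \<le> x0" "x0 + k = b" "R (of_int x0) (of_int y0)"
    "K < h \<longrightarrow> h dvd k" "K < h \<longrightarrow> m < 2 * h \<longrightarrow> k = h"
    and nxt: "x0 \<noteq> - a \<longrightarrow> (\<exists>d' h' x0' y0' k'. facet d' 1 h' \<and> d < d' \<and> d' * x0 - y0 = - h' \<and> 1 \<le> k' \<and>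
      d' * x0' - y0' = - h' \<and> - a \<le> x0' \<and> x0' + k' = x0 \<and> upper_edge d' x0' y0' k' \<and>
      (K < h' \<longrightarrow> m < 2 * h' \<longrightarrow> k' = h'))"
    using first_upper_edge[OF flat y1(2,1) f eq] by blast
  note end_b = k(4) and R0 = k(5)
  have d_cases: "d = 1 \<or> d = 2 \<or> d = 3" using d by auto
  have corner: "d * a \<le> m + h" "m \<le> h + d * b" using facet_corners(1)[OF f] cm[OF f] by auto
  have Km: "K < h" if "m < 2 * h" for h using that m K by simp
  (* An edge of slope 1 or 3 that spans the strip has height m, and then b divides 2 * m. Otherwise
     the slope is 1, and the next edge to the left is too wide as well. *)
  have slope: "d = 2"
  proof (rule ccontr)
    assume "d \<noteq> 2"
    then have d13: "d = 1 \<or> d = 3" using d_cases by blast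
    have h2: "m < 2 * h" using d13
    proof
      assume "d = 1"
      then show ?thesis using corner(2) ab(1) by simp
    next
      assume "d = 3"
      then show ?thesis using corner(1) ab(2) by simp
    qed
    have kh: "k = h" using k(7) h2 Km by blast
    show False
    proof (cases "x0 = - a")
      case True
      then have "h = m" using end_b kh width by simp
      then have "y1 + m = 2 * m + d * b" using y1_eq by simp
      then have "b dvd 2 * m" using b_dvd by (metis dvd_add_left_iff dvd_triv_right)
      then show False using not_dvd(2) by blast
    next
      case False
      then obtain d' h' x0' k' where f': "facet d' 1 h'" and n: "d < d'" "d' * x0 - y0 = - h'" "- a \<le> x0'"
        "x0' + k' = x0" "K < h' \<longrightarrow> m < 2 * h' \<longrightarrow> k' = h'" using nxt by blast
      have "d = 1" using n(1) upper[OF f'] d13 by auto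
      then have h': "h' = d' * (h - b) + b" 
      proof -
        have x0: "x0 = b - h" using end_b kh by simp
        have y0: "y0 = b" using k(2) \<open>d = 1\<close> x0 by simp
        have "h' = y0 - d' * x0" using n(2) by simp
        then show ?thesis unfolding x0 y0 by (simp add: algebra_simps)
      qed
      have "b < h" using ab h2 by simp
      then have "2 * (h - b) \<le> d' * (h - b)" using n(1) \<open>d = 1\<close> by (intro mult_right_mono) auto
      then have "2 * h - b \<le> h'" using h' by simp
      then have "m < 2 * h'" using h2 ab corner(2) \<open>d = 1\<close> by simp
      then have "k' = h'" using n(5) Km by blast
      then show False using n(3,4) end_b kh width h2 \<open>m < 2 * h'\<close> by simp
    qed
  qed
  have h_eq: "h = y1 - 2 * b" using y1_eq slope by simp
  show False
  proof (cases "x0 = - a")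
    case True
    then have km: "k = m" using end_b width by simp
    have y0: "y0 = h - 2 * a" using k(2) slope True by simp
    have "- real_of_int m \<le> of_int y0" by (rule above_bottom[OF R0])
    then have "- m \<le> y0" by linarith
    then consider "y0 = - m" | "- m < y0" by linarith
    then show False
    proof cases
      (* The polygon is a triangle. *)
      case 1
      then have h: "h = 2 * a - m" using y0 by simp
      have "b dvd h + m"
      proof -
        have "y1 + m = (h + m) + 2 * b" using h_eq by simp
        then show ?thesis using b_dvd by (metis dvd_add_left_iff dvd_triv_right)
      qed
      then obtain n where n: "h + m = b * n" by (elim dvdE)
      have b2: "2 * b = m - h" using h width by simp
      have "2 * (h + m) = n * (2 * b)" using n by (simp add: algebra_simps)
      then have eq: "(n - 2) * m = (n + 2) * h" unfolding b2 by (simp add: algebra_simps)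
      have hpos: "0 < h" by (rule height_pos[OF f])
      have "0 < b * n" using n hpos m K by simp
      then have npos: "0 < n" using b by (simp add: zero_less_mult_iff)
      then have "0 < (n - 2) * m" unfolding eq using hpos by simp
      then have n3: "3 \<le> n" using m K by (simp add: zero_less_mult_iff)
      show False
      proof (cases "K < h")
        case True
        then have "h dvd m" using k(6) km by simp
        then have "h dvd 2 * a" using h by (metis diff_add_cancel dvd_add dvd_refl)
        moreover have "coprime h a"
          using \<open>h dvd m\<close> coprime_a by (metis coprime_commute coprime_divisors dvd_refl)
        ultimately have "h dvd 2" using coprime_dvd_mult_left_iff by blast
        then show False using True K zdvd_imp_le[of h 2] by simp
      next
        case False
        have "(n - 2) * m \<le> (5 * (n - 2)) * h" unfolding eq using n3 hpos by (intro mult_right_mono) auto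
        then have "(n - 2) * m \<le> (n - 2) * (5 * h)" by (simp add: algebra_simps)
        then have "m \<le> 5 * h" using n3 by (simp add: mult_le_cancel_left)
        then show False using False m K by simp
      qed
    next
      (* There is a vertical edge on the left, from height - m to height y0. *)
      case 2
      have "a dvd y0 + m"
        using left_facet_above_upper[OF aK f, of y0] k(2) R0 True 2 by simp
      then have "a dvd (h + m) - a * 2" using y0 by (simp add: algebra_simps)
      then have "a dvd h + m" using dvd_diffD by (metis diff_add_cancel dvd_add dvd_triv_left)
      then obtain j where j: "h + m = a * j" by (elim dvdE)
      have "a * 2 < a * j" using j 2 y0 by simp
      then have "3 \<le> j" using a by (simp add: mult_less_cancel_left)
      then have "a * 3 \<le> a * j" using a by simp
      then have h2: "m < 2 * h" using j ab by simp
      then have "h = m" using k(7) km Km by blast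
      then have "a dvd 2 * m" using j by (metis dvd_triv_left mult_2)
      then show False using not_dvd(1) by blast
    qed
  next
    case False
    then obtain d' h' x0' y0' k' where n: "facet d' 1 h'" "d < d'" "d' * x0 - y0 = - h'" "1 \<le> k'"
      "d' * x0' - y0' = - h'" "- a \<le> x0'" "x0' + k' = x0"
      "upper_edge d' x0' y0' k'"
      "K < h' \<longrightarrow> m < 2 * h' \<longrightarrow> k' = h'" using nxt by blast
    (* The next edge has slope 3 and leads to the left end of the strip; both edges are too wide. *)
    have d': "d' = 3" using n(2) upper[OF n(1)] slope by simp
    have h'2: "3 * a \<le> m + h'" using facet_corners(1)[OF n(1)] d' by simp
    then have "m < 2 * h'" using ab by simp
    then have k'h': "k' = h'" using n(9) Km by blast
    have left: "x0' = - a"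
    proof (rule ccontr)
      assume "x0' \<noteq> - a"
      then have "- a < x0'" using n(6) by simp
      then obtain d'' c'' h'' where f'': "facet d'' c'' h''" "1 \<le> c''" "c'' * d' < d''"
          "d'' * x0' - c'' * y0' = - h''"
        using next_upper_facet[OF n(1,5) _ _ n(8)] n(4) by auto
      then show False using upper[OF f''(1,2)] d' by auto
    qed
    have "h = x0 + h'" using k(2) n(3) slope d' by simp
    then have "h = 2 * h' - a" using left k'h' n(7) by simp
    then have h2: "m < 2 * h" using h'2 ab by simp
    then have "k = h" using k(7) Km by blast
    then show False using left n(7) k'h' end_b width h2 \<open>m < 2 * h'\<close> by simp
  qed
qed

end

section \<open>The heights of a minimal polygon\<close>

abbreviation conormal :: "real^2 \<Rightarrow> real^2 \<Rightarrow> int \<Rightarrow> int \<Rightarrow> real^2" where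
  "conormal e f d c \<equiv> of_int d *\<^sub>R e - of_int c *\<^sub>R f"

lemma lattice_dual_coords:
  assumes "unimodular e f" "w \<in> lattice"
  obtains d c :: int where "w = conormal e f d c"
proof -
  let ?p = "point_at e f"
  obtain d c :: int where dc: "w \<bullet> ?p 1 0 = of_int d" "w \<bullet> ?p 0 1 = of_int (- c)"
    using lattice_inner[OF assms(2)] point_at_lattice[OF assms(1)] by (metis Ints_0 Ints_1 Ints_cases minus_minus)
  have "w = conormal e f d c"
  proof (rule vector_eq_ldot[THEN iffD1], rule allI)
    fix v
    have "v = ?p (e \<bullet> v * 1 + f \<bullet> v * 0) (e \<bullet> v * 0 + f \<bullet> v * 1)" using point_at_inner[OF assms(1)] by simp
    then have v: "v = (e \<bullet> v) *\<^sub>R ?p 1 0 + (f \<bullet> v) *\<^sub>R ?p 0 1" by (simp only: point_at_linear)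
    have "w \<bullet> v = w \<bullet> ((e \<bullet> v) *\<^sub>R ?p 1 0 + (f \<bullet> v) *\<^sub>R ?p 0 1)" using v by simp
    also have "\<dots> = conormal e f d c \<bullet> v"
      using dc by (simp add: inner_add_right inner_diff_left)
    finally show "v \<bullet> w = v \<bullet> conormal e f d c" by (simp add: inner_commute)
  qed
  then show thesis using that by blast
qed

lemma primitive_iff_coprime:
  assumes "unimodular e f"
  shows "primitive (conormal e f d c) \<longleftrightarrow> coprime d c"
proof -
  let ?w = "conormal e f d c"
  have ef: "e \<in> lattice" "f \<in> lattice" using assms by (auto simp: unimodular_def)
  have w: "?w \<in> lattice" using ef by (intro lattice_diff lattice_scaleR) auto
  have wp: "?w \<bullet> point_at e f x y = of_int d * x - of_int c * y" for x y
    by (simp add: inner_diff_left inner_point_at[OF assms])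
  show ?thesis
  proof
    assume pr: "primitive ?w"
    show "coprime d c"
    proof (rule coprimeI)
      fix k assume "k dvd d" "k dvd c"
      then obtain d' c' where "d = k * d'" "c = k * c'" by (auto elim!: dvdE)
      then have "?w = of_int k *\<^sub>R (of_int d' *\<^sub>R e - of_int c' *\<^sub>R f)" by (simp add: algebra_simps)
      moreover have "of_int d' *\<^sub>R e - of_int c' *\<^sub>R f \<in> lattice" using ef by (intro lattice_diff lattice_scaleR) auto
      ultimately show "is_unit k" using pr unfolding primitive_def by simp
    qed
  next
    assume "coprime d c"
    then obtain x y where "x * d + y * c = 1" by (metis coprime_iff_gcd_eq_1 bezout_int)
    then have "real_of_int (x * d + y * c) = 1" by simp
    then have "?w \<bullet> point_at e f (of_int x) (- of_int y) = 1" unfolding wp by (simp add: mult.commute)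
    then show "primitive ?w"
      using primitive_if_dual[OF w] point_at_lattice[OF assms] by (metis Ints_minus Ints_of_int)
  qed
qed

text \<open>Otherwise the polygon would contain the whole ray spanned by \<open>v\<close>.\<close>

lemma descending_edge_line:
  assumes "fano_polygon P" "v \<noteq> 0" obtains w h where "edge_line P w h" "w \<bullet> v < 0"
proof -
  have "\<exists>w h. edge_line P w h \<and> w \<bullet> v < 0"
  proof (rule ccontr)
    assume *: "\<not> ?thesis"
    have "t *\<^sub>R v \<in> P" if t: "0 \<le> t" for t
    proof (rule fano_polygon_halfspaces[OF assms(1)])
      fix w h assume e: "edge_line P w h"
      then have "0 \<le> w \<bullet> v" "0 < h" using * edge_line_height_pos[OF assms(1)] by force+
      moreover from this have "0 \<le> t * (w \<bullet> v)" using t by simp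
      ultimately show "- real_of_int h \<le> w \<bullet> (t *\<^sub>R v)" by simp
    qed
    moreover obtain B where "\<forall>x\<in>P. norm x \<le> B" using fano_polygonD(4)[OF assms(1)] bounded_iff by blast
    ultimately have B: "t * norm v \<le> B" if "0 \<le> t" for t using that by fastforce
    have "0 \<le> B" using B[of 0] by simp
    then have "(B + 1) / norm v * norm v \<le> B" using assms(2) by (intro B) simp
    then show False using assms(2) by simp
  qed
  then show thesis using that by blast
qed

lemma in_closed_segment_scaleR:
  assumes "q \<noteq> 0" "0 < k"
  shows "p + t *\<^sub>R q \<in> closed_segment p (p + k *\<^sub>R q) \<longleftrightarrow> 0 \<le> t \<and> t \<le> (k::real)"
proof
  assume "p + t *\<^sub>R q \<in> closed_segment p (p + k *\<^sub>R q)"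
  then obtain u where u: "0 \<le> u" "u \<le> 1" "p + t *\<^sub>R q = (1 - u) *\<^sub>R p + u *\<^sub>R (p + k *\<^sub>R q)"
    unfolding in_segment by blast
  then have "t *\<^sub>R q = (u * k) *\<^sub>R q" by (simp add: algebra_simps)
  then have "t = u * k" using assms(1) by simp
  then show "0 \<le> t \<and> t \<le> k" using u assms(2) by (simp add: mult_left_le_one_le)
next
  assume t: "0 \<le> t \<and> t \<le> k"
  have "p + t *\<^sub>R q = (1 - t / k) *\<^sub>R p + (t / k) *\<^sub>R (p + k *\<^sub>R q)"
    using assms(2) by (simp add: algebra_simps)
  moreover have "0 \<le> t / k" "t / k \<le> 1" using t assms(2) by (auto simp: divide_le_eq)
  ultimately show "p + t *\<^sub>R q \<in> closed_segment p (p + k *\<^sub>R q)" unfolding in_segment by blast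
qed

abbreviation coord_region :: "(real^2) set \<Rightarrow> real^2 \<Rightarrow> real^2 \<Rightarrow> real \<Rightarrow> real \<Rightarrow> bool" where
  "coord_region P e f x y \<equiv> point_at e f x y \<in> P"

abbreviation coord_facet :: "(real^2) set \<Rightarrow> real^2 \<Rightarrow> real^2 \<Rightarrow> int \<Rightarrow> int \<Rightarrow> int \<Rightarrow> bool" where
  "coord_facet P e f d c h \<equiv> edge_line P (conormal e f d c) h"

lemma coord_facet_segment:
  assumes P: "fano_polygon P" and uni: "unimodular e f" and F: "coord_facet P e f d c h"
  obtains x0 y0 k :: int where "1 \<le> k" "d * x0 - c * y0 = - h" "coprime x0 y0"
    "coprime (x0 + k * c) (y0 + k * d)"
    "\<forall>t. coord_region P e f (of_int x0 + t * of_int c) (of_int y0 + t * of_int d) \<longleftrightarrow> 0 \<le> t \<and> t \<le> of_int k"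
    "width (edge_at P (conormal e f d c) h) = nat k"
proof -
  let ?w = "conormal e f d c" and ?pt = "point_at e f"
  let ?E = "edge_at P ?w h"
  have wp: "?w \<bullet> ?pt x y = of_int d * x - of_int c * y" for x y
    by (simp add: inner_diff_left inner_point_at[OF uni])
  obtain u and k :: int where u: "1 \<le> k" "primitive u" "primitive (u + of_int k *\<^sub>R rot ?w)"
    "?E = closed_segment u (u + of_int k *\<^sub>R rot ?w)"
    using edge_line_segment[OF P F] .
  define q where "q = ?pt (of_int c) (of_int d)"
  have w: "primitive ?w" using F by (simp add: edge_line_def)
  (* The sign depends on the orientation of the coordinates. *)
  have "q = rot ?w \<or> q = - rot ?w"
  proof -
    have "?w \<bullet> q = 0" unfolding q_def wp by simp
    then obtain s where s: "q = s *\<^sub>R rot ?w" using orthogonal_parallel_rot primitive_nonzero[OF w] by blast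
    have "coprime c d" using w primitive_iff_coprime[OF uni] by (simp add: coprime_commute)
    then obtain x y where "x * c + y * d = 1" by (metis coprime_iff_gcd_eq_1 bezout_int)
    then have "of_int x * of_int c + of_int y * of_int d = (1::real)" by (metis of_int_1 of_int_add of_int_mult)
    then have "q \<bullet> (of_int x *\<^sub>R e + of_int y *\<^sub>R f) = 1"
      by (simp add: q_def inner_add_right inner_commute[of "point_at _ _ _ _"] inner_point_at[OF uni])
    moreover have "q \<in> lattice" by (simp add: q_def point_at_lattice[OF uni])
    moreover have "of_int x *\<^sub>R e + of_int y *\<^sub>R f \<in> lattice"
      using uni by (intro lattice_add lattice_scaleR) (auto simp: unimodular_def)
    ultimately have "primitive q" by (intro primitive_if_dual)
    then show ?thesis using primitive_parallel[OF _ _ s] w by simp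
  qed
  then obtain p where p: "primitive p" "primitive (p + of_int k *\<^sub>R q)" "?E = closed_segment p (p + of_int k *\<^sub>R q)"
  proof
    assume "q = rot ?w" then show thesis using that u by simp
  next
    assume q: "q = - rot ?w"
    define u' where "u' = u + of_int k *\<^sub>R rot ?w"
    have "u' + of_int k *\<^sub>R q = u" by (simp add: u'_def q)
    moreover have "?E = closed_segment u' u" unfolding u(4) u'_def by (rule closed_segment_commute)
    ultimately show thesis using that[of u'] u(2,3) unfolding u'_def[symmetric] by simp
  qed
  obtain x0 y0 where xy: "coprime x0 y0" "e \<bullet> p = of_int x0" "f \<bullet> p = of_int y0"
    using primitive_coords[OF uni p(1)] .
  have pp: "p = ?pt (of_int x0) (of_int y0)" using point_at_inner[OF uni, of p] xy by simp
  have pq: "p + t *\<^sub>R q = ?pt (of_int x0 + t * of_int c) (of_int y0 + t * of_int d)" for t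
    unfolding pp q_def by (simp only: point_at_linear)
  have "p \<in> ?E" unfolding p(3) by simp
  then have wpE: "?w \<bullet> p = - of_int h" by blast
  then have "real_of_int (d * x0 - c * y0) = of_int (- h)" unfolding pp wp by simp
  then have eq: "d * x0 - c * y0 = - h" by (simp only: of_int_eq_iff)
  have wq: "?w \<bullet> q = 0" unfolding q_def wp by simp
  have q0: "q \<noteq> 0" using p(3) \<open>q = rot ?w \<or> q = - rot ?w\<close> primitive_nonzero[of "rot ?w"] w by auto
  have "(?pt (of_int x0 + t * of_int c) (of_int y0 + t * of_int d) \<in> P) \<longleftrightarrow> 0 \<le> t \<and> t \<le> of_int k" for t
  proof -
    have "p + t *\<^sub>R q \<in> P \<longleftrightarrow> p + t *\<^sub>R q \<in> ?E" using wpE wq by (simp add: inner_add_right)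
    also have "\<dots> \<longleftrightarrow> 0 \<le> t \<and> t \<le> of_int k"
      unfolding p(3) using q0 u(1) by (intro in_closed_segment_scaleR) auto
    finally show ?thesis unfolding pq .
  qed
  moreover have "coprime (x0 + k * c) (y0 + k * d)"
  proof -
    obtain i j where ij: "coprime i j" "e \<bullet> (p + of_int k *\<^sub>R q) = of_int i" "f \<bullet> (p + of_int k *\<^sub>R q) = of_int j"
      using primitive_coords[OF uni p(2)] .
    have "of_int i = real_of_int (x0 + k * c)" "of_int j = real_of_int (y0 + k * d)"
      using ij(2,3) unfolding pq inner_point_at[OF uni] by simp_all
    then show ?thesis using ij(1) by (simp only: of_int_eq_iff)
  qed
  moreover have "width ?E = nat k"
    unfolding u(4) using width_segment[of "rot ?w" u k] u w by (simp add: primitive_in_lattice)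
  ultimately show thesis using that u(1) eq xy(1) by blast
qed

lemma plane_polygon_coords:
  assumes min: "minimal_fano_polygon P" and idx: "max_local_index (residual_basket P) \<le> K"
    and K: "3 \<le> K" "6 * int K < m" and m: "\<And>w h. edge_line P w h \<Longrightarrow> h \<le> m"
    and uni: "unimodular e f"
  shows "plane_polygon (int K) m (coord_region P e f) (coord_facet P e f)"
proof -
  have P: "fano_polygon P" using min by (simp add: minimal_fano_polygon_def)
  let ?pt = "point_at e f"
  have wp: "conormal e f d c \<bullet> ?pt x y = of_int d * x - of_int c * y" for d c :: int and x y
    by (simp add: inner_diff_left inner_point_at[OF uni])
  have dvd: "int K < h \<Longrightarrow> 1 \<le> k \<Longrightarrow> edge_line P w h \<Longrightarrow> width (edge_at P w h) = nat k \<Longrightarrow> h dvd k"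
    for w h k using high_edge_width_dvd[OF P idx, of w h] by (simp add: nat_dvd_iff)
  show ?thesis
  proof
    show "3 \<le> int K" "6 * int K < m" using K by simp_all
    fix x y x' y' t :: real assume "?pt x y \<in> P" "?pt x' y' \<in> P" "0 \<le> t" "t \<le> 1"
    then have "(1 - t) *\<^sub>R ?pt x y + t *\<^sub>R ?pt x' y' \<in> P" using fano_polygonD(2)[OF P] by (intro convexD_alt)
    then show "?pt ((1 - t) * x + t * x') ((1 - t) * y + t * y') \<in> P" by (simp only: point_at_linear)
  next
    fix d c h and x y :: real assume "coord_facet P e f d c h" "?pt x y \<in> P"
    then show "- of_int h \<le> of_int d * x - of_int c * y" unfolding edge_line_def using wp by metis
  next
    fix x y p q :: real assume R: "?pt x y \<in> P" "\<And>t. 0 < t \<Longrightarrow> ?pt (x + t * p) (y + t * q) \<notin> P"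
    have "?pt x y + t *\<^sub>R ?pt p q \<notin> P" if "0 < t" for t using R(2)[OF that] by (simp add: point_at_linear)
    then obtain w h where w: "edge_line P w h" "w \<bullet> ?pt x y = - of_int h" "w \<bullet> ?pt p q < 0"
      using tight_edge_line[OF P R(1)] by blast
    then obtain d c where "w = conormal e f d c"
      using lattice_dual_coords[OF uni] primitive_in_lattice unfolding edge_line_def by metis
    then show "\<exists>d c h. coord_facet P e f d c h \<and> of_int d * x - of_int c * y = - of_int h \<and> of_int d * p - of_int c * q < 0"
      using w wp by metis
  next
    fix d c h :: int and x y x' y' :: real
    assume f: "coprime d c" "\<And>x y. ?pt x y \<in> P \<Longrightarrow> - of_int h \<le> of_int d * x - of_int c * y"
      "?pt x y \<in> P" "?pt x' y' \<in> P" "x \<noteq> x' \<or> y \<noteq> y'" "of_int d * x - of_int c * y = - of_int h"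
      "of_int d * x' - of_int c * y' = - of_int h"
    have "- of_int h \<le> conormal e f d c \<bullet> v" if "v \<in> P" for v
      using f(2)[of "e \<bullet> v" "f \<bullet> v"] that wp[of d c "e \<bullet> v" "f \<bullet> v"] by (simp add: point_at_inner[OF uni])
    moreover have "?pt x y \<noteq> ?pt x' y'" using f(5) inner_point_at[OF uni] by metis
    then have "\<exists>u\<in>P. \<exists>v\<in>P. u \<noteq> v \<and> conormal e f d c \<bullet> u = - of_int h
        \<and> conormal e f d c \<bullet> v = - of_int h"
      by (intro bexI[OF bexI[OF _ f(4)] f(3)]) (use f(6,7) in \<open>simp add: wp\<close>)
    ultimately show "coord_facet P e f d c h"
      unfolding edge_line_def primitive_iff_coprime[OF uni] using f(1) by blast
  next
    fix d c h assume F: "coord_facet P e f d c h"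
    show "coprime d c" using F primitive_iff_coprime[OF uni] by (simp add: edge_line_def)
    show "0 < h" by (rule edge_line_height_pos[OF P F])
    show "h \<le> m" by (rule m[OF F])
    obtain x0 y0 k :: int where s: "1 \<le> k" "d * x0 - c * y0 = - h" "coprime x0 y0"
      "coprime (x0 + k * c) (y0 + k * d)"
      "\<forall>t. coord_region P e f (of_int x0 + t * of_int c) (of_int y0 + t * of_int d) \<longleftrightarrow> 0 \<le> t \<and> t \<le> of_int k"
      "width (edge_at P (conormal e f d c) h) = nat k"
      using coord_facet_segment[OF P uni F] .
    show "\<exists>x0 y0 k. 1 \<le> k \<and> d * x0 - c * y0 = - h \<and> coprime x0 y0 \<and> coprime (x0 + k * c) (y0 + k * d) \<and>
      (\<forall>t. coord_region P e f (of_int x0 + t * of_int c) (of_int y0 + t * of_int d) \<longleftrightarrow> 0 \<le> t \<and> t \<le> of_int k) \<and>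
      (int K < h \<longrightarrow> h dvd k)"
      using s dvd[OF _ s(1) F s(6)] by blast
    assume h: "int K < h"
    have "h \<le> k" using dvd[OF h s(1) F s(6)] s(1) by (simp add: zdvd_imp_le)
    then have "h \<le> int (width (edge_at P (conormal e f d c) h))"
      using s(1) unfolding s(6) by simp
    then obtain v where "v \<in> P" "of_int h \<le> conormal e f d c \<bullet> v"
      using minimal_fano_polygon_long_edge[OF min F] by blast
    then show "\<exists>x y. ?pt x y \<in> P \<and> of_int h \<le> of_int d * x - of_int c * y"
      using wp point_at_inner[OF uni] by metis
  next
    fix p q :: real assume "p \<noteq> 0 \<or> q \<noteq> 0"
    then have "?pt p q \<noteq> 0" using inner_point_at[OF uni, of p q] by auto
    then obtain w h where w: "edge_line P w h" "w \<bullet> ?pt p q < 0" using descending_edge_line[OF P] by blast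
    then obtain d c where "w = conormal e f d c"
      using lattice_dual_coords[OF uni] primitive_in_lattice unfolding edge_line_def by metis
    then show "\<exists>d c h. coord_facet P e f d c h \<and> of_int d * p - of_int c * q < 0" using w wp by metis
  qed
qed

lemma point_at_shear:
  assumes "unimodular e f"
  shows "point_at (e + of_int j *\<^sub>R f) f x y = point_at e f (x - of_int j * y) y"
proof (rule coords_eqI[OF assms])
  have u: "unimodular (e + of_int j *\<^sub>R f) f" by (rule unimodular_shear[OF assms])
  show "f \<bullet> point_at (e + of_int j *\<^sub>R f) f x y = f \<bullet> point_at e f (x - of_int j * y) y"
    by (simp add: inner_point_at[OF u] inner_point_at[OF assms])
  have "e = (e + of_int j *\<^sub>R f) - of_int j *\<^sub>R f" by simp
  then have "e \<bullet> point_at (e + of_int j *\<^sub>R f) f x y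
    = ((e + of_int j *\<^sub>R f) - of_int j *\<^sub>R f) \<bullet> point_at (e + of_int j *\<^sub>R f) f x y" by simp
  also have "\<dots> = x - of_int j * y"
    unfolding inner_diff_left inner_scaleR_left inner_point_at[OF u] ..
  finally show "e \<bullet> point_at (e + of_int j *\<^sub>R f) f x y = e \<bullet> point_at e f (x - of_int j * y) y"
    by (simp add: inner_point_at[OF assms])
qed

lemma point_at_flip:
  assumes "unimodular e f" shows "point_at (- e) f x y = point_at e f (- x) y"
  by (rule coords_eqI[OF unimodular_flip[OF assms]])
    (simp_all add: inner_point_at[OF assms] inner_point_at[OF unimodular_flip[OF assms]] del: inner_minus_left, simp add: inner_point_at[OF assms])

text \<open>Put an edge of maximal height \<open>m\<close> at the bottom. If its width is \<open>n * m\<close> with \<open>n \<ge> 2\<close>, a further shear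
  yields a second strip. If \<open>n = 1\<close>, the polygon leans to one side, and a reflection reduces to the
  case of the right-hand side.\<close>

lemma minimal_edge_height_bound:
  assumes min: "minimal_fano_polygon P" and idx: "max_local_index (residual_basket P) \<le> K"
    and K: "3 \<le> K" and e0: "edge_line P w0 h0"
  shows "h0 \<le> 6 * int K"
proof (rule ccontr)
  assume neg: "\<not> h0 \<le> 6 * int K"
  have P: "fano_polygon P" using min by (simp add: minimal_fano_polygon_def)
  let ?S = "snd ` {(w, h). edge_line P w h}"
  have fin: "finite ?S" using finite_edge_lines[OF P] by simp
  have h0: "h0 \<in> ?S" using e0 by force
  define m where "m = Max ?S"
  have m: "h \<le> m" if "edge_line P w h" for w h unfolding m_def using fin that by (intro Max_ge) force+
  have "m \<in> ?S" unfolding m_def using fin h0 by (intro Max_in) auto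
  then obtain w where line: "edge_line P w m" by auto
  have Km: "6 * int K < m" using m[OF e0] neg by simp
  have w: "primitive w" using line by (simp add: edge_line_def)
  have poly: "plane_polygon (int K) m (coord_region P e f) (coord_facet P e f)" if "unimodular e f" for e f
    using min idx K Km m that by (rule plane_polygon_coords)
  have bot: "coord_facet P e w 0 (- 1) m" for e using line by simp
  obtain e0 where uni0: "unimodular e0 w" using unimodular_complement[OF w] .
  obtain x0 y0 k where seg: "1 \<le> k" "0 * x0 - (- 1) * y0 = - m" "coprime x0 y0" "coprime (x0 + k * - 1) (y0 + k * 0)"
    "\<forall>t. coord_region P e0 w (of_int x0 + t * of_int (- 1)) (of_int y0 + t * of_int 0) \<longleftrightarrow> 0 \<le> t \<and> t \<le> of_int k"
    "int K < m \<longrightarrow> m dvd k"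
    using plane_polygon.facet_segment[OF poly[OF uni0] bot] by blast
  have y0: "y0 = - m" using seg(2) by simp
  have cop: "coprime x0 m" "coprime (x0 - k) m" using seg(3,4) y0 by simp_all
  have bottom0: "coord_region P e0 w x (- of_int m) \<longleftrightarrow> of_int (x0 - k) \<le> x \<and> x \<le> of_int x0" for x
    using seg(5)[rule_format, of "of_int x0 - x"] y0 by auto
  (* This shear moves the edge such that (0, - m) is one of its inner points. *)
  define j where "j = (x0 - k) div m + 1"
  define a where "a = m - (x0 - k) mod m"
  define b where "b = k - a"
  define e where "e = e0 + of_int j *\<^sub>R w"
  have uni: "unimodular e w" unfolding e_def by (rule unimodular_shear[OF uni0])
  have m1: "1 < m" using Km K by simp
  have "(x0 - k) mod m \<noteq> 0"
  proof
    assume "(x0 - k) mod m = 0"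
    then have "m dvd x0 - k" by (simp add: dvd_eq_mod_eq_0)
    then have "is_unit m" using cop(2) coprime_common_divisor dvd_refl by blast
    then show False using m1 by simp
  qed
  moreover have "0 \<le> (x0 - k) mod m" "(x0 - k) mod m < m" using m1 by simp_all
  ultimately have a: "0 < a" "a < m" unfolding a_def by linarith+
  have mk: "m dvd k" using seg(6) Km by simp
  then have "m \<le> k" using seg(1) by (simp add: zdvd_imp_le)
  then have b: "0 < b" using a by (simp add: b_def)
  have left: "- a = x0 - k - j * m"
    using div_mult_mod_eq[of "x0 - k" m] by (simp add: a_def j_def algebra_simps)
  have right: "b = x0 - j * m" using left by (simp add: b_def)
  have unit: "coprime (x - i * m) m" if "coprime x m" for x i
  proof (rule coprimeI)
    fix g assume g: "g dvd x - i * m" "g dvd m"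
    then have "g dvd (x - i * m) + i * m" by (intro dvd_add dvd_mult)
    then show "is_unit g" using coprime_common_divisor[OF that _ g(2)] by simp
  qed
  have cops: "coprime a m" "coprime b m"
    using unit[OF cop(2), of j] unit[OF cop(1), of j] unfolding right left[symmetric] by simp_all
  have bottom: "coord_region P e w x (- of_int m) \<longleftrightarrow> - of_int a \<le> x \<and> x \<le> of_int b" for x
  proof -
    have "coord_region P e w x (- of_int m) \<longleftrightarrow> of_int (x0 - k) \<le> x + of_int j * of_int m \<and> x + of_int j * of_int m \<le> of_int x0"
      unfolding e_def point_at_shear[OF uni0] using bottom0[of "x + of_int j * of_int m"] by simp
    moreover have "real_of_int (- a) = of_int (x0 - k) - of_int j * of_int m" "real_of_int b = of_int x0 - of_int j * of_int m"
      unfolding left right by simp_all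
    ultimately show ?thesis by auto
  qed
  have sheared: "polygon_on_edge (int K) m (coord_region P (e + of_int i *\<^sub>R w) w) (coord_facet P (e + of_int i *\<^sub>R w) w)
      (a + i * m) (b - i * m)" if i: "0 < a + i * m" "0 < b - i * m" for i
  proof -
    interpret plane_polygon "int K" m "coord_region P (e + of_int i *\<^sub>R w) w" "coord_facet P (e + of_int i *\<^sub>R w) w"
      by (rule poly[OF unimodular_shear[OF uni]])
    show ?thesis
    proof
      show "0 < a + i * m" "0 < b - i * m" by fact+
      show "coprime (a + i * m) m" using unit[OF cops(1), of "- i"] by simp
      show "coprime (b - i * m) m" by (rule unit[OF cops(2)])
      show "coord_facet P (e + of_int i *\<^sub>R w) w 0 (- 1) m" by (rule bot)
      show "coord_region P (e + of_int i *\<^sub>R w) w x (- of_int m) \<longleftrightarrow>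
         - of_int (a + i * m) \<le> x \<and> x \<le> of_int (b - i * m)" for x
        unfolding point_at_shear[OF uni] using bottom[of "x + of_int i * of_int m"] by auto
    qed
  qed
  obtain n where n: "k = m * n" using mk by (elim dvdE)
  have ab: "a + b = n * m" by (simp add: b_def n)
  have "0 < n" using zero_less_mult_pos[of m n] seg(1) n m1 by simp
  interpret E: polygon_on_edge "int K" m "coord_region P e w" "coord_facet P e w" a b
    using sheared[of 0] a b by simp
  have "n = 1"
  proof (rule ccontr)
    assume "n \<noteq> 1"
    then have n2: "2 \<le> n" using \<open>0 < n\<close> by simp
    have bn: "b - (n - 1) * m = m - a" using ab by (simp add: algebra_simps)
    have "0 \<le> (n - 1) * m" using n2 m1 by simp
    then have pos: "0 < a + (n - 1) * m" "0 < b - (n - 1) * m" using a bn by linarith+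
    interpret S: polygon_on_edge "int K" m "coord_region P (e + of_int (n - 1) *\<^sub>R w) w"
      "coord_facet P (e + of_int (n - 1) *\<^sub>R w) w" "a + (n - 1) * m" "b - (n - 1) * m"
      by (rule sheared[OF pos])
    show False
    proof (rule E.not_two_strips[OF ab n2])
      fix x y assume "coord_region P e w x y"
      then have "coord_region P (e + of_int (n - 1) *\<^sub>R w) w (x + of_int (n - 1) * y) y"
        unfolding point_at_shear[OF uni] by simp
      then show "x + of_int (n - 1) * y \<le> of_int (m - a)" using S.strip(2) bn by metis
    qed
  qed
  then have wid: "a + b = m" using ab by simp
  interpret N: narrow_polygon "int K" m "coord_region P e w" "coord_facet P e w" a b
    by unfold_locales (rule wid)
  show False
  proof (cases "\<forall>x y. coord_region P e w x y \<longrightarrow> of_int m \<le> y \<longrightarrow> 0 \<le> x")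
    case True
    interpret right_leaning_polygon "int K" m "coord_region P e w" "coord_facet P e w" a b
      by unfold_locales (use True in blast)
    show False by (rule impossible)
  next
    case False
    then have le: "x \<le> 0" if "coord_region P e w x y" "of_int m \<le> y" for x y
      using N.high_points_one_sided that by (meson linorder_not_le)
    interpret plane_polygon "int K" m "coord_region P (- e) w" "coord_facet P (- e) w"
      by (rule poly[OF unimodular_flip[OF uni]])
    interpret right_leaning_polygon "int K" m "coord_region P (- e) w" "coord_facet P (- e) w" b a
    proof
      show "coord_facet P (- e) w 0 (- 1) m" by (rule bot)
      show "coord_region P (- e) w x (- of_int m) \<longleftrightarrow> - of_int b \<le> x \<and> x \<le> of_int a" for x
        unfolding point_at_flip[OF uni] using bottom[of "- x"] by auto
      show "0 \<le> x" if "coord_region P (- e) w x y" "of_int m \<le> y" for x y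
        using le[of "- x" y] that unfolding point_at_flip[OF uni] by simp
    qed (use a b cops wid in auto)
    show False by (rule impossible)
  qed
qed

section \<open>Finitely many normal forms\<close>

lemma vertex_in_direction:
  assumes "fano_polygon P" "a \<noteq> 0" obtains v where "v extreme_point_of P" "a \<bullet> v > 0"
proof -
  have "\<exists>v. v extreme_point_of P \<and> a \<bullet> v > 0"
  proof (rule ccontr)
    assume "\<not> ?thesis"
    then have "convex hull {v. v extreme_point_of P} \<subseteq> {x. a \<bullet> x \<le> 0}"
      by (intro hull_minimal) (auto simp: convex_halfspace_le not_less)
    then have le: "a \<bullet> x \<le> 0" if "x \<in> P" for x using fano_polygonD(8)[OF assms(1)] that by auto
    obtain r where r: "r > 0" "ball 0 r \<subseteq> P"
      using fano_polygonD(7)[OF assms(1)] mem_interior by blast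
    have "(r / (2 * norm a)) *\<^sub>R a \<in> ball 0 r" using r assms(2) by simp
    then have "a \<bullet> ((r / (2 * norm a)) *\<^sub>R a) \<le> 0" using le r by blast
    moreover have "a \<bullet> ((r / (2 * norm a)) *\<^sub>R a) > 0" using r assms(2) by simp
    ultimately show False by simp
  qed
  then show thesis using that by blast
qed

text \<open>The origin is a convex combination of at most three vertices, so some vertex \<open>v\<close> has weight at least
  \<open>1/3\<close>, and the others balance it at a multiple of \<open>- v\<close> that is at least \<open>1/2\<close>.\<close>

lemma vertex_with_opposite_half:
  assumes "fano_polygon P" obtains v where "v extreme_point_of P" "- (1/2) *\<^sub>R v \<in> P"
proof -
  note P = fano_polygonD[OF assms]
  let ?X = "{v. v extreme_point_of P}"
  have XP: "?X \<subseteq> P" by (auto simp: extreme_point_of_def)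
  have "0 \<in> convex hull ?X" using P(6,8) by auto
  then have "0 \<in> {x. \<exists>S. finite S \<and> S \<subseteq> ?X \<and> card S \<le> DIM(real^2) + 1 \<and> x \<in> convex hull S}"
    by (subst (asm) caratheodory)
  then obtain S where S: "finite S" "S \<subseteq> ?X" "card S \<le> 3" "0 \<in> convex hull S" by auto
  then obtain u where u: "\<forall>x\<in>S. 0 \<le> u x" "sum u S = 1" "(\<Sum>x\<in>S. u x *\<^sub>R x) = 0"
    unfolding convex_hull_finite[OF S(1)] by blast
  obtain v where v: "v \<in> S" "1/3 \<le> u v"
  proof (rule ccontr)
    assume "\<not> thesis"
    then have lt: "u x < 1/3" if "x \<in> S" for x using that \<open>\<And>v. v \<in> S \<Longrightarrow> 1/3 \<le> u v \<Longrightarrow> thesis\<close> by fastforce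
    have "S \<noteq> {}" using u(2) by auto
    then have "sum u S < (\<Sum>x\<in>S. 1/3)" using S(1) lt by (intro sum_strict_mono) auto
    also have "\<dots> \<le> 1" using S(3) by simp
    finally show False using u(2) by simp
  qed
  (* coefficients of - v / 2, where the weight left over goes to the origin, which takes the place of v *)
  define c where "c x = (if x = v then 1 - (\<Sum>y\<in>S - {v}. u y / (2 * u v)) else u x / (2 * u v))" for x
  have rest: "sum u (S - {v}) = 1 - u v" using u(2) v(1) S(1) by (simp add: sum_diff1)
  have "(\<Sum>y\<in>S - {v}. u y / (2 * u v)) = (1 - u v) / (2 * u v)"
    unfolding rest[symmetric] by (simp add: sum_divide_distrib)
  also have "\<dots> \<le> 1" using v(2) by (simp add: divide_le_eq)
  finally have cv: "0 \<le> c v" by (simp add: c_def)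
  have c: "0 \<le> c x" if "x \<in> S" for x using cv u(1) v(2) that by (cases "x = v") (auto simp: c_def)
  have "sum c S = c v + sum c (S - {v})" using S(1) v(1) by (rule sum.remove)
  also have "sum c (S - {v}) = (\<Sum>y\<in>S - {v}. u y / (2 * u v))" by (intro sum.cong) (auto simp: c_def)
  finally have c1: "sum c S = 1" by (simp add: c_def)
  let ?g = "\<lambda>x. if x = v then 0 else x"
  have "(\<Sum>x\<in>S. c x *\<^sub>R ?g x) \<in> P"
    using c P(6) S(2) XP by (intro convex_sum[OF S(1) P(2) c1]) auto
  moreover have "(\<Sum>x\<in>S. c x *\<^sub>R ?g x) = (\<Sum>x\<in>S - {v}. (1 / (2 * u v)) *\<^sub>R (u x *\<^sub>R x))"
    unfolding sum.remove[OF S(1) v(1)] by (simp add: c_def)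
  moreover have "\<dots> = (1 / (2 * u v)) *\<^sub>R (- u v *\<^sub>R v)"
  proof -
    have "(\<Sum>x\<in>S - {v}. u x *\<^sub>R x) = - u v *\<^sub>R v"
      using u(3) unfolding sum.remove[OF S(1) v(1)] by (simp add: eq_neg_iff_add_eq_0 add.commute)
    then show ?thesis by (simp only: scaleR_sum_right[symmetric])
  qed
  moreover have "\<dots> = - (1/2) *\<^sub>R v" using v(2) by simp
  ultimately have "- (1/2) *\<^sub>R v \<in> P" by (simp only:)
  then show thesis using that[of v] v(1) S(2) by blast
qed

lemma GL2Z_mult: "A \<in> GL2Z \<Longrightarrow> B \<in> GL2Z \<Longrightarrow> A ** B \<in> GL2Z"
  unfolding GL2Z_def mem_Collect_eq det_mul abs_mult by (simp add: matrix_matrix_mult_def sum_2)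

lemma GL2Z_inverse:
  assumes "A \<in> GL2Z" obtains B where "B \<in> GL2Z" "\<And>v. B *v (A *v v) = v"
proof -
  have uni: "unimodular (A$1) (A$2)" using assms by (simp add: GL2Z_unimodular)
  let ?p = "point_at (A$1) (A$2)"
  define B :: "real^2^2" where "B = (\<chi> i. vector [?p 1 0 $ i, ?p 0 1 $ i])"
  have Bv: "B *v z = ?p (z$1) (z$2)" for z
  proof -
    have "?p (z$1) (z$2) = ?p (z$1 * 1 + z$2 * 0) (z$1 * 0 + z$2 * 1)" by simp
    also have "\<dots> = z$1 *\<^sub>R ?p 1 0 + z$2 *\<^sub>R ?p 0 1" by (simp only: point_at_linear)
    finally show ?thesis
      by (simp add: eq2 matrix_vector_mul_component inner2 B_def mult.commute)
  qed
  have "A *v (B *v z) = z" for z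
    by (simp add: eq2[of "A *v _"] matrix_vector_mul_component Bv inner_point_at[OF uni])
  then have "A ** B = mat 1" unfolding matrix_eq by (simp add: matrix_vector_mul_assoc[symmetric])
  then have "det A * det B = 1" by (metis det_mul det_I)
  then have "\<bar>det A\<bar> * \<bar>det B\<bar> = 1" by (metis abs_mult abs_one)
  then have "\<bar>det B\<bar> = 1" using assms by (simp add: GL2Z_def)
  moreover have "\<forall>i j. B $ i $ j \<in> \<int>"
  proof -
    have "?p 1 0 \<in> lattice" "?p 0 1 \<in> lattice" by (simp_all add: point_at_lattice[OF uni])
    then show ?thesis by (simp add: forall_2 B_def lattice2)
  qed
  ultimately have "B \<in> GL2Z" by (simp add: GL2Z_def)
  moreover have "B *v (A *v v) = v" for v
    unfolding Bv by (simp add: matrix_vector_mul_component point_at_inner[OF uni])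
  ultimately show thesis using that by blast
qed

lemma equiv_gl2z_rel: "equiv UNIV gl2z_rel"
proof (rule equivI)
  show "refl gl2z_rel" by (simp add: refl_on_def gl2z_rel_refl)
  show "sym gl2z_rel"
  proof (rule symI)
    fix X Y assume "(X, Y) \<in> gl2z_rel"
    then obtain A where A: "A \<in> GL2Z" "Y = (\<lambda>v. A *v v) ` X" by (auto simp: gl2z_rel_def)
    obtain B where B: "B \<in> GL2Z" "\<And>v. B *v (A *v v) = v" using GL2Z_inverse[OF A(1)] by blast
    have "X = (\<lambda>v. B *v v) ` Y" unfolding A(2) image_image B(2) by simp
    then show "(Y, X) \<in> gl2z_rel" using B(1) by (auto simp: gl2z_rel_def)
  qed
  show "trans gl2z_rel"
  proof (rule transI)
    fix X Y Z assume "(X, Y) \<in> gl2z_rel" "(Y, Z) \<in> gl2z_rel"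
    then obtain A B where "A \<in> GL2Z" "B \<in> GL2Z" "Y = (\<lambda>v. A *v v) ` X" "Z = (\<lambda>v. B *v v) ` Y"
      by (auto simp: gl2z_rel_def)
    then have "B ** A \<in> GL2Z" "Z = (\<lambda>v. (B ** A) *v v) ` X"
      by (auto simp: GL2Z_mult image_image matrix_vector_mul_assoc)
    then show "(X, Z) \<in> gl2z_rel" by (auto simp: gl2z_rel_def)
  qed
qed auto

definition polygon_of_normals :: "(int \<times> int \<times> int) set \<Rightarrow> (real^2) set" where
  "polygon_of_normals T = {z. \<forall>(d, c, h)\<in>T. - of_int h \<le> of_int d * z$1 - of_int c * z$2}"

text \<open>Choose the coordinates so that the vertex \<open>v\<close> with \<open>- v / 2\<close> in the polygon is \<open>(1, 0)\<close>. These two points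
  bound the first coordinate of all normals. After a shear, a vertex \<open>(p, q)\<close> above the axis satisfies
  \<open>0 \<le> p \<le> q\<close> and bounds the second coordinate on one side. On the other side it is bounded by a
  vertex \<open>(p', - q')\<close> below the axis: its slope \<open>p' / q'\<close> is controlled because the segment between the
  two vertices meets the axis inside the polygon, where \<open>\<bar>x\<bar> \<le> H\<close>. As \<open>q\<close> and \<open>q'\<close> are integers, no lower
  bound on them is needed, and the normals and heights come from a finite set.\<close>

lemma bounded_height_normal_form:
  fixes H :: int
  assumes P: "fano_polygon P" and H: "1 \<le> H" "\<And>w h. edge_line P w h \<Longrightarrow> h \<le> H"
  defines "B \<equiv> H + 2 * H * (2 * H + 1)"
  obtains T where "T \<subseteq> {-B..B} \<times> {-B..B} \<times> {0..H}" "(P, polygon_of_normals T) \<in> gl2z_rel"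
proof -
  obtain v where v: "v extreme_point_of P" "- (1/2) *\<^sub>R v \<in> P" using vertex_with_opposite_half[OF P] .
  have vP: "v \<in> P" using v(1) by (simp add: extreme_point_of_def)
  have prim: "primitive v" by (rule fano_polygonD(10)[OF P v(1)])
  define f where "f = rot v"
  obtain z where z: "z \<in> lattice" "v \<bullet> z = 1" using primitive_dual[OF prim] .
  have fl: "f \<in> lattice" "f \<noteq> 0" using prim primitive_in_lattice primitive_nonzero unfolding f_def by simp_all
  have uz: "unimodular z f" using z fl by (simp add: unimodular_def f_def inner2 mult.commute)
  have fv: "f \<bullet> v = 0" by (simp add: f_def inner_commute)
  obtain t where t: "t extreme_point_of P" "f \<bullet> t > 0" using vertex_in_direction[OF P fl(2)] .
  obtain p0 q where pq0: "z \<bullet> t = of_int p0" "f \<bullet> t = of_int q"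
    using primitive_coords[OF uz fano_polygonD(10)[OF P t(1)]] by blast
  have q: "1 \<le> q" using t(2) pq0(2) by simp
  define e where "e = z + of_int (- (p0 div q)) *\<^sub>R f"
  have uni: "unimodular e f" unfolding e_def by (rule unimodular_shear[OF uz])
  have ev: "e \<bullet> v = 1"
    unfolding e_def inner_add_left inner_scaleR_left fv using z(2) by (simp add: inner_commute[of z])
  define p where "p = p0 mod q"
  have "p = p0 - (p0 div q) * q" by (simp add: p_def minus_div_mult_eq_mod)
  then have et: "e \<bullet> t = of_int p" using pq0 by (simp add: e_def inner_add_left inner_diff_left)
  have p: "0 \<le> p" "p \<le> q" using q by (simp_all add: p_def less_imp_le)
  have tP: "t \<in> P" using t(1) by (simp add: extreme_point_of_def)
  have "- f \<noteq> 0" using fl(2) by simp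
  then obtain s where s: "s extreme_point_of P" "(- f) \<bullet> s > 0" using vertex_in_direction[OF P] by blast
  obtain p' q0 where pq1: "e \<bullet> s = of_int p'" "f \<bullet> s = of_int q0"
    using primitive_coords[OF uni fano_polygonD(10)[OF P s(1)]] by blast
  define q' where "q' = - q0"
  have q': "1 \<le> q'" "f \<bullet> s = - of_int q'" using s(2) pq1(2) by (simp_all add: q'_def)
  have sP: "s \<in> P" using s(1) by (simp add: extreme_point_of_def)
  have line: "\<bar>X\<bar> \<le> of_int H" if X: "X *\<^sub>R v \<in> P" for X
  proof -
    have *: "Y \<le> of_int H" if Y: "Y *\<^sub>R u \<in> P" "primitive u" for Y u
    proof (cases "0 \<le> Y")
      case True
      obtain w h where w: "edge_line P w h" "w \<bullet> u < 0"
        using descending_edge_line[OF P primitive_nonzero[OF Y(2)]] .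
      have "w \<bullet> u \<in> \<int>" using w(1) Y(2) by (simp add: edge_line_def primitive_in_lattice lattice_inner)
      then obtain i where i: "w \<bullet> u = of_int i" by (rule Ints_cases)
      then have "i \<le> - 1" using w(2) by simp
      then have "Y * of_int i \<le> Y * (- 1)" using True by (intro mult_left_mono) auto
      moreover have "- of_int h \<le> w \<bullet> (Y *\<^sub>R u)" using w(1) Y(1) unfolding edge_line_def by blast
      moreover have "real_of_int h \<le> of_int H" using H(2)[OF w(1)] by simp
      ultimately show ?thesis by (simp add: i)
    next
      case False
      then have "Y \<le> 0" by simp
      also have "0 \<le> real_of_int H" using H(1) by simp
      finally show ?thesis .
    qed
    have "(- X) *\<^sub>R (- v) \<in> P" using X by simp
    then have "- X \<le> of_int H" using *[of "- X" "- v"] prim primitive_uminus by blast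
    moreover have "X \<le> of_int H" using *[OF X prim] .
    ultimately show ?thesis by simp
  qed
  have slope: "\<bar>p'\<bar> \<le> (2 * H + 1) * q'"
  proof -
    let ?u = "real_of_int q / of_int (q + q')" and ?X = "real_of_int (q' * p + q * p') / of_int (q + q')"
    have pos: "0 < real_of_int (q + q')" using q q'(1) by linarith
    have u: "0 \<le> ?u" "?u \<le> 1" using q q'(1) by (auto simp: divide_le_eq)
    have u1: "1 - ?u = of_int q' / of_int (q + q')" using pos by (simp add: field_simps)
    have "(1 - ?u) *\<^sub>R t + ?u *\<^sub>R s \<in> P" using fano_polygonD(2)[OF P] tP sP u by (intro convexD_alt)
    moreover have "(1 - ?u) *\<^sub>R t + ?u *\<^sub>R s = ?X *\<^sub>R v"
    proof (rule coords_eqI[OF uni])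
      show "e \<bullet> ((1 - ?u) *\<^sub>R t + ?u *\<^sub>R s) = e \<bullet> (?X *\<^sub>R v)"
        unfolding u1 by (simp add: inner_add_right et pq1(1) ev add_divide_distrib)
      show "f \<bullet> ((1 - ?u) *\<^sub>R t + ?u *\<^sub>R s) = f \<bullet> (?X *\<^sub>R v)"
        unfolding u1 by (simp add: inner_add_right pq0(2) q'(2) fv)
    qed
    ultimately have "\<bar>?X\<bar> \<le> of_int H" using line by metis
    then have "\<bar>real_of_int (q' * p + q * p')\<bar> \<le> of_int H * of_int (q + q')"
      using pos by (simp only: abs_divide abs_of_pos pos_divide_le_eq)
    then have "real_of_int \<bar>q' * p + q * p'\<bar> \<le> of_int (H * (q + q'))" by simp
    then have X: "\<bar>q' * p + q * p'\<bar> \<le> H * (q + q')" by (simp only: of_int_le_iff)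
    have "q * \<bar>p'\<bar> = \<bar>q * p'\<bar>" using q by (simp add: abs_mult)
    also have "\<dots> \<le> H * (q + q') + q' * p" using X q'(1) p(1) mult_nonneg_nonneg[of q' p] by linarith
    also have "\<dots> \<le> H * (2 * (q * q')) + q' * q"
    proof (intro add_mono mult_left_mono)
      have "q * 1 \<le> q * q'" "1 * q' \<le> q * q'" using q q'(1) by (intro mult_left_mono mult_right_mono; simp)+
      then show "q + q' \<le> 2 * (q * q')" by simp
    qed (use H(1) p q'(1) in auto)
    also have "\<dots> = q * ((2 * H + 1) * q')" by (simp add: algebra_simps)
    finally show ?thesis using q by (simp add: mult_le_cancel_left)
  qed
  define T where "T = {(d, c, h). coord_facet P e f d c h}"
  have "T \<subseteq> {-B..B} \<times> {-B..B} \<times> {0..H}"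
  proof (clarsimp simp: T_def)
    fix d c h assume F: "coord_facet P e f d c h"
    let ?w = "conormal e f d c"
    have ge: "- real_of_int h \<le> of_int d * (e \<bullet> x) - of_int c * (f \<bullet> x)" if "x \<in> P" for x
      using F that unfolding edge_line_def by (simp add: inner_diff_left)
    have h: "0 < h" "h \<le> H" using edge_line_height_pos[OF P F] H(2)[OF F] by auto
    have d1: "- h \<le> d" using ge[OF vP] by (simp add: ev fv)
    have "- real_of_int h \<le> of_int d * (- (1/2))" using ge[OF v(2)] by (simp add: ev fv)
    then have "d \<le> 2 * h" by linarith
    then have d: "\<bar>d\<bar> \<le> 2 * H" using d1 h by simp
    have "- real_of_int h \<le> of_int (d * p - c * q)" using ge[OF tP] by (simp add: et pq0(2))
    then have "real_of_int (- h) \<le> of_int (d * p - c * q)" by simp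
    then have "- h \<le> d * p - c * q" by (simp only: of_int_le_iff)
    then have top: "c * q \<le> h + d * p" by simp
    have "d * p \<le> \<bar>d\<bar> * p" using p(1) by (intro mult_right_mono) auto
    also have "\<dots> \<le> 2 * H * q" using d p H(1) by (intro mult_mono) auto
    finally have "c * q \<le> H * 1 + 2 * H * q" using top h by simp
    also have "\<dots> \<le> H * q + 2 * H * q" using q H(1) by (intro add_right_mono mult_left_mono) auto
    finally have "c * q \<le> (3 * H) * q" by (simp add: algebra_simps)
    then have c1: "c \<le> 3 * H" using q by (simp add: mult_le_cancel_right)
    have "- real_of_int h \<le> of_int (d * p' + c * q')" using ge[OF sP] by (simp add: pq1(1) q'(2))
    then have "real_of_int (- h) \<le> of_int (d * p' + c * q')" by simp
    then have "- h \<le> d * p' + c * q'" by (simp only: of_int_le_iff)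
    then have bot: "- c * q' \<le> h + d * p'" by simp
    have "d * p' \<le> \<bar>d\<bar> * \<bar>p'\<bar>" by (simp add: abs_mult[symmetric])
    also have "\<dots> \<le> 2 * H * ((2 * H + 1) * q')" using d slope H(1) by (intro mult_mono) auto
    finally have "- c * q' \<le> H * 1 + 2 * H * ((2 * H + 1) * q')" using bot h by simp
    also have "\<dots> \<le> H * q' + 2 * H * ((2 * H + 1) * q')" using q'(1) H(1) by (intro add_right_mono mult_left_mono) auto
    finally have "- c * q' \<le> B * q'" by (simp add: B_def algebra_simps)
    then have c2: "- c \<le> B" using q'(1) by (simp only: mult_le_cancel_right)
    have "1 * 1 \<le> H * H" using H(1) by (intro mult_mono) auto
    then have B3: "3 * H \<le> B" "2 * H \<le> B" using H(1) by (auto simp: B_def algebra_simps)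
    show "- B \<le> d \<and> d \<le> B \<and> - B \<le> c \<and> c \<le> B \<and> 0 \<le> h \<and> h \<le> H" using d c1 c2 B3 h by auto
  qed
  moreover have "(P, polygon_of_normals T) \<in> gl2z_rel"
  proof -
    define A :: "real^2^2" where "A = vector [e, f]"
    have A: "A$1 = e" "A$2 = f" by (simp_all add: A_def)
    have "A \<in> GL2Z" using uni by (simp add: GL2Z_unimodular A)
    moreover have "polygon_of_normals T = (\<lambda>x. A *v x) ` P"
    proof (intro equalityI subsetI)
      fix x assume x: "x \<in> polygon_of_normals T"
      have "point_at e f (x$1) (x$2) \<in> P"
      proof (rule fano_polygon_halfspaces[OF P])
        fix w h assume w: "edge_line P w h"
        then obtain d c where dc: "w = conormal e f d c"
          using lattice_dual_coords[OF uni] primitive_in_lattice unfolding edge_line_def by metis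
        then have "(d, c, h) \<in> T" using w by (simp add: T_def)
        then have "- of_int h \<le> of_int d * x$1 - of_int c * x$2" using x by (auto simp: polygon_of_normals_def)
        then show "- of_int h \<le> w \<bullet> point_at e f (x$1) (x$2)"
          by (simp add: dc inner_diff_left inner_point_at[OF uni])
      qed
      moreover have "x = A *v point_at e f (x$1) (x$2)"
        by (simp add: eq2[of x] matrix_vector_mul_component A inner_point_at[OF uni])
      ultimately show "x \<in> (\<lambda>x. A *v x) ` P" by blast
    next
      fix x assume "x \<in> (\<lambda>x. A *v x) ` P"
      then obtain y where y: "y \<in> P" "x = A *v y" by blast
      have xy: "x$1 = e \<bullet> y" "x$2 = f \<bullet> y" by (simp_all add: y(2) matrix_vector_mul_component A)
      show "x \<in> polygon_of_normals T"
        unfolding polygon_of_normals_def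
      proof (clarsimp simp: T_def xy)
        fix d c h assume "coord_facet P e f d c h"
        then show "- real_of_int h \<le> of_int d * (e \<bullet> y) - of_int c * (f \<bullet> y)"
          using y(1) unfolding edge_line_def by (simp add: inner_diff_left)
      qed
    qed
    ultimately show ?thesis by (auto simp: gl2z_rel_def)
  qed
  ultimately show thesis using that by blast
qed

theorem theorem6p3:
  fixes K :: nat
  assumes "0 < K"
  shows "finite ({P. minimal_fano_polygon P \<and> max_local_index (residual_basket P) \<le> K} // gl2z_rel)"
proof -
  define H where "H = 6 * int (max K 3)"
  define B where "B = H + 2 * H * (2 * H + 1)"
  let ?T = "Pow ({-B..B} \<times> {-B..B} \<times> {0..H})"
  have "{P. minimal_fano_polygon P \<and> max_local_index (residual_basket P) \<le> K} // gl2z_rel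
      \<subseteq> (\<lambda>T. gl2z_rel `` {polygon_of_normals T}) ` ?T"
  proof
    fix C assume "C \<in> {P. minimal_fano_polygon P \<and> max_local_index (residual_basket P) \<le> K} // gl2z_rel"
    then obtain P where P: "minimal_fano_polygon P" "max_local_index (residual_basket P) \<le> K"
      and C: "C = gl2z_rel `` {P}" by (auto elim!: quotientE)
    have idx: "max_local_index (residual_basket P) \<le> max K 3" using P(2) by simp
    have "h \<le> H" if "edge_line P w h" for w h
      using minimal_edge_height_bound[OF P(1) idx _ that] by (simp add: H_def)
    moreover have "fano_polygon P" "1 \<le> H" using P(1) by (simp_all add: minimal_fano_polygon_def H_def)
    ultimately obtain T where T: "T \<in> ?T" "(P, polygon_of_normals T) \<in> gl2z_rel"
      using bounded_height_normal_form[of P H] unfolding B_def by blast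
    then have "C = gl2z_rel `` {polygon_of_normals T}" unfolding C by (intro equiv_class_eq[OF equiv_gl2z_rel])
    then show "C \<in> (\<lambda>T. gl2z_rel `` {polygon_of_normals T}) ` ?T" using T(1) by blast
  qed
  then show ?thesis by (rule finite_subset) simp
qed

end
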